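(* Let $\lambda,\mu,\gamma,\alpha,\beta\in\mathbb{C}^\ast$, $z\in\mathbb{C}\setminus(-\infty,1]$. Then one has the following Laplace-type integral representation of the Jacobi function of the second kind: $$(z-1)^{\lambda+\frac12\mu}(z+1)^{\frac12\mu}Q_{\gamma-\lambda-\mu}^{(\alpha+2\lambda+\mu,\beta+\mu)}(z)=\frac{2^{2\beta+\lambda+\mu}\Gamma(\beta)\Gamma(\lambda+1)\Gamma(\mu+1)\Gamma(\alpha+\gamma+1)\Gamma(\alpha+\beta+\gamma+1)}{\Gamma(\alpha-\beta+\lambda)\Gamma(2\beta+\mu)\Gamma(\gamma-\lambda-\mu+1)\Gamma(\alpha+\beta+\gamma+\lambda+\mu+1)}$$ $$\times\int_1^\infty\int_1^\infty P_\lambda^{(\alpha-\beta-1,\beta+\mu)}(2w^2-1)\,C_\mu^{\beta}(x)\,\frac{w^{2\beta+\mu+1}(w^2-1)^{\alpha-\beta-1}(x^2-1)^{\beta-\frac12}}{\left(z+\sqrt{z^2-1}\,xw+\frac12(z-1)(w^2-1)\right)^{\alpha+\beta+\gamma+1}}\,dw\,dx .$$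
   Context: $\mathbb{C}^\ast=\mathbb{C}\setminus\{0\}$. Let $\mathbf{F}(a,b;c;z)=\sum_{n\ge0}\frac{(a)_n(b)_n}{\Gamma(c+n)}\frac{z^n}{n!}$ (continued analytically) be the regularized Gauss hypergeometric function. Jacobi function of the second kind: $Q_\gamma^{(\alpha,\beta)}(z)=\frac{2^{\alpha+\beta+\gamma}\Gamma(\alpha+\gamma+1)\Gamma(\beta+\gamma+1)}{(z-1)^{\alpha+\gamma+1}(z+1)^\beta}\mathbf{F}\big(\gamma+1,\alpha+\gamma+1;\alpha+\beta+2\gamma+2;\frac{2}{1-z}\big)$. Jacobi function of the first kind, $z\in\mathbb{C}\setminus(-\infty,-1]$: $P_\gamma^{(\alpha,\beta)}(z)=\frac{\Gamma(\alpha+\gamma+1)}{\Gamma(\gamma+1)}\mathbf{F}\big(-\gamma,\alpha+\beta+\gamma+1;\alpha+1;\frac{1-z}{2}\big)$. Gegenbauer function of the first kind: $C_\lambda^\alpha(z)=\frac{\sqrt\pi\,\Gamma(2\alpha+\lambda)}{2^{2\alpha-1}\Gamma(\alpha)\Gamma(\lambda+1)}\mathbf{F}\big(-\lambda,2\alpha+\lambda;\alpha+\frac12;\frac{1-z}{2}\big)$.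
   Formalization: Assumes in addition that the double integral converges absolutely, that no Gamma factor in a numerator is at a pole, and that Re β > −1/2 and Re(α−β) > 0; the square root of z²−1 is √(z−1)·√(z+1). Without such conditions the formula is undefined or false. *)

theory Defs
  imports "HOL-Analysis.Analysis"
begin

(* Here rGamma is the entire function 1 / Gamma, so the series is defined for every c.  It converges
   on the unit disc, and its sum extends analytically to the complement of [1,\<infinity>).  That domain is
   connected and contains the disc, so the extension is unique on it; on the cut [1,\<infinity>) itself
   hyp_reg carries no information. *)
definition hyp_reg :: "complex \<Rightarrow> complex \<Rightarrow> complex \<Rightarrow> complex \<Rightarrow> complex" where
  "hyp_reg a b c =
    (SOME f. f holomorphic_on - (complex_of_real ` {1..}) \<and>
       (\<forall>z\<in>ball 0 1. f z =
          (\<Sum>n. pochhammer a n * pochhammer b n * rGamma (c + of_nat n) * z ^ n / fact n)))"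

(* All powers below are principal: powr is exp (s * Ln z).  The library sets Gamma to 0 at its poles
   and x / 0 to 0, so a Gamma in a denominator stands for the entire function 1 / Gamma, whereas a
   pole of a Gamma in a numerator has to be excluded wherever these functions are used. *)

definition jacobi_Q :: "complex \<Rightarrow> complex \<Rightarrow> complex \<Rightarrow> complex \<Rightarrow> complex" where
  "jacobi_Q \<gamma> \<alpha> \<beta> z =
     2 powr (\<alpha> + \<beta> + \<gamma>) * Gamma (\<alpha> + \<gamma> + 1) * Gamma (\<beta> + \<gamma> + 1)
       / ((z - 1) powr (\<alpha> + \<gamma> + 1) * (z + 1) powr \<beta>)
     * hyp_reg (\<gamma> + 1) (\<alpha> + \<gamma> + 1) (\<alpha> + \<beta> + 2 * \<gamma> + 2) (2 / (1 - z))"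

definition jacobi_P :: "complex \<Rightarrow> complex \<Rightarrow> complex \<Rightarrow> complex \<Rightarrow> complex" where
  "jacobi_P \<gamma> \<alpha> \<beta> z =
     Gamma (\<alpha> + \<gamma> + 1) / Gamma (\<gamma> + 1)
     * hyp_reg (- \<gamma>) (\<alpha> + \<beta> + \<gamma> + 1) (\<alpha> + 1) ((1 - z) / 2)"

definition gegenbauer_C :: "complex \<Rightarrow> complex \<Rightarrow> complex \<Rightarrow> complex" where
  "gegenbauer_C \<mu> \<alpha> z =
     of_real (sqrt pi) * Gamma (2 * \<alpha> + \<mu>)
       / (2 powr (2 * \<alpha> - 1) * Gamma \<alpha> * Gamma (\<mu> + 1))
     * hyp_reg (- \<mu>) (2 * \<alpha> + \<mu>) (\<alpha> + 1 / 2) ((1 - z) / 2)"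

(* The branch of the square root of z^2 - 1 that is analytic off (-\<infinity>,1] and positive for z > 1.
   It differs in sign from csqrt (z^2 - 1) when Re z < 0. *)
definition sqrt_sq_minus_1 :: "complex \<Rightarrow> complex" where
  "sqrt_sq_minus_1 z = csqrt (z - 1) * csqrt (z + 1)"

(* The base of the power in the denominator is never in (-\<infinity>,0] for z off (-\<infinity>,1] and w, x > 1, so
   the principal power is analytic in z there. *)
definition laplace_integrand ::
    "complex \<Rightarrow> complex \<Rightarrow> complex \<Rightarrow> complex \<Rightarrow> complex \<Rightarrow> complex \<Rightarrow> real \<Rightarrow> real \<Rightarrow> complex" where
  "laplace_integrand lam \<mu> \<gamma> \<alpha> \<beta> z w x =
     jacobi_P lam (\<alpha> - \<beta> - 1) (\<beta> + \<mu>) (of_real (2 * w\<^sup>2 - 1))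
     * gegenbauer_C \<mu> \<beta> (of_real x)
     * (of_real w powr (2 * \<beta> + \<mu> + 1)
        * of_real (w\<^sup>2 - 1) powr (\<alpha> - \<beta> - 1)
        * of_real (x\<^sup>2 - 1) powr (\<beta> - 1 / 2)
        / (z + sqrt_sq_minus_1 z * of_real x * of_real w
             + (z - 1) * of_real (w\<^sup>2 - 1) / 2) powr (\<alpha> + \<beta> + \<gamma> + 1))"

end

theory Submission
  imports Defs "HOL-Complex_Analysis.Complex_Analysis"
begin

text \<open>For real parameters near $\lambda = -1/2$, $\mu = -1/4$, $\beta = 1$, $\alpha = 2$, for real $z > 1$ and a
  large exponent $s = \alpha + \beta + \gamma + 1$, both special functions in the integrand are fractional
  integrals with positive kernels: the Jacobi function of powers, the Gegenbauer function of
  $\cosh((\beta+\mu)\varphi)$.  All integrands are then positive, so Tonelli's theorem permits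
  integrating $x$ and $w$ first by Beta integrals; a scaling separates one more variable, and what
  remains is Euler's integral for the hypergeometric function in $Q$.  With $s$ large and fixed, the
  integral is holomorphic in the other parameters and in $z$, which gives the identity for all of them
  by analytic continuation.  Finally the parameters are fixed and $s$ is moved from large real values
  through a half-plane to its given value on the boundary; there the integral is continuous, because
  it is dominated by the integrand at that boundary value, which is integrable by hypothesis.\<close>

text \<open>Two coincidences make the double integral computable. For z > 1 the base is (z + 1)/2
  times 1 + 2 p x + p^2 with p = sqrt ((z - 1)/(z + 1)) w, and the substitution (\<rho> +
  1/\<rho>)/2, natural for the Gegenbauer function, splits this form into linear factors. Moreover
  p^2 is linear in w^2 - 1, the variable of the Jacobi function. With \<alpha> - \<beta>, \<beta>
  and s as coordinates, the exponents at the edges w = 1 and x = 1 do not involve s, which governs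
  only the decay at infinity. If all parameters moved at once, convergence could be lost on the way;
  a large s absorbs the polynomial growth of both special functions uniformly over a bounded set of
  the remaining parameters, hence the two stages. A preliminary obstacle is that
  \<open>hyp_reg\<close> is chosen among the continuations of a power series, so for all parameters
  a continuation must be shown to exist. Euler's integral provides it in one region, and contiguous
  relations carry it to all others, together with holomorphy in the parameters and the growth
  bound.\<close>

section \<open>Holomorphic dependence of an integral on a parameter\<close>

text \<open>Cauchy's inequality turns the local bound g for the integrand into g / r for its
  derivative. Hence the difference quotients are dominated, and the derivative passes under the
  integral along every sequence.\<close>

lemma holomorphic_lebesgue_integral:
  fixes f :: "complex \<Rightarrow> 'b \<Rightarrow> complex"
  assumes "open S"
    and hol: "\<And>t. t \<in> space M \<Longrightarrow> (\<lambda>\<zeta>. f \<zeta> t) holomorphic_on S"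
    and meas: "\<And>\<zeta>. \<zeta> \<in> S \<Longrightarrow> f \<zeta> \<in> borel_measurable M"
    and dom: "\<And>\<zeta>0. \<zeta>0 \<in> S \<Longrightarrow> \<exists>r>0. \<exists>g. integrable M g \<and>
      (\<forall>\<zeta>\<in>ball \<zeta>0 r \<inter> S. \<forall>t\<in>space M. norm (f \<zeta> t) \<le> g t)"
  shows "(\<lambda>\<zeta>. \<integral>t. f \<zeta> t \<partial>M) holomorphic_on S"
proof (rule holomorphic_onI)
  fix \<zeta>0 assume z0: "\<zeta>0 \<in> S"
  obtain r0 g where r0: "r0 > 0" and g: "integrable M g"
    and gb: "\<And>\<zeta> t. \<zeta> \<in> ball \<zeta>0 r0 \<inter> S \<Longrightarrow> t \<in> space M \<Longrightarrow> norm (f \<zeta> t) \<le> g t"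
    using dom[OF z0] by blast
  obtain r1 where r1: "r1 > 0" "ball \<zeta>0 r1 \<subseteq> S"
    using \<open>open S\<close> z0 openE by blast
  \<comment> \<open>The third keeps every disc \<open>cball w r\<close> with centre in
    \<open>ball \<zeta>0 r\<close> inside \<open>ball \<zeta>0 (3*r)\<close>, where both the bound
    and holomorphy are available.\<close>
  define r where "r = min r0 r1 / 3"
  have r: "r > 0" using r0 r1 by (simp add: r_def)
  have sub: "ball \<zeta>0 (3*r) \<subseteq> ball \<zeta>0 r0 \<inter> S"
    using r1 by (auto simp: r_def)
  have subS: "ball \<zeta>0 (3*r) \<subseteq> S" using sub by auto
  have int: "integrable M (f \<zeta>)" if "\<zeta> \<in> ball \<zeta>0 (3*r)" for \<zeta>
    using that sub by (intro Bochner_Integration.integrable_bound[OF g meas] AE_I2 order.trans[OF gb]) auto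
  define f' where "f' = (\<lambda>t. deriv (\<lambda>\<zeta>. f \<zeta> t) \<zeta>0)"
  have db: "norm (deriv (\<lambda>\<zeta>. f \<zeta> t) w) \<le> g t / r" if "w \<in> ball \<zeta>0 r" "t \<in> space M" for w t
  proof -
    have s: "cball w r \<subseteq> ball \<zeta>0 (3*r)"
      using that r by (smt (verit, best) cball_subset_ball_iff dist_commute mem_ball)
    have "norm ((deriv ^^ 1) (\<lambda>\<zeta>. f \<zeta> t) w) \<le> fact 1 * g t / r ^ 1"
    proof (rule Cauchy_inequality)
      show "(\<lambda>\<zeta>. f \<zeta> t) holomorphic_on ball w r"
        using s subS by (intro holomorphic_on_subset[OF hol[OF that(2)]] order.trans[OF ball_subset_cball]) auto
      show "continuous_on (cball w r) (\<lambda>\<zeta>. f \<zeta> t)"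
        using s subS by (intro holomorphic_on_imp_continuous_on holomorphic_on_subset[OF hol[OF that(2)]]) auto
      fix x assume "norm (w - x) = r"
      hence "x \<in> cball w r" by (simp add: dist_norm)
      thus "norm (f x t) \<le> g t" using s sub gb that by blast
    qed (use r in auto)
    thus ?thesis by simp
  qed
  have lip: "norm (f \<zeta> t - f \<zeta>0 t) \<le> g t / r * norm (\<zeta> - \<zeta>0)"
    if "\<zeta> \<in> ball \<zeta>0 r" "t \<in> space M" for \<zeta> t
  proof (rule field_differentiable_bound[where S="ball \<zeta>0 r" and f'="deriv (\<lambda>\<zeta>. f \<zeta> t)"])
    fix z assume z: "z \<in> ball \<zeta>0 r"
    have "ball \<zeta>0 r \<subseteq> S" using sub r by auto
    hence "(\<lambda>\<zeta>. f \<zeta> t) holomorphic_on ball \<zeta>0 r" using hol[OF that(2)] holomorphic_on_subset by blast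
    thus "((\<lambda>\<zeta>. f \<zeta> t) has_field_derivative deriv (\<lambda>\<zeta>. f \<zeta> t) z) (at z within ball \<zeta>0 r)"
      using z holomorphic_derivI has_field_derivative_at_within by blast
  qed (use that db r in auto)
  have "((\<lambda>\<zeta>. ((\<integral>t. f \<zeta> t \<partial>M) - (\<integral>t. f \<zeta>0 t \<partial>M)) / (\<zeta> - \<zeta>0)) \<longlongrightarrow> (\<integral>t. f' t \<partial>M)) (at \<zeta>0)"
    unfolding tendsto_at_iff_sequentially
  proof (intro allI impI, unfold o_def)
    fix X :: "nat \<Rightarrow> complex" assume X: "\<forall>i. X i \<in> UNIV - {\<zeta>0}" "X \<longlonglongrightarrow> \<zeta>0"
    have "\<forall>\<^sub>F n in sequentially. X n \<in> ball \<zeta>0 r"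
      using X(2) r by (metis centre_in_ball open_ball topological_tendstoD)
    then obtain N where N: "\<And>n. n \<ge> N \<Longrightarrow> X n \<in> ball \<zeta>0 r" by (auto simp: eventually_sequentially)
    define Y where "Y n = X (n + N)" for n
    have Y: "Y n \<in> ball \<zeta>0 r" "Y n \<noteq> \<zeta>0" for n using N X(1) by (auto simp: Y_def)
    have Yl: "Y \<longlonglongrightarrow> \<zeta>0" unfolding Y_def using X(2) by (rule LIMSEQ_ignore_initial_segment)
    have Yin: "Y n \<in> ball \<zeta>0 (3*r)" for n using Y(1)[of n] r by auto
    have "(\<lambda>n. \<integral>t. (f (Y n) t - f \<zeta>0 t) / (Y n - \<zeta>0) \<partial>M) \<longlonglongrightarrow> (\<integral>t. f' t \<partial>M)"
    proof -
      have meas': "(\<lambda>t. (f (Y n) t - f \<zeta>0 t) / (Y n - \<zeta>0)) \<in> borel_measurable M" for n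
        using int[OF Yin] int[of \<zeta>0] r by (intro borel_measurable_divide borel_measurable_diff) auto
      have lim: "(\<lambda>n. (f (Y n) t - f \<zeta>0 t) / (Y n - \<zeta>0)) \<longlonglongrightarrow> f' t" if "t \<in> space M" for t
      proof -
        have "((\<lambda>\<zeta>. f \<zeta> t) has_field_derivative f' t) (at \<zeta>0)"
          unfolding f'_def using hol[OF that] \<open>open S\<close> z0 by (rule holomorphic_derivI)
        hence "((\<lambda>\<zeta>. (f \<zeta> t - f \<zeta>0 t) / (\<zeta> - \<zeta>0)) \<longlongrightarrow> f' t) (at \<zeta>0)"
          by (simp add: has_field_derivative_iff)
        thus ?thesis using Y Yl unfolding tendsto_at_iff_sequentially by (auto simp: o_def)
      qed
      show ?thesis
      proof (rule integral_dominated_convergence)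
        show "f' \<in> borel_measurable M"
          by (rule borel_measurable_LIMSEQ_metric[OF meas' lim])
        show "integrable M (\<lambda>t. g t / r)" using g by auto
        show "AE x in M. (\<lambda>n. (f (Y n) x - f \<zeta>0 x) / (Y n - \<zeta>0)) \<longlonglongrightarrow> f' x"
          using lim by auto
        show "AE x in M. norm ((f (Y n) x - f \<zeta>0 x) / (Y n - \<zeta>0)) \<le> g x / r" for n
        proof (rule AE_I2)
          fix x assume "x \<in> space M"
          from lip[OF Y(1) this, of n] show "norm ((f (Y n) x - f \<zeta>0 x) / (Y n - \<zeta>0)) \<le> g x / r"
            using Y(2)[of n] by (simp add: norm_divide divide_le_eq)
        qed
      qed (rule meas')
    qed
    also have "(\<lambda>n. \<integral>t. (f (Y n) t - f \<zeta>0 t) / (Y n - \<zeta>0) \<partial>M) =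
        (\<lambda>n. ((\<integral>t. f (Y n) t \<partial>M) - (\<integral>t. f \<zeta>0 t \<partial>M)) / (Y n - \<zeta>0))"
      using int[OF Yin] int[of \<zeta>0] r by (subst integral_divide_zero) (simp add: Bochner_Integration.integral_diff)
    finally show "(\<lambda>n. ((\<integral>t. f (X n) t \<partial>M) - (\<integral>t. f \<zeta>0 t \<partial>M)) / (X n - \<zeta>0)) \<longlonglongrightarrow> (\<integral>t. f' t \<partial>M)"
      unfolding Y_def by (rule LIMSEQ_offset)
  qed
  hence "((\<lambda>\<zeta>. \<integral>t. f \<zeta> t \<partial>M) has_field_derivative (\<integral>t. f' t \<partial>M)) (at \<zeta>0)"
    by (simp add: has_field_derivative_iff)
  thus "(\<lambda>\<zeta>. \<integral>t. f \<zeta> t \<partial>M) field_differentiable at \<zeta>0 within S"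
    using field_differentiable_at_within field_differentiable_def by blast
qed

section \<open>Complex Beta integrals and analytic continuation\<close>

lemma borel_measurable_complex_powr [measurable]:
  fixes f g :: "'a \<Rightarrow> complex"
  assumes [measurable]: "f \<in> borel_measurable M" "g \<in> borel_measurable M"
  shows "(\<lambda>x. f x powr g x) \<in> borel_measurable M"
  unfolding powr_def by measurable

definition beta_kernel :: "complex \<Rightarrow> complex \<Rightarrow> real \<Rightarrow> complex" where
  "beta_kernel p q r = indicator {0<..<1} r * (of_real r powr (p - 1) * of_real (1 - r) powr (q - 1))"

lemma borel_measurable_beta_kernel [measurable]: "beta_kernel p q \<in> borel_measurable borel"
  unfolding beta_kernel_def by measurable

lemma norm_beta_kernel:
  "norm (beta_kernel p q r) = indicator {0<..<1} r * (r powr (Re p - 1) * (1 - r) powr (Re q - 1))"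
  by (cases "r \<in> {0<..<1}") (simp_all add: beta_kernel_def norm_mult norm_powr_real_powr del: of_real_diff)

lemma integrable_norm_beta_kernel:
  assumes "Re p > 0" "Re q > 0"
  shows "integrable lborel (\<lambda>r. norm (beta_kernel p q r))"
proof -
  have "set_integrable lborel {0<..<1} (\<lambda>t. t powr (Re p - 1) * (1 - t) powr (Re q - 1))"
    by (rule set_integrable_subset[OF integrable_Beta]) (use assms in auto)
  thus ?thesis unfolding norm_beta_kernel set_integrable_def by simp
qed

lemma integrable_beta_kernel:
  assumes "Re p > 0" "Re q > 0"
  shows "integrable lborel (beta_kernel p q)"
  using integrable_norm_beta_kernel[OF assms] by (simp add: integrable_norm_iff)

lemma integral_beta_kernel_real:
  fixes p q :: real
  assumes "p > 0" "q > 0"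
  shows "(\<integral>r. beta_kernel (of_real p) (of_real q) r \<partial>lborel) = Beta (of_real p) (of_real q)"
proof -
  have "beta_kernel (of_real p) (of_real q) r =
      of_real (indicator {0<..<1} r * (r powr (p - 1) * (1 - r) powr (q - 1)))" for r
    by (cases "r \<in> {0<..<1}") (simp_all add: beta_kernel_def powr_of_real[symmetric])
  hence "(\<integral>r. beta_kernel (of_real p) (of_real q) r \<partial>lborel) =
      of_real (\<integral>r. indicator {0<..<1} r * (r powr (p - 1) * (1 - r) powr (q - 1)) \<partial>lborel)"
    by (simp only: integral_complex_of_real)
  also have "(\<integral>r. indicator {0<..<1} r * (r powr (p - 1) * (1 - r) powr (q - 1)) \<partial>lborel) =
      (LINT r:{0<..<1}|lborel. r powr (p - 1) * (1 - r) powr (q - 1))"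
    by (simp add: set_lebesgue_integral_def)
  also have "\<dots> = integral {0<..<1} (\<lambda>r. r powr (p - 1) * (1 - r) powr (q - 1))"
    by (rule set_borel_integral_eq_integral, rule set_integrable_subset[OF integrable_Beta])
       (use assms in auto)
  also have "\<dots> = Beta p q"
    using has_integral_Beta_real[OF assms] by (simp add: has_integral_Icc_iff_Ioo integral_unique)
  finally show ?thesis by (simp add: Beta_complex_of_real)
qed

lemma norm_beta_kernel_mono:
  assumes "Re p' \<le> Re p" "Re q' \<le> Re q"
  shows "norm (beta_kernel p q r) \<le> norm (beta_kernel p' q' r)"
  unfolding norm_beta_kernel using assms
  by (cases "r \<in> {0<..<1}") (auto intro!: mult_mono powr_mono')

text \<open>Supplies the limit point for the identity theorem whenever an equation is known only at
  real arguments.\<close>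

lemma islimpt_real_axis:
  assumes "open S" "of_real c \<in> S"
  shows "of_real c islimpt (range complex_of_real \<inter> S)"
proof (rule islimptI)
  obtain e where e: "e > 0" "ball (of_real c) e \<subseteq> S" using assms openE by blast
  fix T :: "complex set" assume "of_real c \<in> T" "open T"
  then obtain d where d: "d > 0" "ball (of_real c) d \<subseteq> T" using openE by blast
  define x where "x = c + min d e / 2"
  have "x > c" "x - c < d" "x - c < e" using d e by (auto simp: x_def)
  hence "of_real x \<in> ball (complex_of_real c) d" "of_real x \<in> ball (complex_of_real c) e" "complex_of_real x \<noteq> of_real c"
    by (auto simp: dist_norm norm_minus_commute simp flip: of_real_diff)
  thus "\<exists>y\<in>range complex_of_real \<inter> S. y \<in> T \<and> y \<noteq> of_real c"
    using d e by blast
qed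

lemma nonpos_Ints_Re:
  assumes "(z::complex) \<in> \<int>\<^sub>\<le>\<^sub>0"
  shows "Re z \<le> 0"
  using assms by (auto elim!: nonpos_Ints_cases)

text \<open>A one-variable identity theorem suffices: the complex line through (Re p, Re q) with
  direction (Im p, Im q) consists of real pairs for real \<zeta> and meets (p, q) at \<zeta> =
  \<i>.\<close>

lemma integral_beta_kernel:
  assumes "Re p > 0" "Re q > 0"
  shows "(\<integral>r. beta_kernel p q r \<partial>lborel) = Beta p q"
proof -
  define P where "P \<zeta> = of_real (Re p) + \<zeta> * of_real (Im p)" for \<zeta> :: complex
  define Q where "Q \<zeta> = of_real (Re q) + \<zeta> * of_real (Im q)" for \<zeta> :: complex
  define S where "S = {\<zeta>. Re (P \<zeta>) > 0} \<inter> {\<zeta>. Re (Q \<zeta>) > 0}"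
  have [holomorphic_intros]: "P holomorphic_on A" "Q holomorphic_on A" for A
    unfolding P_def Q_def by (intro holomorphic_intros)+
  have cont: "continuous_on UNIV P" "continuous_on UNIV Q"
    by (intro holomorphic_on_imp_continuous_on holomorphic_intros)+
  have oS: "open S" unfolding S_def
    by (intro open_Int open_Collect_less continuous_intros cont)
  \<comment> \<open>The real parts of P \<zeta> and Q \<zeta> are affine in Re \<zeta>, so S is an
    intersection of half-planes and therefore connected.\<close>
  have S_eq: "S = {\<zeta>. Re p + Re \<zeta> * Im p > 0} \<inter> {\<zeta>. Re q + Re \<zeta> * Im q > 0}"
    by (auto simp: S_def P_def Q_def)
  have "convex {\<zeta>. a + Re \<zeta> * b > 0}" for a b :: real
  proof -
    have "{\<zeta>. a + Re \<zeta> * b > 0} = {\<zeta>. inner (of_real b) \<zeta> > - a}"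
      by (auto simp: inner_complex_def mult.commute)
    thus ?thesis by (simp add: convex_halfspace_gt)
  qed
  hence "connected S" unfolding S_eq by (intro convex_connected convex_Int)
  define h where "h \<zeta> = (\<integral>r. beta_kernel (P \<zeta>) (Q \<zeta>) r \<partial>lborel) - Beta (P \<zeta>) (Q \<zeta>)" for \<zeta>
  have "(\<lambda>\<zeta>. \<integral>r. beta_kernel (P \<zeta>) (Q \<zeta>) r \<partial>lborel) holomorphic_on S"
  proof (rule holomorphic_lebesgue_integral[OF oS])
    show "(\<lambda>\<zeta>. beta_kernel (P \<zeta>) (Q \<zeta>) r) holomorphic_on S" for r
      unfolding beta_kernel_def by (intro holomorphic_intros)
    fix \<zeta>0 assume z0: "\<zeta>0 \<in> S"
    define a where "a = Re (P \<zeta>0) / 2"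
    define b where "b = Re (Q \<zeta>0) / 2"
    have ab: "a > 0" "b > 0" using z0 by (auto simp: a_def b_def S_def)
    have "open ({\<zeta>. Re (P \<zeta>) > a} \<inter> {\<zeta>. Re (Q \<zeta>) > b})"
      by (intro open_Int open_Collect_less continuous_intros cont)
    moreover have "\<zeta>0 \<in> {\<zeta>. Re (P \<zeta>) > a} \<inter> {\<zeta>. Re (Q \<zeta>) > b}"
      using z0 by (auto simp: a_def b_def S_def)
    ultimately obtain e where e: "e > 0" "ball \<zeta>0 e \<subseteq> {\<zeta>. Re (P \<zeta>) > a} \<inter> {\<zeta>. Re (Q \<zeta>) > b}"
      using openE by blast
    show "\<exists>r>0. \<exists>g. integrable lborel g \<and>
      (\<forall>\<zeta>\<in>ball \<zeta>0 r \<inter> S. \<forall>t\<in>space lborel. norm (beta_kernel (P \<zeta>) (Q \<zeta>) t) \<le> g t)"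
    proof (intro exI conjI ballI)
      show "integrable lborel (\<lambda>r. norm (beta_kernel (of_real a) (of_real b) r))"
        using ab by (intro integrable_norm_beta_kernel) auto
      fix \<zeta> t assume "\<zeta> \<in> ball \<zeta>0 e \<inter> S"
      with e have "Re (P \<zeta>) > a" "Re (Q \<zeta>) > b" by auto
      thus "norm (beta_kernel (P \<zeta>) (Q \<zeta>) t) \<le> norm (beta_kernel (of_real a) (of_real b) t)"
        by (intro norm_beta_kernel_mono) auto
    qed (rule e)
  qed simp
  moreover have "(\<lambda>\<zeta>. Beta (P \<zeta>) (Q \<zeta>)) holomorphic_on S"
    by (intro holomorphic_intros) (auto simp: S_def dest!: nonpos_Ints_Re)
  ultimately have hol: "h holomorphic_on S" unfolding h_def by (rule holomorphic_on_diff)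
  define U where "U = complex_of_real ` UNIV \<inter> S"
  have "0 \<in> S" "\<i> \<in> S" using assms by (auto simp: S_eq)
  have "h \<i> = 0"
  proof (rule analytic_continuation[OF hol oS \<open>connected S\<close> _ \<open>0 \<in> S\<close>])
    show "0 islimpt U" unfolding U_def using islimpt_real_axis[OF oS, of 0] \<open>0 \<in> S\<close> by simp
    fix \<zeta> assume "\<zeta> \<in> U"
    then obtain x where x: "\<zeta> = of_real x" "\<zeta> \<in> S" by (auto simp: U_def)
    have "P \<zeta> = of_real (Re p + x * Im p)" "Q \<zeta> = of_real (Re q + x * Im q)"
      by (auto simp: x P_def Q_def)
    moreover have "Re p + x * Im p > 0" "Re q + x * Im q > 0" using x by (auto simp: S_eq)
    ultimately show "h \<zeta> = 0" unfolding h_def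
      using integral_beta_kernel_real[of "Re p + x * Im p" "Re q + x * Im q"] by simp
  qed (auto simp: U_def \<open>\<i> \<in> S\<close>)
  moreover have "P \<i> = p" "Q \<i> = q" by (auto simp: P_def Q_def complex_eq_iff)
  ultimately show ?thesis by (simp add: h_def)
qed

section \<open>The slit plane and averages against Beta kernels\<close>

definition slit_plane :: "complex set" where
  "slit_plane = - (complex_of_real ` {1..})"

lemma mem_slit_plane_iff: "z \<in> slit_plane \<longleftrightarrow> Im z \<noteq> 0 \<or> Re z < 1"
proof -
  have "z \<in> complex_of_real ` {1..} \<longleftrightarrow> Im z = 0 \<and> Re z \<ge> 1"
    by (auto simp: complex_eq_iff image_iff intro!: bexI[of _ "Re z"])
  thus ?thesis by (auto simp: slit_plane_def)
qed

lemma closed_of_real_atLeast: "closed (complex_of_real ` {c..})"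
proof -
  have "complex_of_real ` {c..} = {z. Im z = 0} \<inter> {z. Re z \<ge> c}"
    by (auto simp: complex_eq_iff image_iff intro!: bexI[of _ "Re _"])
  thus ?thesis by (auto intro!: closed_Int closed_Collect_eq closed_Collect_le continuous_intros)
qed

lemma open_slit_plane: "open slit_plane"
  using closed_of_real_atLeast by (simp add: open_Compl slit_plane_def)

lemma connected_slit_plane: "connected slit_plane"
  unfolding slit_plane_def by (intro starlike_imp_connected starlike_slotted_complex_plane_right)

lemma zero_in_slit_plane: "0 \<in> slit_plane"
  by (simp add: mem_slit_plane_iff)

lemma ball_subset_slit_plane: "ball 0 1 \<subseteq> slit_plane"
proof
  fix z :: complex assume "z \<in> ball 0 1"
  hence "Re z < 1" using complex_Re_le_cmod[of z] by auto
  thus "z \<in> slit_plane" by (simp add: mem_slit_plane_iff)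
qed

lemma scale_in_slit_plane:
  assumes "z \<in> slit_plane" "0 \<le> r" "r \<le> 1"
  shows "of_real r * z \<in> slit_plane"
proof (cases "r = 0")
  case False
  have "r * Re z < 1" if "Re z < 1"
  proof (cases "Re z \<le> 0")
    case True
    hence "r * Re z \<le> 0" using assms by (simp add: mult_nonneg_nonpos)
    thus ?thesis by simp
  next
    case 2: False
    have "r * Re z \<le> 1 * Re z" using 2 assms by (intro mult_right_mono) auto
    thus ?thesis using that by simp
  qed
  thus ?thesis using assms False by (auto simp: mem_slit_plane_iff)
qed (simp add: mem_slit_plane_iff)

text \<open>The slit plane is star-shaped about 0, so the products of [0,1] with a small closed disc
  form a compact subset of it. This yields the dominating constant for all averages over r in
  (0,1).\<close>

lemma bounded_scaled_nbhd:
  assumes "f holomorphic_on slit_plane" "z0 \<in> slit_plane"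
  obtains e B where "e > 0" "ball z0 e \<subseteq> slit_plane"
    "\<And>z r. z \<in> ball z0 e \<Longrightarrow> 0 \<le> r \<Longrightarrow> r \<le> 1 \<Longrightarrow> norm (f (of_real r * z)) \<le> B"
proof -
  obtain e where e: "e > 0" "cball z0 e \<subseteq> slit_plane"
    using open_slit_plane assms(2) open_contains_cball by blast
  define K where "K = (\<lambda>(r, z). of_real r * z) ` ({0..1::real} \<times> cball z0 e)"
  have "compact K" unfolding K_def split_def
    by (intro compact_continuous_image continuous_intros compact_Times) auto
  moreover have KS: "K \<subseteq> slit_plane"
    unfolding K_def using e scale_in_slit_plane by fastforce
  have "continuous_on K f"
    using holomorphic_on_imp_continuous_on[OF assms(1)] KS continuous_on_subset by blast
  ultimately have "bounded (f ` K)"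
    by (intro compact_imp_bounded compact_continuous_image)
  then obtain B where B: "\<And>w. w \<in> K \<Longrightarrow> norm (f w) \<le> B" by (auto simp: bounded_iff)
  show ?thesis
  proof (rule that[of e B])
    fix z r assume "z \<in> ball z0 e" "0 \<le> r" "r \<le> (1::real)"
    hence "of_real r * z \<in> K" unfolding K_def by force
    thus "norm (f (of_real r * z)) \<le> B" by (rule B)
  qed (use e in auto)
qed

text \<open>For r outside (0,1) the point r z may lie on the cut, where nothing is known about f;
  the indicator removes these r before continuity is used.\<close>

lemma measurable_beta_average:
  assumes "f holomorphic_on slit_plane" "z \<in> slit_plane"
  shows "(\<lambda>r. beta_kernel p q r * f (of_real r * z)) \<in> borel_measurable borel"
proof -
  have "(\<lambda>r. indicator {0<..<1} r *\<^sub>R f (of_real r * z)) \<in> borel_measurable borel"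
  proof (rule borel_measurable_continuous_on_indicator)
    have "continuous_on {0<..<1} (f \<circ> (\<lambda>r. of_real r * z))"
      using scale_in_slit_plane[OF assms(2)]
      by (intro continuous_on_compose continuous_intros
            continuous_on_subset[OF holomorphic_on_imp_continuous_on[OF assms(1)]]) fastforce
    thus "continuous_on {0<..<1} (\<lambda>r. f (of_real r * z))" by (simp add: o_def)
  qed simp
  hence "(\<lambda>r. beta_kernel p q r * (indicator {0<..<1} r *\<^sub>R f (of_real r * z))) \<in> borel_measurable borel"
    by measurable
  also have "(\<lambda>r. beta_kernel p q r * (indicator {0<..<1} r *\<^sub>R f (of_real r * z))) =
      (\<lambda>r. beta_kernel p q r * f (of_real r * z))"
    by (auto simp: fun_eq_iff beta_kernel_def indicator_def)
  finally show ?thesis .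
qed

lemma holomorphic_beta_average:
  assumes f: "f holomorphic_on slit_plane" and pq: "Re p > 0" "Re q > 0"
  shows "(\<lambda>z. \<integral>r. beta_kernel p q r * f (of_real r * z) \<partial>lborel) holomorphic_on slit_plane"
proof (rule holomorphic_lebesgue_integral[OF open_slit_plane])
  show "(\<lambda>z. beta_kernel p q r * f (of_real r * z)) holomorphic_on slit_plane" for r
  proof (cases "r \<in> {0<..<1}")
    case True
    have "(f \<circ> (\<lambda>z. of_real r * z)) holomorphic_on slit_plane"
      using True by (intro holomorphic_on_compose_gen[OF _ f] holomorphic_intros)
        (auto intro!: scale_in_slit_plane)
    thus ?thesis unfolding o_def by (intro holomorphic_intros)
  qed (simp add: beta_kernel_def)
  show "(\<lambda>r. beta_kernel p q r * f (of_real r * z)) \<in> borel_measurable lborel" if "z \<in> slit_plane" for z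
    using measurable_beta_average[OF f that] by simp
  fix z0 assume "z0 \<in> slit_plane"
  then obtain e B where e: "e > 0" "ball z0 e \<subseteq> slit_plane"
    and B: "\<And>z r. z \<in> ball z0 e \<Longrightarrow> 0 \<le> r \<Longrightarrow> r \<le> 1 \<Longrightarrow> norm (f (of_real r * z)) \<le> B"
    using bounded_scaled_nbhd[OF f] by metis
  show "\<exists>r>0. \<exists>g. integrable lborel g \<and>
      (\<forall>z\<in>ball z0 r \<inter> slit_plane. \<forall>t\<in>space lborel. norm (beta_kernel p q t * f (of_real t * z)) \<le> g t)"
  proof (intro exI conjI ballI)
    show "integrable lborel (\<lambda>t. norm (beta_kernel p q t) * B)"
      using integrable_norm_beta_kernel[OF pq] by simp
    fix z t assume z: "z \<in> ball z0 e \<inter> slit_plane"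
    show "norm (beta_kernel p q t * f (of_real t * z)) \<le> norm (beta_kernel p q t) * B"
    proof (cases "t \<in> {0<..<1}")
      case True
      thus ?thesis unfolding norm_mult using z B[of z t] by (intro mult_left_mono) auto
    qed (simp add: beta_kernel_def)
  qed (rule e)
qed

lemma beta_kernel_mult_power:
  "beta_kernel p q r * of_real r ^ n = beta_kernel (p + of_nat n) q r"
proof (cases "r \<in> {0<..<1}")
  case True
  have "of_real r powr (p + of_nat n - 1) = of_real r powr (p - 1) * of_real r ^ n"
    using True powr_add[of "complex_of_real r" "p - 1" "of_nat n"] by (simp add: algebra_simps)
  thus ?thesis using True by (simp add: beta_kernel_def algebra_simps)
qed (simp add: beta_kernel_def)

text \<open>The factor r^n coming from (r z)^n shifts p to p + n in the kernel, so averaging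
  multiplies the n-th coefficient by a Beta value. Euler's and Bateman's integrals are both
  instances.\<close>

lemma has_fps_expansion_beta_average:
  assumes f: "f holomorphic_on slit_plane" "f has_fps_expansion F" and pq: "Re p > 0" "Re q > 0"
  shows "(\<lambda>z. \<integral>r. beta_kernel p q r * f (of_real r * z) \<partial>lborel) has_fps_expansion
           Abs_fps (\<lambda>n. fps_nth F n * Beta (p + of_nat n) q)"
proof (rule has_fps_expansionI)
  have fb: "f holomorphic_on eball 0 1"
    using f(1) ball_subset_slit_plane by (simp add: one_ereal_def) (rule holomorphic_on_subset)
  have sums: "(\<lambda>n. fps_nth F n * w ^ n) sums f w" if "norm w < 1" for w
    by (rule has_fps_expansion_imp_sums_complex[OF f(2) fb]) (use that in \<open>simp add: one_ereal_def\<close>)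
  have asum: "summable (\<lambda>n. norm (fps_nth F n) * norm w ^ n)" if w: "norm w < 1" for w :: complex
  proof -
    \<comment> \<open>Any radius strictly between \<open>norm w\<close> and 1 would do: convergence
      there gives absolute convergence at w.\<close>
    define s where "s = (1 + norm w) / 2"
    have s: "norm w < norm (complex_of_real s)" "norm (complex_of_real s) < 1"
      unfolding norm_of_real using w norm_ge_zero[of w] by (simp_all add: s_def abs_of_nonneg)
    have "summable (\<lambda>n. fps_nth F n * complex_of_real s ^ n)"
      by (rule sums_summable[OF sums]) (rule s)
    hence "summable (\<lambda>n. norm (fps_nth F n * w ^ n))"
      by (rule powser_insidea) (rule s)
    thus ?thesis by (simp add: norm_mult norm_power)
  qed
  have "(\<lambda>n. fps_nth F n * Beta (p + of_nat n) q * z ^ n) sums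
      (\<integral>r. beta_kernel p q r * f (of_real r * z) \<partial>lborel)" if z: "norm z < 1" for z
  proof -
    define G where "G n r = beta_kernel (p + of_nat n) q r * (fps_nth F n * z ^ n)" for n r
    have G: "G n r = beta_kernel p q r * (fps_nth F n * (of_real r * z) ^ n)" for n r
      unfolding G_def beta_kernel_mult_power[symmetric] by (simp add: power_mult_distrib)
    have "(\<lambda>n. \<integral>r. G n r \<partial>lborel) sums (\<integral>r. (\<Sum>n. G n r) \<partial>lborel)"
    proof (rule sums_integral)
      show int: "integrable lborel (G n)" for n
        unfolding G_def using pq by (intro integrable_mult_left integrable_beta_kernel) auto
      have nb: "norm (G n r) \<le> norm (beta_kernel p q r) * (norm (fps_nth F n) * norm z ^ n)" for n r
      proof (cases "r \<in> {0<..<1}")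
        case True
        hence "r ^ n \<le> 1" by (intro power_le_one) auto
        hence "r ^ n * norm z ^ n \<le> 1 * norm z ^ n" by (intro mult_right_mono) auto
        thus ?thesis using True unfolding G norm_mult norm_power power_mult_distrib
          by (intro mult_left_mono) auto
      qed (simp add: G beta_kernel_def)
      show "AE r in lborel. summable (\<lambda>n. norm (G n r))"
        by (rule AE_I2, rule summable_comparison_test'[OF summable_mult[OF asum[OF z]]])
           (use nb in simp)
      show "summable (\<lambda>n. \<integral>r. norm (G n r) \<partial>lborel)"
      proof (rule summable_comparison_test'[OF summable_mult[OF asum[OF z]]])
        fix n :: nat assume "n \<ge> 0"
        have "(\<integral>r. norm (G n r) \<partial>lborel) \<le>
            (\<integral>r. norm (beta_kernel p q r) * (norm (fps_nth F n) * norm z ^ n) \<partial>lborel)"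
          using int integrable_norm_beta_kernel[OF pq] nb by (intro integral_mono) auto
        also have "\<dots> = (\<integral>r. norm (beta_kernel p q r) \<partial>lborel) * (norm (fps_nth F n) * norm z ^ n)"
          by simp
        finally show "norm (\<integral>r. norm (G n r) \<partial>lborel) \<le>
            (\<integral>r. norm (beta_kernel p q r) \<partial>lborel) * (norm (fps_nth F n) * norm z ^ n)"
          by simp
      qed
    qed
    also have "(\<integral>r. (\<Sum>n. G n r) \<partial>lborel) = (\<integral>r. beta_kernel p q r * f (of_real r * z) \<partial>lborel)"
    proof (rule Bochner_Integration.integral_cong[OF refl])
      fix r
      show "(\<Sum>n. G n r) = beta_kernel p q r * f (of_real r * z)"
      proof (cases "r \<in> {0<..<1}")
        case True
        have "norm (of_real r * z) \<le> 1 * norm z"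
          unfolding norm_mult using True by (intro mult_right_mono) auto
        hence "norm (of_real r * z) < 1" using z by simp
        from sums_mult[OF sums[OF this], of "beta_kernel p q r"]
        show ?thesis by (simp add: G sums_iff)
      qed (simp add: G beta_kernel_def)
    qed
    also have "(\<lambda>n. \<integral>r. G n r \<partial>lborel) = (\<lambda>n. fps_nth F n * Beta (p + of_nat n) q * z ^ n)"
      unfolding G_def using pq by (simp add: integral_beta_kernel mult_ac)
    finally show ?thesis .
  qed
  thus "\<forall>\<^sub>F z in nhds 0. (\<lambda>n. fps_nth (Abs_fps (\<lambda>n. fps_nth F n * Beta (p + of_nat n) q)) n * z ^ n) sums
      (\<integral>r. beta_kernel p q r * f (of_real r * z) \<partial>lborel)"
    by (intro eventually_nhds_in_open[of "ball 0 1", THEN eventually_mono]) auto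
qed

section \<open>The regularized hypergeometric function\<close>

text \<open>Relations between hypergeometric functions are verified on these coefficients and
  transferred to functions afterwards. With \<open>rGamma\<close> in place of a division they hold
  for every c.\<close>

definition hyp_fps :: "complex \<Rightarrow> complex \<Rightarrow> complex \<Rightarrow> complex fps" where
  "hyp_fps a b c = Abs_fps (\<lambda>n. pochhammer a n * pochhammer b n * rGamma (c + of_nat n) / fact n)"

lemma hyp_fps_nth_0 [simp]: "fps_nth (hyp_fps a b c) 0 = rGamma c"
  by (simp add: hyp_fps_def)

lemma hyp_fps_nth_Suc:
  "of_nat (Suc n) * fps_nth (hyp_fps a b c) (Suc n) =
     a * b * fps_nth (hyp_fps (a + 1) (b + 1) (c + 1)) n"
proof -
  have "rGamma (c + of_nat (Suc n)) = rGamma (c + 1 + of_nat n)" by (simp add: add_ac)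
  moreover have "(fact (Suc n) :: complex) = of_nat (Suc n) * fact n" by simp
  ultimately show ?thesis unfolding hyp_fps_def fps_nth_Abs_fps pochhammer_rec
    by (simp del: of_nat_Suc fact_Suc add: field_simps)
qed

lemma hyp_fps_rec:
  "of_nat (Suc n) * (c + of_nat n) * fps_nth (hyp_fps a b c) (Suc n) =
     (a + of_nat n) * (b + of_nat n) * fps_nth (hyp_fps a b c) n"
proof -
  have "(c + of_nat n) * rGamma (c + of_nat n + 1) = rGamma (c + of_nat n)" by (rule rGamma_plus1)
  hence *: "rGamma (c + of_nat n) = (c + of_nat n) * rGamma (c + of_nat (Suc n))" by (simp add: add_ac)
  have "(fact (Suc n) :: complex) = of_nat (Suc n) * fact n" by simp
  thus ?thesis unfolding hyp_fps_def fps_nth_Abs_fps pochhammer_rec' *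
    by (simp del: of_nat_Suc fact_Suc add: field_simps)
qed

lemma hyp_fps_ode:
  "fps_X * (1 - fps_X) * fps_deriv (fps_deriv (hyp_fps a b c))
     + (fps_const c - fps_const (a + b + 1) * fps_X) * fps_deriv (hyp_fps a b c)
     - fps_const (a * b) * hyp_fps a b c = 0" (is "?L = 0")
proof (rule fps_ext)
  fix n
  define H where "H = hyp_fps a b c"
  have L: "?L = fps_X * fps_deriv (fps_deriv H) - fps_X * (fps_X * fps_deriv (fps_deriv H))
      + fps_const c * fps_deriv H - fps_const (a + b + 1) * (fps_X * fps_deriv H) - fps_const (a * b) * H"
    by (simp add: H_def algebra_simps)
  have rec: "of_nat (Suc n) * (c + of_nat n) * fps_nth H (Suc n) = (a + of_nat n) * (b + of_nat n) * fps_nth H n"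
    unfolding H_def by (rule hyp_fps_rec)
  show "fps_nth ?L n = fps_nth 0 n"
  proof (cases n)
    case 0
    thus ?thesis using rec unfolding L by simp
  next
    case (Suc m)
    show ?thesis
    proof (cases m)
      case 0
      thus ?thesis using rec Suc unfolding L by (simp add: algebra_simps)
    next
      case (Suc k)
      thus ?thesis using rec \<open>n = Suc m\<close> unfolding L by (simp add: algebra_simps)
    qed
  qed
qed

text \<open>The equation forces the recurrence \<open>hyp_fps_rec\<close>, whose leading factor (n +
  1)(c + n) vanishes for no n when c is not a nonpositive integer.\<close>

lemma hyp_fps_unique:
  assumes ode: "fps_X * (1 - fps_X) * fps_deriv (fps_deriv G)
     + (fps_const c - fps_const (a + b + 1) * fps_X) * fps_deriv G - fps_const (a * b) * G = 0"
    and G0: "fps_nth G 0 = rGamma c" and c: "c \<notin> \<int>\<^sub>\<le>\<^sub>0"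
  shows "G = hyp_fps a b c"
proof (rule fps_ext)
  have rec: "of_nat (Suc n) * (c + of_nat n) * fps_nth G (Suc n) = (a + of_nat n) * (b + of_nat n) * fps_nth G n" for n
  proof -
    have L: "fps_X * fps_deriv (fps_deriv G) - fps_X * (fps_X * fps_deriv (fps_deriv G))
      + fps_const c * fps_deriv G - fps_const (a + b + 1) * (fps_X * fps_deriv G) - fps_const (a * b) * G = 0"
      (is "?R = 0") using ode by (simp add: algebra_simps)
    hence R: "fps_nth ?R n = 0" by simp
    show ?thesis
    proof (cases n)
      case 0
      thus ?thesis using R by simp
    next
      case (Suc m)
      show ?thesis
      proof (cases m)
        case 0
        thus ?thesis using R Suc by (simp add: algebra_simps)
      next
        case (Suc k)
        thus ?thesis using R \<open>n = Suc m\<close> by (simp add: algebra_simps)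
      qed
    qed
  qed
  show "fps_nth G n = fps_nth (hyp_fps a b c) n" for n
  proof (induction n)
    case (Suc n)
    have "c + of_nat n \<noteq> 0"
    proof
      assume "c + of_nat n = 0"
      hence "c = - of_nat n" by (simp add: add_eq_0_iff2)
      thus False using c by simp
    qed
    hence "of_nat (Suc n) * (c + of_nat n) \<noteq> 0" by (simp del: of_nat_Suc)
    moreover have "of_nat (Suc n) * (c + of_nat n) * fps_nth G (Suc n) =
        of_nat (Suc n) * (c + of_nat n) * fps_nth (hyp_fps a b c) (Suc n)"
      unfolding rec hyp_fps_rec Suc.IH ..
    ultimately show ?case by (metis mult_cancel_left)
  qed (simp add: G0)
qed

text \<open>From 1/\<Gamma>(c + n) = (c + n)/\<Gamma>(c + 1 + n) one gets F(a,b;c) = (c + z d/dz)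
  F(a,b;c+1), and the derivative raises all three parameters by one.\<close>

lemma hyp_fps_lower_c:
  "hyp_fps a b c = fps_const c * hyp_fps a b (c + 1)
     + fps_const (a * b) * (fps_X * hyp_fps (a + 1) (b + 1) (c + 2))"
proof (rule fps_ext)
  fix n
  show "fps_nth (hyp_fps a b c) n = fps_nth (fps_const c * hyp_fps a b (c + 1)
     + fps_const (a * b) * (fps_X * hyp_fps (a + 1) (b + 1) (c + 2))) n"
  proof (cases n)
    case 0
    thus ?thesis by (simp add: rGamma_plus1)
  next
    case (Suc m)
    have 1: "a * b * fps_nth (hyp_fps (a + 1) (b + 1) (c + 2)) m =
        of_nat (Suc m) * fps_nth (hyp_fps a b (c + 1)) (Suc m)"
      using hyp_fps_nth_Suc[of m a b "c + 1"] by (simp add: add_ac)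
    have "rGamma (c + of_nat (Suc m)) = (c + of_nat (Suc m)) * rGamma (c + of_nat (Suc m) + 1)"
      by (rule rGamma_plus1[symmetric])
    hence 2: "fps_nth (hyp_fps a b c) (Suc m) = (c + of_nat (Suc m)) * fps_nth (hyp_fps a b (c + 1)) (Suc m)"
      by (simp add: hyp_fps_def add_ac)
    show ?thesis unfolding Suc 2 using 1 by (simp add: algebra_simps)
  qed
qed

text \<open>Gauss's contiguous relation between b, b + 1 and b + 2. It has no exceptional parameters
  in this form; solving it for the lowest function requires c - b - 1 \<noteq> 0.\<close>

lemma hyp_fps_lower_b:
  "fps_const (c - b - 1) * hyp_fps a b c =
     fps_const (c - 2 * b - 2) * hyp_fps a (b + 1) c
     - fps_const (a - b - 1) * (fps_X * hyp_fps a (b + 1) c)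
     + fps_const (b + 1) * hyp_fps a (b + 2) c
     - fps_const (b + 1) * (fps_X * hyp_fps a (b + 2) c)"
proof (rule fps_ext)
  fix n
  show "fps_nth (fps_const (c - b - 1) * hyp_fps a b c) n =
     fps_nth (fps_const (c - 2 * b - 2) * hyp_fps a (b + 1) c
     - fps_const (a - b - 1) * (fps_X * hyp_fps a (b + 1) c)
     + fps_const (b + 1) * hyp_fps a (b + 2) c
     - fps_const (b + 1) * (fps_X * hyp_fps a (b + 2) c)) n"
  proof (cases n)
    case 0
    thus ?thesis by (simp add: algebra_simps)
  next
    case (Suc m)
    \<comment> \<open>All coefficients that occur, some after multiplication by b + 1, are
      polynomials times the common factor q w, so the relation reduces to a polynomial
      identity.\<close>
    define q where "q = pochhammer (b + 1) m"
    define w where "w = pochhammer a m * rGamma (c + of_nat (Suc m)) / fact (Suc m)"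
    have r: "rGamma (c + of_nat m) = (c + of_nat m) * rGamma (c + of_nat (Suc m))"
      using rGamma_plus1[of "c + of_nat m"] by (simp add: add_ac)
    have f: "(fact (Suc m) :: complex) = of_nat (Suc m) * fact m" by simp
    have p1: "pochhammer b (Suc m) = b * q" by (simp add: q_def pochhammer_rec)
    have p2: "pochhammer (b + 1) (Suc m) = (b + 1 + of_nat m) * q" by (simp add: q_def pochhammer_rec')
    have p3: "(b + 1) * pochhammer (b + 2) m = (b + 1 + of_nat m) * q"
      using pochhammer_rec[of "b + 1" m] pochhammer_rec'[of "b + 1" m] by (simp add: q_def add_ac)
    have p4: "(b + 1) * pochhammer (b + 2) (Suc m) = (b + 1 + of_nat m) * (b + 2 + of_nat m) * q"
      unfolding pochhammer_rec'[of "b + 2" m] using p3 by algebra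
    have h1: "fps_nth (hyp_fps a b c) (Suc m) = (a + of_nat m) * b * q * w"
      unfolding hyp_fps_def fps_nth_Abs_fps p1 pochhammer_rec'[of a m] w_def by simp
    have h2: "fps_nth (hyp_fps a (b + 1) c) (Suc m) = (a + of_nat m) * (b + 1 + of_nat m) * q * w"
      unfolding hyp_fps_def fps_nth_Abs_fps p2 pochhammer_rec'[of a m] w_def by simp
    have h3: "fps_nth (hyp_fps a (b + 1) c) m = of_nat (Suc m) * (c + of_nat m) * q * w"
      unfolding hyp_fps_def fps_nth_Abs_fps r w_def q_def f by (simp del: of_nat_Suc fact_Suc)
    have h4: "(b + 1) * fps_nth (hyp_fps a (b + 2) c) (Suc m) =
        (a + of_nat m) * (b + 1 + of_nat m) * (b + 2 + of_nat m) * q * w"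
    proof -
      have "(b + 1) * fps_nth (hyp_fps a (b + 2) c) (Suc m) =
         (a + of_nat m) * ((b + 1) * pochhammer (b + 2) (Suc m)) * w"
        unfolding hyp_fps_def fps_nth_Abs_fps pochhammer_rec'[of a m] w_def by simp
      thus ?thesis unfolding p4 by (simp add: mult_ac)
    qed
    have h5: "(b + 1) * fps_nth (hyp_fps a (b + 2) c) m = of_nat (Suc m) * (c + of_nat m) * (b + 1 + of_nat m) * q * w"
    proof -
      have "(b + 1) * fps_nth (hyp_fps a (b + 2) c) m =
         of_nat (Suc m) * (c + of_nat m) * ((b + 1) * pochhammer (b + 2) m) * w"
        unfolding hyp_fps_def fps_nth_Abs_fps w_def r f by (simp del: of_nat_Suc fact_Suc)
      thus ?thesis unfolding p3 by (simp add: mult_ac)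
    qed
    have "(c - b - 1) * ((a + of_nat m) * b * q * w) =
        (c - 2 * b - 2) * ((a + of_nat m) * (b + 1 + of_nat m) * q * w)
        - (a - b - 1) * (of_nat (Suc m) * (c + of_nat m) * q * w)
        + (a + of_nat m) * (b + 1 + of_nat m) * (b + 2 + of_nat m) * q * w
        - of_nat (Suc m) * (c + of_nat m) * (b + 1 + of_nat m) * q * w"
      unfolding of_nat_Suc by algebra
    thus ?thesis unfolding Suc using h1 h2 h3 h4 h5 by simp
  qed
qed

section \<open>Existence and uniqueness of the continuation\<close>

text \<open>A property of an arbitrary candidate f, so that existence can be settled before the
  choice in \<open>hyp_reg\<close> is touched. The expansion at 0 replaces the sum over the unit
  disc.\<close>

definition hyp_cont :: "complex \<Rightarrow> complex \<Rightarrow> complex \<Rightarrow> (complex \<Rightarrow> complex) \<Rightarrow> bool" where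
  "hyp_cont a b c f \<longleftrightarrow> f holomorphic_on slit_plane \<and> f has_fps_expansion hyp_fps a b c"

lemma one_minus_not_nonpos_Reals: "z \<in> slit_plane \<Longrightarrow> 1 - z \<notin> \<real>\<^sub>\<le>\<^sub>0"
  by (auto simp: mem_slit_plane_iff complex_nonpos_Reals_iff)

lemma holomorphic_one_minus_powr: "(\<lambda>z. (1 - z) powr e) holomorphic_on slit_plane"
  by (intro holomorphic_intros) (auto dest: one_minus_not_nonpos_Reals)

lemma has_fps_expansion_one_minus_powr:
  "(\<lambda>z. (1 - z) powr (- a :: complex)) has_fps_expansion Abs_fps (\<lambda>n. pochhammer a n / fact n)"
proof (rule has_fps_expansionI)
  have "(\<lambda>n. pochhammer a n / fact n * z ^ n) sums (1 - z) powr (- a)" if "norm z < 1" for z :: complex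
  proof -
    have "(\<lambda>n. (- a gchoose n) * (- z) ^ n) sums (1 + (- z)) powr (- a)"
      by (rule gen_binomial_complex) (use that in simp)
    moreover have "(- a gchoose n) * (- z) ^ n = pochhammer a n / fact n * z ^ n" for n
    proof -
      have "(- z) ^ n = (- 1) ^ n * z ^ n" by (rule power_minus)
      moreover have "(- 1) ^ n * (- 1) ^ n = (1 :: complex)"
        by (simp add: power_mult_distrib[symmetric])
      ultimately show ?thesis by (simp add: gbinomial_pochhammer)
    qed
    ultimately show ?thesis by simp
  qed
  thus "\<forall>\<^sub>F z in nhds 0. (\<lambda>n. fps_nth (Abs_fps (\<lambda>n. pochhammer a n / fact n)) n * z ^ n) sums
      (1 - z) powr (- a)"
    by (intro eventually_nhds_in_open[of "ball 0 1", THEN eventually_mono]) auto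
qed

definition euler_integral :: "complex \<Rightarrow> complex \<Rightarrow> complex \<Rightarrow> complex \<Rightarrow> complex" where
  "euler_integral a b c z = rGamma b * rGamma (c - b) *
     (\<integral>r. beta_kernel b (c - b) r * (1 - of_real r * z) powr (- a) \<partial>lborel)"

text \<open>Averaging the binomial series turns its coefficient (a)_n / n! into (a)_n B(b + n, c -
  b) / n!; the two reciprocal Gamma factors reduce the Beta value to (b)_n / \<Gamma>(c +
  n).\<close>

lemma hyp_cont_euler_integral:
  assumes "Re b > 0" "Re (c - b) > 0"
  shows "hyp_cont a b c (euler_integral a b c)"
  unfolding hyp_cont_def
proof
  show "euler_integral a b c holomorphic_on slit_plane"
    unfolding euler_integral_def
    by (intro holomorphic_intros holomorphic_beta_average holomorphic_one_minus_powr assms)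
  have nz: "rGamma b \<noteq> 0" "rGamma (c - b) \<noteq> 0"
    using assms by (auto simp: rGamma_eq_zero_iff dest!: nonpos_Ints_Re)
  have "euler_integral a b c has_fps_expansion fps_const (rGamma b * rGamma (c - b)) *
     Abs_fps (\<lambda>n. fps_nth (Abs_fps (\<lambda>n. pochhammer a n / fact n)) n * Beta (b + of_nat n) (c - b))"
    unfolding euler_integral_def
    by (intro fps_expansion_intros has_fps_expansion_beta_average holomorphic_one_minus_powr
          has_fps_expansion_one_minus_powr assms)
  moreover have "fps_const (rGamma b * rGamma (c - b)) *
     Abs_fps (\<lambda>n. fps_nth (Abs_fps (\<lambda>n. pochhammer a n / fact n)) n * Beta (b + of_nat n) (c - b)) =
     hyp_fps a b c"
  proof (rule fps_ext)
    fix n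
    have "b + of_nat n \<notin> \<int>\<^sub>\<le>\<^sub>0" using assms(1) by (auto dest!: nonpos_Ints_Re)
    hence "Gamma (b + of_nat n) * rGamma (b + of_nat n) = 1"
      by (simp add: Gamma_def rGamma_eq_zero_iff)
    hence "pochhammer b n = Gamma (b + of_nat n) * rGamma b"
      unfolding pochhammer_rGamma[of b n] by (simp add: mult_ac)
    moreover have "rGamma (c - b) * Gamma (c - b) = 1"
      using nz(2) by (simp add: Gamma_def)
    ultimately show "fps_nth (fps_const (rGamma b * rGamma (c - b)) *
     Abs_fps (\<lambda>n. fps_nth (Abs_fps (\<lambda>n. pochhammer a n / fact n)) n * Beta (b + of_nat n) (c - b))) n =
     fps_nth (hyp_fps a b c) n"
      by (simp add: hyp_fps_def Beta_altdef add_ac)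
  qed
  ultimately show "euler_integral a b c has_fps_expansion hyp_fps a b c" by simp
qed

text \<open>The identity theorem in the form needed throughout: an equation between formal power
  series becomes an equation between functions on the whole slit plane.\<close>

lemma holomorphic_eqI_fps:
  assumes "f holomorphic_on slit_plane" "g holomorphic_on slit_plane"
    and "f has_fps_expansion F" "g has_fps_expansion F" and "z \<in> slit_plane"
  shows "f z = g z"
proof -
  have "(\<lambda>z. f z - g z) has_fps_expansion F - F" using assms(3,4) by (rule has_fps_expansion_diff)
  hence e: "(\<lambda>z. f z - g z) has_fps_expansion 0" by simp
  have "(\<lambda>z. f z - g z) holomorphic_on slit_plane" using assms by (intro holomorphic_intros)
  from has_fps_expansion_0_analytic_continuation[OF e this open_slit_plane connected_slit_plane zero_in_slit_plane assms(5)]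
  show ?thesis by simp
qed

lemma hyp_cont_unique:
  assumes "hyp_cont a b c f" "hyp_cont a b c g" "z \<in> slit_plane"
  shows "f z = g z"
  using assms holomorphic_eqI_fps unfolding hyp_cont_def by blast

text \<open>Every parameter triple is reached from the region where Euler's integral converges by lowering
  the second and the third parameter.  The parameters are functions of an index, so that the same
  induction yields existence, holomorphy in the parameters and uniform bounds.\<close>

lemma hyp_parameter_induct:
  fixes a b c :: "'i \<Rightarrow> complex" and k j :: nat
  assumes adm: "\<And>f. f \<in> A \<Longrightarrow> (\<lambda>i. f i + 1) \<in> A" "a \<in> A" "b \<in> A" "c \<in> A"
    and base: "\<And>a b c. a \<in> A \<Longrightarrow> b \<in> A \<Longrightarrow> c \<in> A \<Longrightarrow>
      (\<And>i. i \<in> U \<Longrightarrow> Re (b i) > 1 \<and> Re (c i - b i) > 1) \<Longrightarrow> Q a b c"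
    and lower_b: "\<And>a b c. a \<in> A \<Longrightarrow> b \<in> A \<Longrightarrow> c \<in> A \<Longrightarrow> (\<And>i. i \<in> U \<Longrightarrow> Re (c i - b i) > 2) \<Longrightarrow>
      Q a (\<lambda>i. b i + 1) c \<Longrightarrow> Q a (\<lambda>i. b i + 2) c \<Longrightarrow> Q a b c"
    and lower_c: "\<And>a b c. a \<in> A \<Longrightarrow> b \<in> A \<Longrightarrow> c \<in> A \<Longrightarrow>
      Q a b (\<lambda>i. c i + 1) \<Longrightarrow> Q (\<lambda>i. a i + 1) (\<lambda>i. b i + 1) (\<lambda>i. c i + 2) \<Longrightarrow> Q a b c"
    and range: "\<And>i. i \<in> U \<Longrightarrow> Re (b i) > 1 - real k"
      "\<And>i. i \<in> U \<Longrightarrow> Re (c i - b i) > 1 + 2 * real k - real j"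
  shows "Q a b c"
proof -
  have adm2: "(\<lambda>i. f i + 2) \<in> A" if "f \<in> A" for f
    using adm(1)[OF adm(1)[OF that]] by (simp add: add.assoc)
  \<comment> \<open>Reducing k by one replaces b by b + 1 and b + 2. The latter lowers Re (c - b) by
    2, which accounts for the term 2 k in the range.\<close>
  have 1: "Q a b c" if "a \<in> A" "b \<in> A" "c \<in> A" "\<And>i. i \<in> U \<Longrightarrow> Re (b i) > 1 - real k"
    "\<And>i. i \<in> U \<Longrightarrow> Re (c i - b i) > 1 + 2 * real k" for a b c k
    using that
  proof (induction k arbitrary: a b c)
    case 0
    thus ?case by (intro base) auto
  next
    case (Suc k)
    show ?case
    proof (rule lower_b)
      fix i assume "i \<in> U"
      thus "Re (c i - b i) > 2" using Suc.prems(5)[of i] by simp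
    next
      show "Q a (\<lambda>i. b i + 1) c"
        using Suc.prems(4,5) by (intro Suc.IH adm Suc.prems(1-3)) fastforce+
      show "Q a (\<lambda>i. b i + 2) c"
        using Suc.prems(4,5) by (intro Suc.IH adm2 Suc.prems(1-3)) fastforce+
    qed (use Suc.prems in auto)
  qed
  \<comment> \<open>Both triples above c have Re (c - b) larger by exactly one, so each lowering of
    c uses up one unit of j and leaves k unchanged.\<close>
  show ?thesis using adm(2-) range
  proof (induction j arbitrary: a b c)
    case 0
    show ?case by (rule 1[where k=k]) (use 0 in auto)
  next
    case (Suc j)
    show ?case
    proof (rule lower_c)
      show "Q a b (\<lambda>i. c i + 1)"
        using Suc.prems(4,5) by (intro Suc.IH adm Suc.prems(1-3)) fastforce+
      show "Q (\<lambda>i. a i + 1) (\<lambda>i. b i + 1) (\<lambda>i. c i + 2)"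
        using Suc.prems(4,5) by (intro Suc.IH adm adm2 Suc.prems(1-3)) fastforce+
    qed (use Suc.prems in auto)
  qed
qed

text \<open>Bounded parameters need boundedly many lowerings, with counts common to the whole index
  set; this is what makes later conclusions uniform.\<close>

lemma exists_parameter_range:
  assumes "\<And>i. i \<in> U \<Longrightarrow> norm (b i) \<le> R" "\<And>i. i \<in> U \<Longrightarrow> norm (c i :: complex) \<le> R"
  obtains k j :: nat where "\<And>i. i \<in> U \<Longrightarrow> Re (b i) > 1 - real k"
      "\<And>i. i \<in> U \<Longrightarrow> Re (c i - b i) > 1 + 2 * real k - real j"
proof -
  obtain k :: nat where k: "real k > 1 + R" using reals_Archimedean2 by blast
  obtain j :: nat where j: "real j > 1 + 2 * real k + 2 * R" using reals_Archimedean2 by blast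
  show ?thesis
  proof (rule that)
    fix i assume i: "i \<in> U"
    show "Re (b i) > 1 - real k"
      using assms(1)[OF i] abs_Re_le_cmod[of "b i"] k by linarith
    show "Re (c i - b i) > 1 + 2 * real k - real j"
      using assms(1,2)[OF i] abs_Re_le_cmod[of "b i"] abs_Re_le_cmod[of "c i"] j by simp
  qed
qed

lemma hyp_cont_exists: "\<exists>f. hyp_cont a b c f"
proof -
  obtain k j :: nat where kj: "\<And>i::unit. i \<in> UNIV \<Longrightarrow> Re b > 1 - real k"
      "\<And>i::unit. i \<in> UNIV \<Longrightarrow> Re (c - b) > 1 + 2 * real k - real j"
    using exists_parameter_range[of UNIV "\<lambda>_::unit. b" "max (norm b) (norm c)" "\<lambda>_. c"] by auto
  \<comment> \<open>The index set is a single point here: only existence for one fixed triple is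
    wanted.\<close>
  define Q where "Q a b c \<longleftrightarrow> (\<exists>f. hyp_cont (a ()) (b ()) (c ()) f)" for a b c
  have "Q (\<lambda>_. a) (\<lambda>_. b) (\<lambda>_. c)"
  proof (rule hyp_parameter_induct[where Q=Q and A=UNIV and U=UNIV and k=k and j=j])
    fix a b c :: "unit \<Rightarrow> complex"
    assume "\<And>i. i \<in> UNIV \<Longrightarrow> Re (b i) > 1 \<and> Re (c i - b i) > 1"
    thus "Q a b c"
      unfolding Q_def using hyp_cont_euler_integral[of "b ()" "c ()" "a ()"] by fastforce
  next
    show "Q a b c" if pos: "\<And>i. i \<in> UNIV \<Longrightarrow> Re (c i - b i) > 2"
      and Q: "Q a (\<lambda>i. b i + 1) c" "Q a (\<lambda>i. b i + 2) c" for a b c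
    proof -
      define a' b' c' where "a' = a ()" "b' = b ()" "c' = c ()"
      obtain f g where fg: "hyp_cont a' (b' + 1) c' f" "hyp_cont a' (b' + 2) c' g"
        using Q by (auto simp: Q_def a'_b'_c'_def)
      have nz: "c' - b' - 1 \<noteq> 0" using pos[of "()"] by (auto simp: a'_b'_c'_def complex_eq_iff)
      define h where "h z = 1 / (c' - b' - 1) * ((c' - 2 * b' - 2) * f z - (a' - b' - 1) * (z * f z)
         + (b' + 1) * g z - (b' + 1) * (z * g z))" for z
      have "h has_fps_expansion fps_const (1 / (c' - b' - 1)) * (fps_const (c' - b' - 1) * hyp_fps a' b' c')"
        unfolding h_def hyp_fps_lower_b using fg
        by (intro fps_expansion_intros) (auto simp: hyp_cont_def)
      also have "fps_const (1 / (c' - b' - 1)) * (fps_const (c' - b' - 1) * hyp_fps a' b' c') = hyp_fps a' b' c'"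
        using nz by (simp add: mult.assoc[symmetric])
      finally have "h has_fps_expansion hyp_fps a' b' c'" .
      moreover have "h holomorphic_on slit_plane"
        unfolding h_def using fg by (intro holomorphic_intros) (auto simp: hyp_cont_def nz)
      ultimately have "hyp_cont a' b' c' h" by (simp add: hyp_cont_def)
      thus ?thesis by (auto simp: Q_def a'_b'_c'_def)
    qed
    show "Q a b c" if Q: "Q a b (\<lambda>i. c i + 1)" "Q (\<lambda>i. a i + 1) (\<lambda>i. b i + 1) (\<lambda>i. c i + 2)" for a b c
    proof -
      define a' b' c' where "a' = a ()" "b' = b ()" "c' = c ()"
      obtain f g where fg: "hyp_cont a' b' (c' + 1) f" "hyp_cont (a' + 1) (b' + 1) (c' + 2) g"
        using Q by (auto simp: Q_def a'_b'_c'_def)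
      define h where "h z = c' * f z + a' * b' * (z * g z)" for z
      have "h has_fps_expansion hyp_fps a' b' c'"
        unfolding h_def using fg
        by (subst hyp_fps_lower_c, intro fps_expansion_intros) (auto simp: hyp_cont_def)
      moreover have "h holomorphic_on slit_plane"
        unfolding h_def using fg by (intro holomorphic_intros) (auto simp: hyp_cont_def)
      ultimately have "hyp_cont a' b' c' h" by (simp add: hyp_cont_def)
      thus ?thesis by (auto simp: Q_def a'_b'_c'_def)
    qed
  qed (use kj in auto)
  thus ?thesis by (simp add: Q_def)
qed

text \<open>A continuation exists, so the chosen function has the defining property; it agrees with
  that continuation near 0 and inherits its expansion.\<close>

lemma hyp_cont_hyp_reg: "hyp_cont a b c (hyp_reg a b c)"
proof -
  obtain f where f: "hyp_cont a b c f" using hyp_cont_exists by blast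
  define P where "P g \<longleftrightarrow> g holomorphic_on slit_plane \<and> (\<forall>z\<in>ball 0 1. g z =
          (\<Sum>n. pochhammer a n * pochhammer b n * rGamma (c + of_nat n) * z ^ n / fact n))" for g
  have fs: "f z = (\<Sum>n. pochhammer a n * pochhammer b n * rGamma (c + of_nat n) * z ^ n / fact n)"
    if "z \<in> ball 0 1" for z
  proof -
    have "f holomorphic_on ball 0 1"
      using f holomorphic_on_subset[OF _ ball_subset_slit_plane] by (simp add: hyp_cont_def)
    hence "f holomorphic_on eball 0 1" by (simp add: one_ereal_def)
    hence "(\<lambda>n. fps_nth (hyp_fps a b c) n * z ^ n) sums f z"
      using f that unfolding hyp_cont_def
      by (intro has_fps_expansion_imp_sums_complex[where r=1]) (auto simp: one_ereal_def)
    thus ?thesis by (simp add: hyp_fps_def sums_iff)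
  qed
  hence "P f" using f by (simp add: P_def hyp_cont_def)
  moreover have "hyp_reg a b c = (SOME g. P g)"
    by (simp add: hyp_reg_def P_def slit_plane_def)
  ultimately have P: "P (hyp_reg a b c)" by (metis someI)
  have "\<forall>\<^sub>F z in nhds 0. z \<in> ball (0::complex) 1" by (intro eventually_nhds_in_open) auto
  hence "\<forall>\<^sub>F z in nhds 0. f z = hyp_reg a b c z"
    by (rule eventually_mono) (use fs P in \<open>auto simp: P_def\<close>)
  moreover have "f has_fps_expansion hyp_fps a b c" using f by (simp add: hyp_cont_def)
  ultimately have "hyp_reg a b c has_fps_expansion hyp_fps a b c"
    using has_fps_expansion_cong by blast
  thus ?thesis using P by (simp add: hyp_cont_def P_def)
qed

section \<open>Functional identities for \<open>hyp_reg\<close>\<close>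

lemma holomorphic_hyp_reg: "hyp_reg a b c holomorphic_on slit_plane"
  using hyp_cont_hyp_reg by (simp add: hyp_cont_def)

lemma has_fps_expansion_hyp_reg: "hyp_reg a b c has_fps_expansion hyp_fps a b c"
  using hyp_cont_hyp_reg by (simp add: hyp_cont_def)

lemma hyp_reg_eqI:
  assumes "f holomorphic_on slit_plane" "f has_fps_expansion hyp_fps a b c" "z \<in> slit_plane"
  shows "hyp_reg a b c z = f z"
  using hyp_cont_unique[OF hyp_cont_hyp_reg _ assms(3)] assms(1,2) by (simp add: hyp_cont_def)

lemma hyp_reg_eq_euler_integral:
  assumes "Re b > 0" "Re (c - b) > 0" "z \<in> slit_plane"
  shows "hyp_reg a b c z = euler_integral a b c z"
  using hyp_cont_euler_integral[OF assms(1,2), of a] assms(3)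
  by (intro hyp_reg_eqI) (auto simp: hyp_cont_def)

lemma hyp_reg_lower_c:
  assumes "z \<in> slit_plane"
  shows "hyp_reg a b c z = c * hyp_reg a b (c + 1) z + a * b * (z * hyp_reg (a + 1) (b + 1) (c + 2) z)"
proof (rule hyp_reg_eqI[OF _ _ assms])
  show "(\<lambda>z. c * hyp_reg a b (c + 1) z + a * b * (z * hyp_reg (a + 1) (b + 1) (c + 2) z)) has_fps_expansion hyp_fps a b c"
    by (subst hyp_fps_lower_c, intro fps_expansion_intros has_fps_expansion_hyp_reg)
qed (intro holomorphic_intros holomorphic_hyp_reg)

lemma hyp_reg_lower_b:
  assumes "z \<in> slit_plane"
  shows "(c - b - 1) * hyp_reg a b c z =
     (c - 2 * b - 2) * hyp_reg a (b + 1) c z - (a - b - 1) * (z * hyp_reg a (b + 1) c z)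
     + (b + 1) * hyp_reg a (b + 2) c z - (b + 1) * (z * hyp_reg a (b + 2) c z)"
proof (rule holomorphic_eqI_fps[OF _ _ _ _ assms])
  show "(\<lambda>z. (c - b - 1) * hyp_reg a b c z) has_fps_expansion fps_const (c - b - 1) * hyp_fps a b c"
    by (intro fps_expansion_intros has_fps_expansion_hyp_reg)
  show "(\<lambda>z. (c - 2 * b - 2) * hyp_reg a (b + 1) c z - (a - b - 1) * (z * hyp_reg a (b + 1) c z)
     + (b + 1) * hyp_reg a (b + 2) c z - (b + 1) * (z * hyp_reg a (b + 2) c z))
     has_fps_expansion fps_const (c - b - 1) * hyp_fps a b c"
    unfolding hyp_fps_lower_b by (intro fps_expansion_intros has_fps_expansion_hyp_reg)
qed (intro holomorphic_intros holomorphic_hyp_reg)+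

lemma hyp_reg_commute:
  assumes "z \<in> slit_plane"
  shows "hyp_reg a b c z = hyp_reg b a c z"
proof (rule hyp_reg_eqI[OF _ _ assms])
  have "hyp_fps a b c = hyp_fps b a c" by (simp add: hyp_fps_def mult_ac)
  thus "hyp_reg b a c has_fps_expansion hyp_fps a b c" using has_fps_expansion_hyp_reg by simp
qed (rule holomorphic_hyp_reg)

text \<open>The product on the right solves the hypergeometric equation with parameters a, b, c and
  has the constant term \<open>rGamma c\<close>, so \<open>hyp_fps_unique\<close> identifies its
  expansion.\<close>

lemma hyp_reg_euler_transformation:
  assumes "z \<in> slit_plane" and c: "c \<notin> \<int>\<^sub>\<le>\<^sub>0"
  shows "hyp_reg a b c z = (1 - z) powr (c - a - b) * hyp_reg (c - a) (c - b) c z"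
proof (rule hyp_reg_eqI[OF _ _ assms(1)])
  define e where "e = c - a - b"
  define P where "P = Abs_fps (\<lambda>n. pochhammer (- e) n / fact n)"
  define H where "H = hyp_fps (c - a) (c - b) c"
  show "(\<lambda>z. (1 - z) powr (c - a - b) * hyp_reg (c - a) (c - b) c z) holomorphic_on slit_plane"
    by (intro holomorphic_intros holomorphic_one_minus_powr holomorphic_hyp_reg)
  have "(\<lambda>z. (1 - z) powr (- (- e)) * hyp_reg (c - a) (c - b) c z) has_fps_expansion P * H"
    unfolding P_def H_def
    by (intro fps_expansion_intros has_fps_expansion_one_minus_powr has_fps_expansion_hyp_reg)
  moreover have "P * H = hyp_fps a b c"
  proof (rule hyp_fps_unique[OF _ _ c])
    \<comment> \<open>The formal counterpart of the first-order equation (1 - z) y' = - e y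
      satisfied by (1 - z)^e.\<close>
    have P1: "(1 - fps_X) * fps_deriv P = - (fps_const e * P)"
    proof (rule fps_ext)
      fix n
      have "of_nat (Suc n) * fps_nth P (Suc n) = (- e + of_nat n) * fps_nth P n" for n
        unfolding P_def fps_nth_Abs_fps pochhammer_rec'
        by (simp del: of_nat_Suc add: field_simps)
      note r = this[of n] this[of "n - 1"]
      show "fps_nth ((1 - fps_X) * fps_deriv P) n = fps_nth (- (fps_const e * P)) n"
        using r by (cases n) (simp_all add: left_diff_distrib algebra_simps)
    qed
    have P2: "(1 - fps_X) * fps_deriv (fps_deriv P) = fps_deriv P - fps_const e * fps_deriv P"
    proof -
      have "fps_deriv ((1 - fps_X) * fps_deriv P) = fps_deriv (- (fps_const e * P))" by (simp add: P1)
      thus ?thesis by (simp add: algebra_simps)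
    qed
    have Hode: "fps_X * (1 - fps_X) * fps_deriv (fps_deriv H)
     + (fps_const c - (fps_const e + fps_const c + 1) * fps_X) * fps_deriv H
     - (fps_const c * fps_const e + fps_const a * fps_const b) * H = 0"
    proof -
      have eqs: "c - a + (c - b) + 1 = e + c + 1" "(c - a) * (c - b) = c * e + a * b"
        by (simp_all add: e_def algebra_simps)
      show ?thesis using hyp_fps_ode[of "c - a" "c - b" c] unfolding eqs H_def[symmetric]
        by (simp add: fps_const_add[symmetric] fps_const_mult[symmetric] del: fps_const_add fps_const_mult)
    qed
    have e: "fps_const a + fps_const b + 1 = fps_const c - fps_const e + 1"
      by (simp add: e_def fps_const_sub[symmetric] del: fps_const_sub)
    define D where "D = fps_X * (1 - fps_X) * fps_deriv (fps_deriv (P * H))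
     + (fps_const c - (fps_const c - fps_const e + 1) * fps_X) * fps_deriv (P * H)
     - fps_const a * fps_const b * (P * H)"
    have D: "fps_deriv (P * H) = P * fps_deriv H + fps_deriv P * H"
      "fps_deriv (fps_deriv (P * H)) = P * fps_deriv (fps_deriv H) + 2 * (fps_deriv P * fps_deriv H)
         + fps_deriv (fps_deriv P) * H"
      by (simp_all add: algebra_simps)
    define X where "X = (fps_X :: complex fps)"
    define p0 p1 p2 h0 h1 h2 where "p0 = P" "p1 = fps_deriv P" "p2 = fps_deriv (fps_deriv P)"
      "h0 = H" "h1 = fps_deriv H" "h2 = fps_deriv (fps_deriv H)"
    define A B C E where "A = fps_const a" "B = fps_const b" "C = fps_const c" "E = fps_const e"
    \<comment> \<open>The extra factor 1 - X makes it possible to eliminate both derivatives of P by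
      \<open>P1\<close> and \<open>P2\<close>. It can be cancelled afterwards, since formal power
      series over a field have no zero divisors.\<close>
    have "(1 - X) * (X * (1 - X) * (p0 * h2 + 2 * (p1 * h1) + p2 * h0) +
        (C - (C - E + 1) * X) * (p0 * h1 + p1 * h0) - A * B * (p0 * h0)) = 0"
    proof -
      have "(1 - X) * p1 = - (E * p0)" "(1 - X) * p2 = p1 - E * p1"
        "X * (1 - X) * h2 + (C - (E + C + 1) * X) * h1 - (C * E + A * B) * h0 = 0"
        unfolding X_def p0_p1_p2_h0_h1_h2_def A_B_C_E_def by (rule P1 P2 Hode)+
      thus ?thesis by algebra
    qed
    hence "(1 - fps_X) * D = 0"
      unfolding D_def D(2) unfolding D(1) X_def p0_p1_p2_h0_h1_h2_def A_B_C_E_def by assumption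
    moreover have "(1 - fps_X :: complex fps) \<noteq> 0"
    proof
      assume "(1 - fps_X :: complex fps) = 0"
      hence "fps_nth (1 - fps_X :: complex fps) 0 = 0" by simp
      thus False by simp
    qed
    ultimately have "D = 0" by simp
    thus "fps_X * (1 - fps_X) * fps_deriv (fps_deriv (P * H))
      + (fps_const c - fps_const (a + b + 1) * fps_X) * fps_deriv (P * H) - fps_const (a * b) * (P * H) = 0"
      using e by (simp add: D_def fps_const_add[symmetric] fps_const_mult[symmetric] del: fps_const_add fps_const_mult)
    show "fps_nth (P * H) 0 = rGamma c" by (simp add: P_def H_def)
  qed
  ultimately show "(\<lambda>z. (1 - z) powr (c - a - b) * hyp_reg (c - a) (c - b) c z) has_fps_expansion hyp_fps a b c"
    by (simp add: e_def)
qed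

lemma hyp_reg_ode:
  assumes z: "z \<in> slit_plane"
  shows "z * (1 - z) * deriv (deriv (hyp_reg a b c)) z + (c - (a + b + 1) * z) * deriv (hyp_reg a b c) z
    - a * b * hyp_reg a b c z = 0"
proof (rule holomorphic_eqI_fps[OF _ _ _ _ z])
  show "(\<lambda>z. z * (1 - z) * deriv (deriv (hyp_reg a b c)) z + (c - (a + b + 1) * z) * deriv (hyp_reg a b c) z
    - a * b * hyp_reg a b c z) has_fps_expansion 0"
    by (subst hyp_fps_ode[of a b c, symmetric], intro fps_expansion_intros has_fps_expansion_hyp_reg)
qed (intro holomorphic_intros holomorphic_hyp_reg holomorphic_deriv open_slit_plane | rule has_fps_expansion_0)+

text \<open>On coefficients, B(c + n, d) / (\<Gamma>(d) \<Gamma>(c + n)) = 1/\<Gamma>(c + d + n). It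
  will be applied with c = 1/2, where the function under the integral is elementary.\<close>

lemma hyp_reg_bateman:
  assumes "Re c > 0" "Re d > 0" "z \<in> slit_plane"
  shows "hyp_reg a b (c + d) z = rGamma d * (\<integral>r. beta_kernel c d r * hyp_reg a b c (of_real r * z) \<partial>lborel)"
proof (rule hyp_reg_eqI[OF _ _ assms(3)])
  have "(\<lambda>z. rGamma d * (\<integral>r. beta_kernel c d r * hyp_reg a b c (of_real r * z) \<partial>lborel)) has_fps_expansion
      fps_const (rGamma d) * Abs_fps (\<lambda>n. fps_nth (hyp_fps a b c) n * Beta (c + of_nat n) d)"
    by (intro fps_expansion_intros has_fps_expansion_beta_average holomorphic_hyp_reg
          has_fps_expansion_hyp_reg assms)
  also have "\<dots> = hyp_fps a b (c + d)"
  proof (rule fps_ext)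
    fix n
    have "rGamma d \<noteq> 0" using nonpos_Ints_Re[of d] assms(2) by (auto simp: rGamma_eq_zero_iff)
    hence "Gamma d * rGamma d = 1" by (simp add: Gamma_def)
    moreover have "c + of_nat n \<notin> \<int>\<^sub>\<le>\<^sub>0" using assms(1) by (auto dest!: nonpos_Ints_Re)
    hence "Gamma (c + of_nat n) * rGamma (c + of_nat n) = 1"
      by (simp add: Gamma_def rGamma_eq_zero_iff)
    ultimately show "fps_nth (fps_const (rGamma d) * Abs_fps (\<lambda>n. fps_nth (hyp_fps a b c) n * Beta (c + of_nat n) d)) n =
        fps_nth (hyp_fps a b (c + d)) n"
      by (simp add: hyp_fps_def Beta_altdef add_ac mult_ac)
  qed
  finally show "(\<lambda>z. rGamma d * (\<integral>r. beta_kernel c d r * hyp_reg a b c (of_real r * z) \<partial>lborel)) has_fps_expansion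
      hyp_fps a b (c + d)" .
qed (intro holomorphic_intros holomorphic_beta_average holomorphic_hyp_reg assms)

section \<open>Dependence on the parameters\<close>

text \<open>The reason for real parts above 1 rather than 0 in the base case of the parameter
  induction: the kernel is then bounded, uniformly in its parameters.\<close>

lemma norm_beta_kernel_le_indicator:
  assumes "Re p \<ge> 1" "Re q \<ge> 1"
  shows "norm (beta_kernel p q r) \<le> indicator {0<..<1} r"
proof (cases "r \<in> {0<..<1}")
  case True
  hence "r powr (Re p - 1) * (1 - r) powr (Re q - 1) \<le> 1 * 1"
    using assms by (intro mult_mono powr_le1) auto
  thus ?thesis using True by (simp add: norm_beta_kernel)
qed (simp add: norm_beta_kernel)

lemma holomorphic_euler_integral_params:
  assumes "open V" "a holomorphic_on V" "b holomorphic_on V" "c holomorphic_on V" "g holomorphic_on V"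
    and g: "\<And>\<zeta>. \<zeta> \<in> V \<Longrightarrow> g \<zeta> \<in> slit_plane"
    and re: "\<And>\<zeta>. \<zeta> \<in> V \<Longrightarrow> Re (b \<zeta>) > 1 \<and> Re (c \<zeta> - b \<zeta>) > 1"
  shows "(\<lambda>\<zeta>. euler_integral (a \<zeta>) (b \<zeta>) (c \<zeta>) (g \<zeta>)) holomorphic_on V"
proof -
  have "(\<lambda>\<zeta>. \<integral>r. beta_kernel (b \<zeta>) (c \<zeta> - b \<zeta>) r * (1 - of_real r * g \<zeta>) powr (- a \<zeta>) \<partial>lborel) holomorphic_on V"
  proof (rule holomorphic_lebesgue_integral[OF \<open>open V\<close>])
    fix r :: real
    show "(\<lambda>\<zeta>. beta_kernel (b \<zeta>) (c \<zeta> - b \<zeta>) r * (1 - of_real r * g \<zeta>) powr (- a \<zeta>)) holomorphic_on V"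
    proof (cases "r \<in> {0<..<1}")
      case True
      thus ?thesis unfolding beta_kernel_def
        by (intro holomorphic_intros assms one_minus_not_nonpos_Reals scale_in_slit_plane) auto
    qed (simp add: beta_kernel_def)
  next
    show "(\<lambda>r. beta_kernel (b \<zeta>) (c \<zeta> - b \<zeta>) r * (1 - of_real r * g \<zeta>) powr (- a \<zeta>)) \<in> borel_measurable lborel" for \<zeta>
      by measurable
  next
    fix \<zeta>0 assume "\<zeta>0 \<in> V"
    then obtain e where e: "e > 0" "cball \<zeta>0 e \<subseteq> V" using \<open>open V\<close> open_contains_cball by blast
    let ?K = "{0..1::real} \<times> cball \<zeta>0 e"
    have cont: "continuous_on (cball \<zeta>0 e) f" if "f holomorphic_on V" for f
      using that e holomorphic_on_imp_continuous_on continuous_on_subset by blast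
    have cont2: "continuous_on ?K (\<lambda>x. f (snd x))" if "f holomorphic_on V" for f
      by (rule continuous_on_compose2[OF cont[OF that]]) (auto intro!: continuous_intros)
    have "compact ?K" by (intro compact_Times) auto
    moreover have "continuous_on ?K (\<lambda>x. (1 - of_real (fst x) * g (snd x)) powr (- a (snd x)))"
    proof (intro continuous_on_powr_complex continuous_intros cont2 assms)
      show "?K \<subseteq> {z. Re (1 - of_real (fst z) * g (snd z)) \<ge> 0 \<or> Im (1 - of_real (fst z) * g (snd z)) \<noteq> 0}"
      proof (clarify, goal_cases)
        case (1 r \<zeta>)
        hence "of_real r * g \<zeta> \<in> slit_plane" using g e by (intro scale_in_slit_plane) auto
        thus ?case using 1 by (auto simp: mem_slit_plane_iff)
      qed
      show "1 - of_real (fst x) * g (snd x) = 0 \<Longrightarrow> Re (- a (snd x)) > 0" if "x \<in> ?K" for x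
      proof -
        assume z: "1 - of_real (fst x) * g (snd x) = 0"
        have "of_real (fst x) * g (snd x) \<in> slit_plane" using that g e by (intro scale_in_slit_plane) auto
        thus ?thesis using z one_minus_not_nonpos_Reals by fastforce
      qed
    qed
    ultimately have "bounded ((\<lambda>x. (1 - of_real (fst x) * g (snd x)) powr (- a (snd x))) ` ?K)"
      by (intro compact_imp_bounded compact_continuous_image)
    then obtain B where B: "\<And>x. x \<in> ?K \<Longrightarrow> norm ((1 - of_real (fst x) * g (snd x)) powr (- a (snd x))) \<le> B"
      unfolding bounded_iff by blast
    show "\<exists>r>0. \<exists>h. integrable lborel h \<and> (\<forall>\<zeta>\<in>ball \<zeta>0 r \<inter> V. \<forall>t\<in>space lborel.
        norm (beta_kernel (b \<zeta>) (c \<zeta> - b \<zeta>) t * (1 - of_real t * g \<zeta>) powr (- a \<zeta>)) \<le> h t)"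
    proof (intro exI conjI ballI)
      show "integrable lborel (\<lambda>t. B * indicator {0<..<1::real} t)" by simp
      fix \<zeta> t assume z: "\<zeta> \<in> ball \<zeta>0 e \<inter> V"
      show "norm (beta_kernel (b \<zeta>) (c \<zeta> - b \<zeta>) t * (1 - of_real t * g \<zeta>) powr (- a \<zeta>)) \<le> B * indicator {0<..<1} t"
      proof (cases "t \<in> {0<..<1}")
        case True
        have "norm (beta_kernel (b \<zeta>) (c \<zeta> - b \<zeta>) t) * norm ((1 - of_real t * g \<zeta>) powr (- a \<zeta>)) \<le> 1 * B"
          using norm_beta_kernel_le_indicator[of "b \<zeta>" "c \<zeta> - b \<zeta>" t] re[of \<zeta>] z True B[of "(t, \<zeta>)"]
          by (intro mult_mono) auto
        thus ?thesis using True by (simp add: norm_mult)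
      qed (simp add: beta_kernel_def)
    qed (rule e)
  qed
  thus ?thesis unfolding euler_integral_def by (intro holomorphic_intros assms)
qed

text \<open>Holomorphy is local, and on a small disc the parameter functions are bounded. The
  parameter induction therefore runs with fixed counts on the class of functions holomorphic on that
  disc.\<close>

lemma holomorphic_hyp_reg_params:
  assumes "open U" and a: "a holomorphic_on U" and b: "b holomorphic_on U"
    and c: "c holomorphic_on U" and g: "g holomorphic_on U"
    and gU: "\<And>\<zeta>. \<zeta> \<in> U \<Longrightarrow> g \<zeta> \<in> slit_plane"
  shows "(\<lambda>\<zeta>. hyp_reg (a \<zeta>) (b \<zeta>) (c \<zeta>) (g \<zeta>)) holomorphic_on U"
proof (rule holomorphic_onI)
  fix \<zeta>0 assume z0: "\<zeta>0 \<in> U"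
  obtain e where e: "e > 0" "cball \<zeta>0 e \<subseteq> U" using z0 \<open>open U\<close> open_contains_cball by blast
  define V where "V = ball \<zeta>0 e"
  have V: "open V" "V \<subseteq> U" "V \<subseteq> cball \<zeta>0 e" "\<zeta>0 \<in> V" using e by (auto simp: V_def)
  have bdd: "\<exists>R. \<forall>\<zeta>\<in>V. norm (f \<zeta>) \<le> R" if "f holomorphic_on U" for f
  proof -
    have "continuous_on (cball \<zeta>0 e) f"
      using that e holomorphic_on_imp_continuous_on continuous_on_subset by blast
    hence "bounded (f ` cball \<zeta>0 e)" by (intro compact_imp_bounded compact_continuous_image) auto
    thus ?thesis using V(3) unfolding bounded_iff by (meson image_eqI subsetD)
  qed
  obtain R1 R2 where R: "\<And>\<zeta>. \<zeta> \<in> V \<Longrightarrow> norm (b \<zeta>) \<le> R1" "\<And>\<zeta>. \<zeta> \<in> V \<Longrightarrow> norm (c \<zeta>) \<le> R2"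
    using bdd[OF b] bdd[OF c] by blast
  obtain k j :: nat where kj: "\<And>\<zeta>. \<zeta> \<in> V \<Longrightarrow> Re (b \<zeta>) > 1 - real k"
      "\<And>\<zeta>. \<zeta> \<in> V \<Longrightarrow> Re (c \<zeta> - b \<zeta>) > 1 + 2 * real k - real j"
    using exists_parameter_range[of V b "max R1 R2" c] R by (metis max.coboundedI1 max.coboundedI2)
  define Q where "Q a b c \<longleftrightarrow> (\<lambda>\<zeta>. hyp_reg (a \<zeta>) (b \<zeta>) (c \<zeta>) (g \<zeta>)) holomorphic_on V" for a b c
  have gV: "g holomorphic_on V" "\<And>\<zeta>. \<zeta> \<in> V \<Longrightarrow> g \<zeta> \<in> slit_plane"
    using g gU V holomorphic_on_subset by blast+
  have "Q a b c"
  proof (rule hyp_parameter_induct[where Q=Q and A="{f. f holomorphic_on V}" and U=V and k=k and j=j])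
    fix a b c
    assume h: "a \<in> {f. f holomorphic_on V}" "b \<in> {f. f holomorphic_on V}" "c \<in> {f. f holomorphic_on V}"
      and re: "\<And>\<zeta>. \<zeta> \<in> V \<Longrightarrow> Re (b \<zeta>) > 1 \<and> Re (c \<zeta> - b \<zeta>) > 1"
    have "(\<lambda>\<zeta>. euler_integral (a \<zeta>) (b \<zeta>) (c \<zeta>) (g \<zeta>)) holomorphic_on V"
      using h re gV V by (intro holomorphic_euler_integral_params) auto
    moreover have "euler_integral (a \<zeta>) (b \<zeta>) (c \<zeta>) (g \<zeta>) = hyp_reg (a \<zeta>) (b \<zeta>) (c \<zeta>) (g \<zeta>)" if "\<zeta> \<in> V" for \<zeta>
      using re[OF that] gV(2)[OF that] by (intro hyp_reg_eq_euler_integral[symmetric]) auto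
    ultimately show "Q a b c" unfolding Q_def by (rule holomorphic_transform)
  next
    fix a b c
    assume h: "a \<in> {f. f holomorphic_on V}" "b \<in> {f. f holomorphic_on V}" "c \<in> {f. f holomorphic_on V}"
      and re: "\<And>\<zeta>. \<zeta> \<in> V \<Longrightarrow> Re (c \<zeta> - b \<zeta>) > 2"
      and Q: "Q a (\<lambda>\<zeta>. b \<zeta> + 1) c" "Q a (\<lambda>\<zeta>. b \<zeta> + 2) c"
    have nz: "c \<zeta> - b \<zeta> - 1 \<noteq> 0" if "\<zeta> \<in> V" for \<zeta> using re[OF that] by (auto simp: complex_eq_iff)
    have "(\<lambda>\<zeta>. ((c \<zeta> - 2 * b \<zeta> - 2) * hyp_reg (a \<zeta>) (b \<zeta> + 1) (c \<zeta>) (g \<zeta>)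
       - (a \<zeta> - b \<zeta> - 1) * (g \<zeta> * hyp_reg (a \<zeta>) (b \<zeta> + 1) (c \<zeta>) (g \<zeta>))
       + (b \<zeta> + 1) * hyp_reg (a \<zeta>) (b \<zeta> + 2) (c \<zeta>) (g \<zeta>)
       - (b \<zeta> + 1) * (g \<zeta> * hyp_reg (a \<zeta>) (b \<zeta> + 2) (c \<zeta>) (g \<zeta>))) / (c \<zeta> - b \<zeta> - 1)) holomorphic_on V"
      (is "?f holomorphic_on V")
      using h Q gV nz unfolding Q_def by (intro holomorphic_intros) auto
    moreover have "?f \<zeta> = hyp_reg (a \<zeta>) (b \<zeta>) (c \<zeta>) (g \<zeta>)" if "\<zeta> \<in> V" for \<zeta>
      unfolding hyp_reg_lower_b[OF gV(2)[OF that], symmetric] using nz[OF that] by simp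
    ultimately show "Q a b c" unfolding Q_def by (rule holomorphic_transform)
  next
    fix a b c
    assume h: "a \<in> {f. f holomorphic_on V}" "b \<in> {f. f holomorphic_on V}" "c \<in> {f. f holomorphic_on V}"
      and Q: "Q a b (\<lambda>\<zeta>. c \<zeta> + 1)" "Q (\<lambda>\<zeta>. a \<zeta> + 1) (\<lambda>\<zeta>. b \<zeta> + 1) (\<lambda>\<zeta>. c \<zeta> + 2)"
    have "(\<lambda>\<zeta>. c \<zeta> * hyp_reg (a \<zeta>) (b \<zeta>) (c \<zeta> + 1) (g \<zeta>)
        + a \<zeta> * b \<zeta> * (g \<zeta> * hyp_reg (a \<zeta> + 1) (b \<zeta> + 1) (c \<zeta> + 2) (g \<zeta>))) holomorphic_on V"
      (is "?f holomorphic_on V")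
      using h Q gV unfolding Q_def by (intro holomorphic_intros) auto
    moreover have "?f \<zeta> = hyp_reg (a \<zeta>) (b \<zeta>) (c \<zeta>) (g \<zeta>)" if "\<zeta> \<in> V" for \<zeta>
      by (rule hyp_reg_lower_c[OF gV(2)[OF that], symmetric])
    ultimately show "Q a b c" unfolding Q_def by (rule holomorphic_transform)
  qed (use a b c V kj holomorphic_on_subset in \<open>auto intro!: holomorphic_intros\<close>)
  thus "(\<lambda>\<zeta>. hyp_reg (a \<zeta>) (b \<zeta>) (c \<zeta>) (g \<zeta>)) field_differentiable at \<zeta>0 within U"
    using V unfolding Q_def by (metis field_differentiable_at_within holomorphic_on_imp_differentiable_at)
qed

section \<open>Uniform polynomial growth on the negative axis\<close>

text \<open>Both hypergeometric arguments in the integrand, 1 - w^2 and (1 - x)/2, run along the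
  negative axis. K and N are common to all i because domination needs one bound for a whole set of
  parameters.\<close>

definition poly_bdd :: "'i set \<Rightarrow> ('i \<Rightarrow> real \<Rightarrow> complex) \<Rightarrow> bool" where
  "poly_bdd U F \<longleftrightarrow> (\<exists>K N. \<forall>i\<in>U. \<forall>y\<ge>0. norm (F i y) \<le> K * (1 + y) ^ N)"

lemma poly_bddE:
  assumes "poly_bdd U F"
  shows "\<exists>K\<ge>0. \<exists>N. \<forall>i\<in>U. \<forall>y\<ge>0. norm (F i y) \<le> K * (1 + y) ^ N"
proof -
  obtain K N where KN: "\<And>i y. i \<in> U \<Longrightarrow> y \<ge> 0 \<Longrightarrow> norm (F i y) \<le> K * (1 + y) ^ N"
    using assms by (auto simp: poly_bdd_def)
  have "norm (F i y) \<le> \<bar>K\<bar> * (1 + y) ^ N" if "i \<in> U" "y \<ge> 0" for i y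
  proof -
    have "K * (1 + y) ^ N \<le> \<bar>K\<bar> * (1 + y) ^ N" using that by (intro mult_right_mono) auto
    thus ?thesis using KN[OF that] by linarith
  qed
  thus ?thesis by (intro exI[of _ "\<bar>K\<bar>"] conjI exI[of _ N] ballI allI impI) auto
qed

lemma poly_bdd_add:
  assumes "poly_bdd U F" "poly_bdd U G"
  shows "poly_bdd U (\<lambda>i y. F i y + G i y)"
proof -
  obtain K N where K: "K \<ge> 0" "\<And>i y. i \<in> U \<Longrightarrow> y \<ge> 0 \<Longrightarrow> norm (F i y) \<le> K * (1 + y) ^ N"
    using poly_bddE[OF assms(1)] by blast
  obtain L M where L: "L \<ge> 0" "\<And>i y. i \<in> U \<Longrightarrow> y \<ge> 0 \<Longrightarrow> norm (G i y) \<le> L * (1 + y) ^ M"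
    using poly_bddE[OF assms(2)] by blast
  have "norm (F i y + G i y) \<le> (K + L) * (1 + y) ^ (N + M)" if "i \<in> U" "y \<ge> 0" for i y
  proof -
    have "K * (1 + y) ^ N \<le> K * (1 + y) ^ (N + M)" "L * (1 + y) ^ M \<le> L * (1 + y) ^ (N + M)"
      using that K L by (intro mult_left_mono power_increasing; simp)+
    thus ?thesis using K(2)[OF that] L(2)[OF that] norm_triangle_ineq[of "F i y" "G i y"]
      by (simp add: distrib_right)
  qed
  thus ?thesis unfolding poly_bdd_def by blast
qed

lemma poly_bdd_mult:
  assumes "poly_bdd U F" "poly_bdd U G"
  shows "poly_bdd U (\<lambda>i y. F i y * G i y)"
proof -
  obtain K N where K: "K \<ge> 0" "\<And>i y. i \<in> U \<Longrightarrow> y \<ge> 0 \<Longrightarrow> norm (F i y) \<le> K * (1 + y) ^ N"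
    using poly_bddE[OF assms(1)] by blast
  obtain L M where L: "L \<ge> 0" "\<And>i y. i \<in> U \<Longrightarrow> y \<ge> 0 \<Longrightarrow> norm (G i y) \<le> L * (1 + y) ^ M"
    using poly_bddE[OF assms(2)] by blast
  have "norm (F i y * G i y) \<le> (K * L) * (1 + y) ^ (N + M)" if "i \<in> U" "y \<ge> 0" for i y
  proof -
    have "norm (F i y) * norm (G i y) \<le> (K * (1 + y) ^ N) * (L * (1 + y) ^ M)"
      using K L that by (intro mult_mono) auto
    thus ?thesis by (simp add: norm_mult power_add mult_ac)
  qed
  thus ?thesis unfolding poly_bdd_def by blast
qed

lemma poly_bdd_const: "(\<And>i. i \<in> U \<Longrightarrow> norm (f i) \<le> M) \<Longrightarrow> poly_bdd U (\<lambda>i y. f i)"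
  unfolding poly_bdd_def by (rule exI[of _ M], rule exI[of _ 0]) auto

lemma poly_bdd_arg: "poly_bdd U (\<lambda>i y. - complex_of_real y)"
  unfolding poly_bdd_def by (rule exI[of _ 1], rule exI[of _ 1]) auto

lemma poly_bdd_mono:
  assumes "poly_bdd U G" "\<And>i y. i \<in> U \<Longrightarrow> y \<ge> 0 \<Longrightarrow> norm (F i y) \<le> norm (G i y)"
  shows "poly_bdd U F"
  using assms unfolding poly_bdd_def by (meson order_trans)

lemma rGamma_bounded:
  "\<exists>M. \<forall>z. norm (z :: complex) \<le> R \<longrightarrow> norm (rGamma z) \<le> M"
proof -
  have "continuous_on (cball 0 R) (rGamma :: complex \<Rightarrow> complex)"
    by (intro holomorphic_on_imp_continuous_on holomorphic_rGamma)
  hence "bounded (rGamma ` cball (0::complex) R)" by (intro compact_imp_bounded compact_continuous_image) auto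
  then obtain M where "\<forall>z\<in>cball (0::complex) R. norm (rGamma z) \<le> M"
    unfolding bounded_iff by blast
  thus ?thesis by (intro exI[of _ M]) auto
qed

lemma neg_in_slit_plane: "y \<ge> 0 \<Longrightarrow> - complex_of_real y \<in> slit_plane"
  by (simp add: mem_slit_plane_iff)

text \<open>In Euler's region the power under the integral is at most (1 + y)^N once N bounds the
  modulus of a, and the contiguous relations cost only bounded factors and a factor y.\<close>

lemma poly_bdd_hyp_reg:
  fixes a b c :: "'i \<Rightarrow> complex"
  assumes "\<exists>M. \<forall>i\<in>U. norm (a i) \<le> M" "\<exists>M. \<forall>i\<in>U. norm (b i) \<le> M" "\<exists>M. \<forall>i\<in>U. norm (c i) \<le> M"
  shows "poly_bdd U (\<lambda>i y. hyp_reg (a i) (b i) (c i) (- of_real y))"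
proof -
  obtain R1 R2 where R: "\<And>i. i \<in> U \<Longrightarrow> norm (b i) \<le> R1" "\<And>i. i \<in> U \<Longrightarrow> norm (c i) \<le> R2"
    using assms by blast
  obtain k j :: nat where kj: "\<And>i. i \<in> U \<Longrightarrow> Re (b i) > 1 - real k"
      "\<And>i. i \<in> U \<Longrightarrow> Re (c i - b i) > 1 + 2 * real k - real j"
    using exists_parameter_range[of U b "max R1 R2" c] R by (metis max.coboundedI1 max.coboundedI2)
  define A where "A = {f :: 'i \<Rightarrow> complex. \<exists>M. \<forall>i\<in>U. norm (f i) \<le> M}"
  define Q where "Q a b c \<longleftrightarrow> poly_bdd U (\<lambda>i y. hyp_reg (a i) (b i) (c i) (- of_real y))" for a b c
  have A_const: "(\<lambda>i. w) \<in> A" for w by (auto simp: A_def)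
  have A_add: "(\<lambda>i. f i + g i) \<in> A" if fg: "f \<in> A" "g \<in> A" for f g
  proof -
    obtain M N where "\<forall>i\<in>U. norm (f i) \<le> M" "\<forall>i\<in>U. norm (g i) \<le> N"
      using fg unfolding A_def by blast
    hence "\<forall>i\<in>U. norm (f i + g i) \<le> M + N" by (meson norm_triangle_mono)
    thus ?thesis by (auto simp: A_def)
  qed
  have A_mult: "(\<lambda>i. f i * g i) \<in> A" if fg: "f \<in> A" "g \<in> A" for f g
  proof -
    obtain M N where "\<forall>i\<in>U. norm (f i) \<le> M" "\<forall>i\<in>U. norm (g i) \<le> N"
      using fg unfolding A_def by blast
    hence "\<forall>i\<in>U. norm (f i * g i) \<le> M * N"
      unfolding norm_mult by (meson mult_mono norm_ge_zero order_trans)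
    thus ?thesis by (auto simp: A_def)
  qed
  have A_diff: "(\<lambda>i. f i - g i) \<in> A" if "f \<in> A" "g \<in> A" for f g
    using A_add[OF that(1) A_mult[OF A_const[of "-1"] that(2)]] by simp
  have A_pb: "poly_bdd U (\<lambda>i y. f i)" if "f \<in> A" for f
    using that unfolding A_def by (auto intro: poly_bdd_const)
  have A_rGamma: "(\<lambda>i. rGamma (f i)) \<in> A" if fA: "f \<in> A" for f
  proof -
    obtain R where R: "\<forall>i\<in>U. norm (f i) \<le> R" using fA by (auto simp: A_def)
    obtain M where "\<And>z. norm (z :: complex) \<le> R \<Longrightarrow> norm (rGamma z) \<le> M" using rGamma_bounded by blast
    thus ?thesis using R by (auto simp: A_def)
  qed
  have "Q a b c"
  proof (rule hyp_parameter_induct[where Q=Q and A=A and U=U and k=k and j=j])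
    fix a b c
    assume A: "a \<in> A" "b \<in> A" "c \<in> A"
      and re: "\<And>i. i \<in> U \<Longrightarrow> Re (b i) > 1 \<and> Re (c i - b i) > 1"
    obtain R where R: "\<forall>i\<in>U. norm (a i) \<le> R" using A by (auto simp: A_def)
    obtain N :: nat where N: "R \<le> real N" using real_arch_simple by blast
    have bd: "norm (\<integral>r. beta_kernel (b i) (c i - b i) r * (1 - of_real r * (- of_real y)) powr (- a i) \<partial>lborel)
        \<le> 1 * (1 + y) ^ N" if i: "i \<in> U" and y: "y \<ge> 0" for i y
    proof -
      have nb: "norm (beta_kernel (b i) (c i - b i) r * (1 - of_real r * (- of_real y)) powr (- a i))
          \<le> indicator {0<..<1} r * (1 + y) ^ N" for r
      proof (cases "r \<in> {0<..<1}")
        case True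
        have ry: "r * y \<ge> 0" "r * y \<le> y" using True y by (auto simp: mult_left_le_one_le)
        have "norm ((1 - of_real r * (- of_real y)) powr (- a i)) = norm (of_real (1 + r * y) powr (- a i))"
          by simp
        also have "\<dots> = (1 + r * y) powr Re (- a i)" using ry by (subst norm_powr_real_powr) auto
        also have "\<dots> \<le> (1 + r * y) powr real N"
          using R N i ry abs_Re_le_cmod[of "a i"] by (intro powr_mono) (auto dest!: bspec)
        also have "\<dots> \<le> (1 + y) powr real N" using ry by (intro powr_mono2) auto
        also have "\<dots> = (1 + y) ^ N" using y by (simp add: powr_realpow)
        finally have 1: "norm ((1 - of_real r * (- of_real y)) powr (- a i)) \<le> (1 + y) ^ N" .
        show ?thesis unfolding norm_mult
          using re[OF i] y by (intro mult_mono 1 norm_beta_kernel_le_indicator) auto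
      qed (simp add: beta_kernel_def)
      have "norm (\<integral>r. beta_kernel (b i) (c i - b i) r * (1 - of_real r * (- of_real y)) powr (- a i) \<partial>lborel)
          \<le> (\<integral>r. indicator {0<..<1::real} r * (1 + y) ^ N \<partial>lborel)"
      proof (rule order_trans[OF integral_norm_bound], rule Bochner_Integration.integral_mono)
        show g: "integrable lborel (\<lambda>r. indicator {0<..<1::real} r * (1 + y) ^ N)" by simp
        have "(\<lambda>r. beta_kernel (b i) (c i - b i) r * (1 - of_real r * (- of_real y)) powr (- a i)) \<in> borel_measurable lborel"
          by measurable
        thus "integrable lborel (\<lambda>r. norm (beta_kernel (b i) (c i - b i) r * (1 - of_real r * (- of_real y)) powr (- a i)))"
          using nb y by (intro integrable_norm Bochner_Integration.integrable_bound[OF g]) auto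
      qed (rule nb)
      thus ?thesis by simp
    qed
    have "poly_bdd U (\<lambda>i y. \<integral>r. beta_kernel (b i) (c i - b i) r * (1 - of_real r * (- of_real y)) powr (- a i) \<partial>lborel)"
      unfolding poly_bdd_def using bd by blast
    hence "poly_bdd U (\<lambda>i y. euler_integral (a i) (b i) (c i) (- of_real y))"
      unfolding euler_integral_def by (intro poly_bdd_mult A_pb A_rGamma A_mult A_diff A)
    thus "Q a b c" unfolding Q_def
    proof (rule poly_bdd_mono)
      fix i y assume "i \<in> U" "y \<ge> (0::real)"
      thus "norm (hyp_reg (a i) (b i) (c i) (- of_real y)) \<le> norm (euler_integral (a i) (b i) (c i) (- of_real y))"
        using hyp_reg_eq_euler_integral[OF _ _ neg_in_slit_plane, of "b i" "c i" y "a i"] re[of i] by auto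
    qed
  next
    fix a b c
    assume A: "a \<in> A" "b \<in> A" "c \<in> A"
      and re: "\<And>i. i \<in> U \<Longrightarrow> Re (c i - b i) > 2"
      and Q: "Q a (\<lambda>i. b i + 1) c" "Q a (\<lambda>i. b i + 2) c"
    \<comment> \<open>The margin Re (c - b) > 2 kept by the induction bounds the divisor c - b - 1
      away from 0 for all i at once.\<close>
    have nz: "norm (c i - b i - 1) \<ge> 1" if "i \<in> U" for i
      using re[OF that] complex_Re_le_cmod[of "c i - b i - 1"] by simp
    \<comment> \<open>The coefficients are written as \<open>b i + b i\<close> and
      \<open>0 - (b i + 1)\<close> so that the closure rules for sums, differences and products
      apply syntactically.\<close>
    have "poly_bdd U (\<lambda>i y. (c i - (b i + b i) - 2) * hyp_reg (a i) (b i + 1) (c i) (- of_real y)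
       + (b i - a i + 1) * ((- of_real y) * hyp_reg (a i) (b i + 1) (c i) (- of_real y))
       + (b i + 1) * hyp_reg (a i) (b i + 2) (c i) (- of_real y)
       + (0 - (b i + 1)) * ((- of_real y) * hyp_reg (a i) (b i + 2) (c i) (- of_real y)))" (is "poly_bdd U ?f")
      using Q unfolding Q_def
      by (intro poly_bdd_add poly_bdd_mult A_pb A_add A_diff A_const A poly_bdd_arg)
    thus "Q a b c" unfolding Q_def
    proof (rule poly_bdd_mono)
      fix i y assume i: "i \<in> U" and y: "y \<ge> (0::real)"
      have "(c i - b i - 1) * hyp_reg (a i) (b i) (c i) (- of_real y) = ?f i y"
        unfolding hyp_reg_lower_b[OF neg_in_slit_plane[OF y]] by (simp add: algebra_simps)
      hence "norm (?f i y) = norm (c i - b i - 1) * norm (hyp_reg (a i) (b i) (c i) (- of_real y))"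
        by (metis norm_mult)
      moreover have "1 * norm (hyp_reg (a i) (b i) (c i) (- of_real y)) \<le>
          norm (c i - b i - 1) * norm (hyp_reg (a i) (b i) (c i) (- of_real y))"
        using nz[OF i] by (intro mult_right_mono) auto
      ultimately show "norm (hyp_reg (a i) (b i) (c i) (- of_real y)) \<le> norm (?f i y)" by linarith
    qed
  next
    fix a b c
    assume A: "a \<in> A" "b \<in> A" "c \<in> A"
      and Q: "Q a b (\<lambda>i. c i + 1)" "Q (\<lambda>i. a i + 1) (\<lambda>i. b i + 1) (\<lambda>i. c i + 2)"
    have "poly_bdd U (\<lambda>i y. c i * hyp_reg (a i) (b i) (c i + 1) (- of_real y)
        + a i * b i * ((- of_real y) * hyp_reg (a i + 1) (b i + 1) (c i + 2) (- of_real y)))" (is "poly_bdd U ?f")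
      using Q unfolding Q_def by (intro poly_bdd_add poly_bdd_mult A_pb A_mult A poly_bdd_arg)
    thus "Q a b c" unfolding Q_def
      by (rule poly_bdd_mono) (simp only: hyp_reg_lower_c[OF neg_in_slit_plane, symmetric] order.refl)
  qed (use kj assms A_add[OF _ A_const] in \<open>auto simp: A_def\<close>)
  thus ?thesis by (simp add: Q_def)
qed

section \<open>Integrals over real parameters\<close>

text \<open>Both sides are limits over an increasing sequence of compact subintervals, on which the
  substitution rule holds. Monotone convergence then needs no finiteness of either integral.\<close>

lemma nn_integral_substitution_einterval:
  fixes f :: "real \<Rightarrow> ennreal" and g g' :: "real \<Rightarrow> real" and a b :: ereal
  assumes f[measurable]: "f \<in> borel_measurable borel" and "a < b"
    and deriv: "\<And>x. x \<in> einterval a b \<Longrightarrow> (g has_real_derivative g' x) (at x)"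
    and contg': "continuous_on (einterval a b) g'"
    and nonneg: "\<And>x. x \<in> einterval a b \<Longrightarrow> g' x \<ge> 0"
  shows "(\<integral>\<^sup>+x. f x * indicator (g ` einterval a b) x \<partial>lborel) =
         (\<integral>\<^sup>+x. f (g x) * ennreal (g' x) * indicator (einterval a b) x \<partial>lborel)"
proof -
  let ?I = "einterval a b"
  obtain u l where ul: "?I = (\<Union>i. {l i .. u i})" "incseq u" "decseq l" "\<And>i::nat. l i < u i"
    by (rule einterval_Icc_approximation[OF \<open>a < b\<close>]) blast
  have sub: "{l i .. u i} \<subseteq> ?I" for i using ul(1) by blast
  have contg: "continuous_on ?I g"
    using deriv by (meson DERIV_isCont continuous_at_imp_continuous_on)
  have img: "g ` {l i .. u i} = {g (l i) .. g (u i)}" for i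
  proof
    have mono: "g x \<le> g y" if "l i \<le> x" "x \<le> y" "y \<le> u i" for x y
      using that sub[of i] by (intro DERIV_nonneg_imp_nondecreasing[OF that(2)])
        (metis atLeastAtMost_iff deriv nonneg order_trans subsetD)
    show "g ` {l i .. u i} \<subseteq> {g (l i) .. g (u i)}" using mono ul(4)[of i] by auto
    show "{g (l i) .. g (u i)} \<subseteq> g ` {l i .. u i}"
    proof
      fix y assume y: "y \<in> {g (l i) .. g (u i)}"
      have "\<exists>x\<ge>l i. x \<le> u i \<and> g x = y"
        using y ul(4)[of i] continuous_on_subset[OF contg sub] by (intro IVT') auto
      thus "y \<in> g ` {l i .. u i}" by auto
    qed
  qed
  have J: "g ` ?I = (\<Union>i. {g (l i) .. g (u i)})" unfolding ul(1) image_UN img ..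
  have inc: "{l i .. u i} \<subseteq> {l j .. u j}" if "i \<le> j" for i j
    using that ul(2,3) by (auto simp: incseq_def decseq_def intro: order_trans)
  have incg: "{g (l i) .. g (u i)} \<subseteq> {g (l j) .. g (u j)}" if "i \<le> j" for i j
    using inc[OF that] unfolding img[symmetric] by (rule image_mono)
  have ind_SUP: "indicator (\<Union>i. A i) x = (SUP i. indicator (A i) x :: ennreal)"
    for A :: "nat \<Rightarrow> real set" and x
  proof (cases "x \<in> (\<Union>i. A i)")
    case True
    then obtain i where "x \<in> A i" by blast
    hence "(SUP i. indicator (A i) x :: ennreal) = 1"
      by (intro antisym SUP_least SUP_upper2[of i]) (auto simp: indicator_def)
    thus ?thesis using True by simp
  qed simp
  have indm: "c * indicator A x \<le> (c * indicator B x :: ennreal)" if "A \<subseteq> B" for A B :: "real set" and x c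
    using that by (auto simp: indicator_def)
  have mI: "(\<lambda>x. indicator ?I x *\<^sub>R g x) \<in> borel_measurable borel"
      "(\<lambda>x. indicator ?I x *\<^sub>R g' x) \<in> borel_measurable borel"
    by (intro borel_measurable_continuous_on_indicator contg contg'; simp)+
  have meas: "(\<lambda>x. f (g x) * ennreal (g' x) * indicator {l i .. u i} x) \<in> borel_measurable borel" for i
  proof -
    have "(\<lambda>x. f (indicator ?I x *\<^sub>R g x) * ennreal (indicator ?I x *\<^sub>R g' x) * indicator {l i .. u i} x) \<in> borel_measurable borel"
      using mI by measurable
    also have "(\<lambda>x. f (indicator ?I x *\<^sub>R g x) * ennreal (indicator ?I x *\<^sub>R g' x) * indicator {l i .. u i} x) =
        (\<lambda>x. f (g x) * ennreal (g' x) * indicator {l i .. u i} x)"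
      using sub[of i] by (auto simp: fun_eq_iff indicator_def)
    finally show ?thesis .
  qed
  have "(\<integral>\<^sup>+x. f x * indicator (g ` ?I) x \<partial>lborel) =
      (\<integral>\<^sup>+x. (SUP i. f x * indicator {g (l i) .. g (u i)} x) \<partial>lborel)"
    unfolding J ind_SUP by (simp add: SUP_mult_left_ennreal)
  also have "\<dots> = (SUP i. \<integral>\<^sup>+x. f x * indicator {g (l i) .. g (u i)} x \<partial>lborel)"
  proof (rule nn_integral_monotone_convergence_SUP)
    show "incseq (\<lambda>i x. f x * indicator {g (l i)..g (u i)} x)"
      using incg by (intro incseq_SucI le_funI indm) auto
  qed simp
  also have "\<dots> = (SUP i. \<integral>\<^sup>+x. f (g x) * ennreal (g' x) * indicator {l i .. u i} x \<partial>lborel)"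
    using ul(4) subsetD[OF sub]
    by (intro SUP_cong refl nn_integral_substitution_aux continuous_on_subset[OF contg' sub] deriv nonneg f) auto
  also have "\<dots> = (\<integral>\<^sup>+x. (SUP i. f (g x) * ennreal (g' x) * indicator {l i .. u i} x) \<partial>lborel)"
  proof (rule nn_integral_monotone_convergence_SUP[symmetric])
    show "incseq (\<lambda>i x. f (g x) * ennreal (g' x) * indicator {l i..u i} x)"
      using inc by (intro incseq_SucI le_funI indm) auto
  qed (use meas in simp)
  also have "\<dots> = (\<integral>\<^sup>+x. f (g x) * ennreal (g' x) * indicator ?I x \<partial>lborel)"
    unfolding ul(1) ind_SUP by (simp add: SUP_mult_left_ennreal)
  finally show ?thesis .
qed

lemma einterval_greaterThan: "einterval (ereal a) \<infinity> = {a<..}"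
  by (auto simp: einterval_def)

lemma nn_integral_substitution_greaterThan:
  fixes f :: "real \<Rightarrow> ennreal" and g g' :: "real \<Rightarrow> real" and a :: real
  assumes "f \<in> borel_measurable borel"
    and "\<And>x. x > a \<Longrightarrow> (g has_real_derivative g' x) (at x)"
    and "continuous_on {a<..} g'" "\<And>x. x > a \<Longrightarrow> g' x \<ge> 0"
    and "g ` {a<..} = J"
  shows "(\<integral>\<^sup>+x. f x * indicator J x \<partial>lborel) =
         (\<integral>\<^sup>+x. f (g x) * ennreal (g' x) * indicator {a<..} x \<partial>lborel)"
  using nn_integral_substitution_einterval[of f "ereal a" \<infinity> g g'] assms
  by (simp add: einterval_greaterThan)

lemma nn_integral_inversion:
  fixes f :: "real \<Rightarrow> ennreal"
  assumes [measurable]: "f \<in> borel_measurable borel"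
  shows "(\<integral>\<^sup>+x. f x * indicator {0<..<1} x \<partial>lborel) =
         (\<integral>\<^sup>+x. f (1 / x) * ennreal (1 / x\<^sup>2) * indicator {1<..} x \<partial>lborel)"
proof -
  \<comment> \<open>Inversion is decreasing whereas the substitution rule asks for a nonnegative
    derivative, so the interval is reflected first.\<close>
  have "(\<integral>\<^sup>+x. f x * indicator {0<..<1} x \<partial>lborel) =
      (\<integral>\<^sup>+x. f (- x) * indicator {0<..<1} (- x) \<partial>lborel)"
    by (subst nn_integral_real_affine[where c="-1" and t=0]) auto
  also have "\<dots> = (\<integral>\<^sup>+x. f (- x) * indicator {-1<..<0} x \<partial>lborel)"
    by (intro nn_integral_cong) (auto simp: indicator_def)
  also have "\<dots> = (\<integral>\<^sup>+x. f (- (- (1 / x))) * ennreal (1 / x\<^sup>2) * indicator {1<..} x \<partial>lborel)"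
  proof (rule nn_integral_substitution_greaterThan[where f="\<lambda>x. f (- x)"])
    show "(\<lambda>x. - (1 / x :: real)) ` {1<..} = {-1<..<0}"
    proof safe
      fix x :: real assume "x \<in> {-1<..<0}"
      thus "x \<in> (\<lambda>x. - (1 / x)) ` {1<..}"
        by (intro image_eqI[of _ _ "- 1 / x"]) (auto simp: field_simps)
    qed (auto simp: field_simps)
  qed (auto intro!: derivative_eq_intros continuous_intros simp: power2_eq_square)
  finally show ?thesis by simp
qed

lemma nn_integral_scale:
  fixes f :: "real \<Rightarrow> ennreal"
  assumes [measurable]: "f \<in> borel_measurable borel" and "c > 0"
  shows "(\<integral>\<^sup>+x. f x * indicator {0<..} x \<partial>lborel) =
         ennreal c * (\<integral>\<^sup>+x. f (c * x) * indicator {0<..} x \<partial>lborel)"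
proof -
  have "indicator {0<..} (c * x) = (indicator {0<..} x :: ennreal)" for x
    using \<open>c > 0\<close> by (auto simp: indicator_def zero_less_mult_iff)
  thus ?thesis using \<open>c > 0\<close> by (subst nn_integral_real_affine[where c=c and t=0]) auto
qed

lemma nn_integral_beta_unit:
  assumes "p > 0" "q > (0::real)"
  shows "(\<integral>\<^sup>+r. ennreal (r powr (p - 1) * (1 - r) powr (q - 1)) * indicator {0<..<1} r \<partial>lborel) = ennreal (Beta p q)"
proof -
  have "((\<lambda>r. r powr (p - 1) * (1 - r) powr (q - 1)) has_integral Beta p q) {0<..<1}"
    using has_integral_Beta_real[OF assms] by (simp add: has_integral_Icc_iff_Ioo)
  hence "((\<lambda>r. if r \<in> {0<..<1} then r powr (p - 1) * (1 - r) powr (q - 1) else 0) has_integral Beta p q) UNIV"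
    by (simp only: has_integral_restrict_UNIV)
  hence "(\<integral>\<^sup>+r. (if r \<in> {0<..<1} then r powr (p - 1) * (1 - r) powr (q - 1) else 0) \<partial>lborel) = Beta p q"
    by (intro nn_integral_has_integral_lborel) auto
  also have "(\<integral>\<^sup>+r. (if r \<in> {0<..<1} then r powr (p - 1) * (1 - r) powr (q - 1) else 0) \<partial>lborel) =
      (\<integral>\<^sup>+r. ennreal (r powr (p - 1) * (1 - r) powr (q - 1)) * indicator {0<..<1} r \<partial>lborel)"
    by (intro nn_integral_cong) (auto simp: indicator_def)
  finally show ?thesis .
qed

lemma nn_integral_unit_to_halfline:
  fixes f :: "real \<Rightarrow> ennreal"
  assumes "f \<in> borel_measurable borel"
  shows "(\<integral>\<^sup>+x. f x * indicator {0<..<1} x \<partial>lborel) =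
         (\<integral>\<^sup>+v. f (v / (1 + v)) * ennreal ((1 + v) powr (- 2)) * indicator {0<..} v \<partial>lborel)"
proof (rule nn_integral_substitution_greaterThan[OF assms])
  show "(\<lambda>v::real. v / (1 + v)) ` {0<..} = {0<..<1}"
  proof safe
    fix x :: real assume "x \<in> {0<..<1}"
    thus "x \<in> (\<lambda>v. v / (1 + v)) ` {0<..}"
      by (intro image_eqI[of _ _ "x / (1 - x)"]) (auto simp: field_simps)
  qed (auto simp: field_simps)
  show "continuous_on {0<..} (\<lambda>v::real. (1 + v) powr - 2)"
    by (intro continuous_intros) auto
  show "((\<lambda>v. v / (1 + v)) has_real_derivative (1 + x) powr - 2) (at x)" if "0 < x" for x :: real
    using that by (auto intro!: derivative_eq_intros simp: powr_minus powr_numeral field_simps power2_eq_square)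
qed auto

lemma powr_divide_pos: "x > 0 \<Longrightarrow> y > 0 \<Longrightarrow> (x / y :: real) powr e = x powr e * y powr (- e)"
  by (simp add: powr_divide powr_minus field_simps)

lemma nn_integral_beta_halfline:
  assumes "p > 0" "q > (0::real)"
  shows "(\<integral>\<^sup>+v. ennreal (v powr (p - 1) * (1 + v) powr (- (p + q))) * indicator {0<..} v \<partial>lborel) = ennreal (Beta p q)"
proof -
  have "ennreal (Beta p q) = (\<integral>\<^sup>+v. ennreal ((v / (1 + v)) powr (p - 1) * (1 - v / (1 + v)) powr (q - 1)) *
      ennreal ((1 + v) powr (- 2)) * indicator {0<..} v \<partial>lborel)"
    unfolding nn_integral_beta_unit[OF assms, symmetric] by (rule nn_integral_unit_to_halfline) measurable
  also have "\<dots> = (\<integral>\<^sup>+v. ennreal (v powr (p - 1) * (1 + v) powr (- (p + q))) * indicator {0<..} v \<partial>lborel)"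
  proof (intro nn_integral_cong, goal_cases)
    case (1 v)
    show ?case
    proof (cases "v > 0")
      case True
      have "1 - v / (1 + v) = 1 / (1 + v)" using True by (simp add: field_simps)
      hence "(v / (1 + v)) powr (p - 1) * (1 - v / (1 + v)) powr (q - 1) * (1 + v) powr (- 2) =
          v powr (p - 1) * ((1 + v) powr (- (p - 1)) * (1 + v) powr (- (q - 1)) * (1 + v) powr (- 2))"
        using True by (simp add: powr_divide_pos del: minus_diff_eq)
      also have "(1 + v) powr (- (p - 1)) * (1 + v) powr (- (q - 1)) * (1 + v) powr (- 2) = (1 + v) powr (- (p + q))"
        unfolding powr_add[symmetric] by (simp add: algebra_simps)
      finally show ?thesis using True by (simp add: ennreal_mult'[symmetric])
    qed simp
  qed
  finally show ?thesis ..
qed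

lemma Beta_real_pos: "p > 0 \<Longrightarrow> q > 0 \<Longrightarrow> Beta p q > (0::real)"
  by (simp add: Beta_def Gamma_real_pos)

text \<open>With C = A + B t the substitution u = t + (C / B) v gives A + B u = C (1 + v). The
  integrals over x, over u = w^2 - 1 and over the Euler variable t of the Jacobi function are all of
  this type.\<close>

lemma nn_integral_beta_linear:
  fixes A B t p q :: real
  assumes "p > 0" "q > 0" "B > 0" "A + B * t > 0"
  shows "(\<integral>\<^sup>+u. ennreal ((u - t) powr (p - 1) * (A + B * u) powr (- (p + q))) * indicator {t<..} u \<partial>lborel) =
     ennreal (B powr (- p) * (A + B * t) powr (- q) * Beta p q)"
proof -
  define C where "C = A + B * t"
  have C: "C > 0" using assms by (simp add: C_def)
  have "(\<integral>\<^sup>+u. ennreal ((u - t) powr (p - 1) * (A + B * u) powr (- (p + q))) * indicator {t<..} u \<partial>lborel) =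
      ennreal (C / B) * (\<integral>\<^sup>+v. ennreal ((C / B * v) powr (p - 1) * (C + C * v) powr (- (p + q))) * indicator {t<..} (t + C / B * v) \<partial>lborel)"
  proof -
    have "t + C / B * v - t = C / B * v" "A + B * (t + C / B * v) = C + C * v" for v
      using assms by (simp_all add: C_def field_simps)
    thus ?thesis using C assms by (subst nn_integral_real_affine[where c="C / B" and t=t]) auto
  qed
  also have "(\<integral>\<^sup>+v. ennreal ((C / B * v) powr (p - 1) * (C + C * v) powr (- (p + q))) * indicator {t<..} (t + C / B * v) \<partial>lborel) =
      (\<integral>\<^sup>+v. ennreal ((C / B) powr (p - 1) * C powr (- (p + q))) *
         (ennreal (v powr (p - 1) * (1 + v) powr (- (p + q))) * indicator {0<..} v) \<partial>lborel)"
  proof (intro nn_integral_cong, goal_cases)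
    case (1 v)
    show ?case
    proof (cases "v > 0")
      case True
      have "(C / B * v) powr (p - 1) = (C / B) powr (p - 1) * v powr (p - 1)"
        using True C assms by (intro powr_mult)
      moreover have "(C + C * v) powr (- (p + q)) = C powr (- (p + q)) * (1 + v) powr (- (p + q))"
        using powr_mult[of C "1 + v" "- (p + q)"] C True by (simp add: algebra_simps)
      ultimately show ?thesis using True C assms by (simp add: ennreal_mult'[symmetric] mult_ac)
    next
      case False
      hence "t + C / B * v \<le> t" using mult_nonneg_nonpos[of "C / B" v] C assms by simp
      thus ?thesis using False by (auto simp: indicator_def)
    qed
  qed
  also have "\<dots> = ennreal ((C / B) powr (p - 1) * C powr (- (p + q))) * ennreal (Beta p q)"
    by (subst nn_integral_cmult) (auto simp only: nn_integral_beta_halfline[OF assms(1,2)], measurable)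
  also have "ennreal (C / B) * \<dots> = ennreal (C / B * ((C / B) powr (p - 1) * C powr (- (p + q))) * Beta p q)"
    using C assms Beta_real_pos[OF assms(1,2)] by (simp add: ennreal_mult'[symmetric] mult_ac)
  also have "C / B * ((C / B) powr (p - 1) * C powr (- (p + q))) = B powr (- p) * C powr (- q)"
  proof -
    have "C / B * (C / B) powr (p - 1) = (C / B) powr p"
      using powr_add[of "C / B" 1 "p - 1"] C assms by simp
    also have "\<dots> = C powr p * B powr (- p)" using C assms by (simp add: powr_divide_pos)
    finally have e: "C / B * (C / B) powr (p - 1) = C powr p * B powr (- p)" .
    have "C / B * ((C / B) powr (p - 1) * C powr (- (p + q))) = (C / B * (C / B) powr (p - 1)) * C powr (- (p + q))"
      by (simp only: mult.assoc)
    also have "\<dots> = B powr (- p) * (C powr p * C powr (- (p + q)))"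
      unfolding e by (simp only: mult_ac)
    also have "C powr p * C powr (- (p + q)) = C powr (- q)" by (simp add: powr_add[symmetric])
    finally show ?thesis .
  qed
  finally show ?thesis by (simp add: C_def)
qed

section \<open>Real hypergeometric functions as integrals with positive kernels\<close>

lemma integrable_beta_average:
  assumes f: "f holomorphic_on slit_plane" and "z \<in> slit_plane" "Re p > 0" "Re q > 0"
  shows "integrable lborel (\<lambda>r. beta_kernel p q r * f (of_real r * z))"
proof -
  obtain e B where e: "e > 0" "ball z e \<subseteq> slit_plane"
    and B: "\<And>w r. w \<in> ball z e \<Longrightarrow> 0 \<le> r \<Longrightarrow> r \<le> 1 \<Longrightarrow> norm (f (of_real r * w)) \<le> B"
    using bounded_scaled_nbhd[OF f assms(2)] by metis
  have "norm (beta_kernel p q r * f (of_real r * z)) \<le> norm (norm (beta_kernel p q r) * B)" for r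
  proof (cases "r \<in> {0<..<1}")
    case True
    hence "norm (f (of_real r * z)) \<le> \<bar>B\<bar>" using B[of z r] e by (auto intro: order_trans)
    thus ?thesis by (simp add: norm_mult abs_mult mult_left_mono)
  qed (simp add: beta_kernel_def)
  hence "AE r in lborel. norm (beta_kernel p q r * f (of_real r * z)) \<le> norm (norm (beta_kernel p q r) * B)"
    by (intro AE_I2)
  moreover have "integrable lborel (\<lambda>r. norm (beta_kernel p q r) * B)"
    using integrable_norm_beta_kernel[OF assms(3,4)] by (rule integrable_mult_left)
  moreover have "(\<lambda>r. beta_kernel p q r * f (of_real r * z)) \<in> borel_measurable lborel"
    using measurable_beta_average[OF assms(1,2)] by simp
  ultimately show ?thesis using Bochner_Integration.integrable_bound by blast
qed

text \<open>The same H is the value of the complex Bochner integral and of the nonnegative one,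
  which is the passage from identities for \<open>hyp_reg\<close> to integrals that Tonelli's
  theorem can handle.\<close>

lemma beta_average_of_real:
  fixes p q x :: real
  assumes f: "f holomorphic_on slit_plane" and x: "of_real x \<in> slit_plane" and pq: "p > 0" "q > 0"
    and h: "\<And>r. 0 < r \<Longrightarrow> r < 1 \<Longrightarrow> f (of_real (r * x)) = of_real (h r)" "\<And>r. 0 < r \<Longrightarrow> r < 1 \<Longrightarrow> h r \<ge> 0"
  obtains H where "H \<ge> 0"
    "(\<integral>r. beta_kernel (of_real p) (of_real q) r * f (of_real r * of_real x) \<partial>lborel) = of_real H"
    "(\<integral>\<^sup>+r. ennreal (r powr (p - 1) * (1 - r) powr (q - 1) * h r) * indicator {0<..<1} r \<partial>lborel) = ennreal H"
proof -
  define k where "k r = indicator {0<..<1} r * (r powr (p - 1) * (1 - r) powr (q - 1) * h r)" for r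
  have eq: "beta_kernel (of_real p) (of_real q) r * f (of_real r * of_real x) = complex_of_real (k r)" for r
  proof (cases "r \<in> {0<..<1}")
    case True
    have 1: "complex_of_real r powr (of_real p - 1) = of_real (r powr (p - 1))"
      using True by (simp add: powr_of_real[symmetric])
    have 2: "complex_of_real (1 - r) powr (of_real q - 1) = of_real ((1 - r) powr (q - 1))"
      using True powr_of_real[of "1 - r" "q - 1"] by simp
    show ?thesis using True h(1)[of r] unfolding beta_kernel_def k_def 1 2 by simp
  qed (simp add: beta_kernel_def k_def)
  have int: "integrable lborel (\<lambda>r. complex_of_real (k r))"
    using integrable_beta_average[OF f x, of "of_real p" "of_real q"] pq unfolding eq by simp
  hence int': "integrable lborel k" by (simp only: complex_of_real_integrable_eq)
  have nn: "k r \<ge> 0" for r using h(2)[of r] by (auto simp: k_def indicator_def)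
  show ?thesis
  proof
    show "(\<integral>r. k r \<partial>lborel) \<ge> 0" using nn by (intro Bochner_Integration.integral_nonneg) auto
    show "(\<integral>r. beta_kernel (of_real p) (of_real q) r * f (of_real r * of_real x) \<partial>lborel) = of_real (\<integral>r. k r \<partial>lborel)"
      unfolding eq by simp
    have "(\<integral>\<^sup>+r. ennreal (r powr (p - 1) * (1 - r) powr (q - 1) * h r) * indicator {0<..<1} r \<partial>lborel) =
        (\<integral>\<^sup>+r. ennreal (k r) \<partial>lborel)"
      by (intro nn_integral_cong) (auto simp: k_def indicator_def)
    also have "\<dots> = ennreal (\<integral>r. k r \<partial>lborel)"
      using int' nn by (intro nn_integral_eq_integral) auto
    finally show "(\<integral>\<^sup>+r. ennreal (r powr (p - 1) * (1 - r) powr (q - 1) * h r) * indicator {0<..<1} r \<partial>lborel) =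
        ennreal (\<integral>r. k r \<partial>lborel)" .
  qed
qed

lemma of_real_in_slit_plane: "x < 1 \<Longrightarrow> complex_of_real x \<in> slit_plane"
  by (simp add: mem_slit_plane_iff)

lemma hyp_reg_real_euler:
  fixes a b c x :: real
  assumes "0 < b" "b < c" "x < 1"
  obtains H where "H \<ge> 0" "hyp_reg (of_real a) (of_real b) (of_real c) (of_real x) = of_real (H / (Gamma b * Gamma (c - b)))"
    "(\<integral>\<^sup>+r. ennreal (r powr (b - 1) * (1 - r) powr (c - b - 1) * (1 - r * x) powr (- a)) * indicator {0<..<1} r \<partial>lborel) = ennreal H"
proof -
  have *: "(1 - complex_of_real (r * x)) powr (- of_real a) = of_real ((1 - r * x) powr (- a))" if "0 < r" "r < 1" for r
  proof -
    have "1 - r * x > 0"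
    proof (cases "x > 0")
      case True
      hence "r * x < 1 * x" using that by (intro mult_strict_right_mono) auto
      thus ?thesis using assms by simp
    next
      case False
      thus ?thesis using that by (smt (verit) mult_nonneg_nonpos)
    qed
    thus ?thesis using powr_of_real[of "1 - r * x" "- a"] by simp
  qed
  obtain H where H: "H \<ge> 0"
    "(\<integral>r. beta_kernel (of_real b) (of_real (c - b)) r * (1 - of_real r * of_real x) powr (- of_real a) \<partial>lborel) = of_real H"
    "(\<integral>\<^sup>+r. ennreal (r powr (b - 1) * (1 - r) powr (c - b - 1) * (1 - r * x) powr (- a)) * indicator {0<..<1} r \<partial>lborel) = ennreal H"
    by (rule beta_average_of_real[where f="\<lambda>z. (1 - z) powr (- of_real a)" and x=x and p=b and q="c - b"
          and h="\<lambda>r. (1 - r * x) powr (- a)"])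
       (use assms * in \<open>auto intro!: holomorphic_one_minus_powr of_real_in_slit_plane\<close>)
  have "hyp_reg (of_real a) (of_real b) (of_real c) (of_real x) = euler_integral (of_real a) (of_real b) (of_real c) (of_real x)"
    using assms by (intro hyp_reg_eq_euler_integral of_real_in_slit_plane) auto
  also have "\<dots> = of_real (H / (Gamma b * Gamma (c - b)))"
    using H(2) by (simp add: euler_integral_def rGamma_inverse_Gamma Gamma_complex_of_real[symmetric] field_simps
        flip: of_real_diff)
  finally show ?thesis using H that by blast
qed

text \<open>Under r = \<tau> / (1 + \<tau>) the factor 1 - r (1 - X) becomes (1 + X \<tau>) / (1 +
  \<tau>). This is the shape of the single integral left at the end, which is recognised as the
  function in Q.\<close>

lemma hyp_reg_real_euler_halfline:
  fixes a b c X :: real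
  assumes "0 < b" "b < c" "X > 0"
  obtains E where "E \<ge> 0" "hyp_reg (of_real a) (of_real b) (of_real c) (of_real (1 - X)) = of_real (E / (Gamma b * Gamma (c - b)))"
    "(\<integral>\<^sup>+\<tau>. ennreal (\<tau> powr (b - 1) * (1 + \<tau>) powr (a - c) * (1 + X * \<tau>) powr (- a)) * indicator {0<..} \<tau> \<partial>lborel) = ennreal E"
proof -
  obtain H where H: "H \<ge> 0" "hyp_reg (of_real a) (of_real b) (of_real c) (of_real (1 - X)) = of_real (H / (Gamma b * Gamma (c - b)))"
    "(\<integral>\<^sup>+r. ennreal (r powr (b - 1) * (1 - r) powr (c - b - 1) * (1 - r * (1 - X)) powr (- a)) * indicator {0<..<1} r \<partial>lborel) = ennreal H"
    using hyp_reg_real_euler[of b c "1 - X" a] assms by auto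
  have "ennreal H = (\<integral>\<^sup>+v. ennreal ((v / (1 + v)) powr (b - 1) * (1 - v / (1 + v)) powr (c - b - 1) * (1 - v / (1 + v) * (1 - X)) powr (- a)) *
      ennreal ((1 + v) powr (- 2)) * indicator {0<..} v \<partial>lborel)"
    unfolding H(3)[symmetric] by (rule nn_integral_unit_to_halfline) measurable
  also have "\<dots> = (\<integral>\<^sup>+\<tau>. ennreal (\<tau> powr (b - 1) * (1 + \<tau>) powr (a - c) * (1 + X * \<tau>) powr (- a)) * indicator {0<..} \<tau> \<partial>lborel)"
  proof (intro nn_integral_cong, goal_cases)
    case (1 v)
    show ?case
    proof (cases "v > 0")
      case True
      have Xv: "1 + X * v > 0" using True assms by (simp add: add_pos_pos)
      have e: "1 - v / (1 + v) = 1 / (1 + v)" "1 - v / (1 + v) * (1 - X) = (1 + X * v) / (1 + v)"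
        using True by (simp_all add: field_simps)
      have "(v / (1 + v)) powr (b - 1) * (1 - v / (1 + v)) powr (c - b - 1) * (1 - v / (1 + v) * (1 - X)) powr (- a) * (1 + v) powr (- 2) =
          v powr (b - 1) * ((1 + v) powr (- (b - 1)) * (1 + v) powr (- (c - b - 1)) * (1 + v) powr a * (1 + v) powr (- 2)) * (1 + X * v) powr (- a)"
        using True Xv unfolding e by (simp add: powr_divide_pos del: minus_diff_eq)
      also have "(1 + v) powr (- (b - 1)) * (1 + v) powr (- (c - b - 1)) * (1 + v) powr a * (1 + v) powr (- 2) = (1 + v) powr (a - c)"
        unfolding powr_add[symmetric] by (simp add: algebra_simps)
      finally show ?thesis using True by (simp add: ennreal_mult'[symmetric])
    qed simp
  qed
  finally show ?thesis using H that by metis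
qed

text \<open>Scaling Euler's variable by t = u r gives a Riemann-Liouville integral of order c - b.
  For the Jacobi function u = w^2 - 1 and c = \<delta>, so the weight u^(c - 1) is already present
  in the integrand.\<close>

lemma hyp_reg_real_fractional:
  fixes a b c u :: real
  assumes "0 < b" "b < c" "u > 0"
  obtains h where "h \<ge> 0" "hyp_reg (of_real a) (of_real b) (of_real c) (of_real (- u)) = of_real h"
    "ennreal (u powr (c - 1) * h) = ennreal (1 / (Gamma b * Gamma (c - b))) *
      (\<integral>\<^sup>+t. ennreal ((u - t) powr (c - b - 1) * (t powr (b - 1) * (1 + t) powr (- a))) * indicator {0<..<u} t \<partial>lborel)"
proof -
  obtain H where H: "H \<ge> 0" "hyp_reg (of_real a) (of_real b) (of_real c) (of_real (- u)) = of_real (H / (Gamma b * Gamma (c - b)))"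
    "(\<integral>\<^sup>+r. ennreal (r powr (b - 1) * (1 - r) powr (c - b - 1) * (1 - r * (- u)) powr (- a)) * indicator {0<..<1} r \<partial>lborel) = ennreal H"
    using hyp_reg_real_euler[of b c "- u" a] assms by auto
  have G: "Gamma b > 0" "Gamma (c - b) > 0" using assms by auto
  have "(\<integral>\<^sup>+t. ennreal ((u - t) powr (c - b - 1) * (t powr (b - 1) * (1 + t) powr (- a))) * indicator {0<..<u} t \<partial>lborel) =
     ennreal u * (\<integral>\<^sup>+r. ennreal ((u - u * r) powr (c - b - 1) * ((u * r) powr (b - 1) * (1 + u * r) powr (- a))) * indicator {0<..<u} (u * r) \<partial>lborel)"
    by (subst nn_integral_real_affine[where c=u and t=0]) (use assms in auto)
  also have "(\<integral>\<^sup>+r. ennreal ((u - u * r) powr (c - b - 1) * ((u * r) powr (b - 1) * (1 + u * r) powr (- a))) * indicator {0<..<u} (u * r) \<partial>lborel) =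
     (\<integral>\<^sup>+r. ennreal (u powr (c - 2)) * (ennreal (r powr (b - 1) * (1 - r) powr (c - b - 1) * (1 - r * (- u)) powr (- a)) * indicator {0<..<1} r) \<partial>lborel)"
  proof (intro nn_integral_cong, goal_cases)
    case (1 r)
    show ?case
    proof (cases "r \<in> {0<..<1}")
      case True
      have "(u - u * r) powr (c - b - 1) = u powr (c - b - 1) * (1 - r) powr (c - b - 1)"
        using powr_mult[of u "1 - r" "c - b - 1"] assms True by (simp add: algebra_simps)
      moreover have "(u * r) powr (b - 1) = u powr (b - 1) * r powr (b - 1)"
        using assms True by (intro powr_mult)
      moreover have "u powr (c - b - 1) * u powr (b - 1) = u powr (c - 2)"
        unfolding powr_add[symmetric] by simp
      ultimately have "(u - u * r) powr (c - b - 1) * ((u * r) powr (b - 1) * (1 + u * r) powr (- a)) =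
         u powr (c - 2) * (r powr (b - 1) * (1 - r) powr (c - b - 1) * (1 - r * (- u)) powr (- a))"
        by (simp add: mult_ac)
      thus ?thesis using True assms by (simp add: ennreal_mult'[symmetric])
    next
      case False
      hence "u * r \<notin> {0<..<u}" using assms by (auto simp: zero_less_mult_iff)
      thus ?thesis using False by simp
    qed
  qed
  also have "\<dots> = ennreal (u powr (c - 2)) * ennreal H"
    by (subst nn_integral_cmult) (auto simp: H(3)[symmetric])
  also have "ennreal u * \<dots> = ennreal (u powr (c - 1) * H)"
  proof -
    have "u * u powr (c - 2) = u powr (c - 1)"
      using powr_add[of u 1 "c - 2"] assms by simp
    thus ?thesis using assms H by (simp add: ennreal_mult'[symmetric] mult.assoc[symmetric])
  qed
  finally have "(\<integral>\<^sup>+t. ennreal ((u - t) powr (c - b - 1) * (t powr (b - 1) * (1 + t) powr (- a))) * indicator {0<..<u} t \<partial>lborel) =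
    ennreal (u powr (c - 1) * H)" .
  moreover have "ennreal (1 / (Gamma b * Gamma (c - b))) * ennreal (u powr (c - 1) * H) =
      ennreal (u powr (c - 1) * (H / (Gamma b * Gamma (c - b))))"
    using G H by (subst ennreal_mult'[symmetric]) auto
  ultimately show ?thesis using H G that[of "H / (Gamma b * Gamma (c - b))"] by simp
qed

section \<open>Gegenbauer functions\<close>

text \<open>With third parameter $1/2$ the hypergeometric equation becomes $G'' = \nu^2 G$ in the
  variable $\varphi$ with $z = -\sinh^2(\varphi/2)$.\<close>

lemma hyp_reg_cosh:
  fixes \<nu> \<phi> :: real
  assumes "\<nu> \<noteq> 0"
  shows "of_real (cosh (\<phi> / 2)) * of_real (sqrt pi) *
      hyp_reg (of_real (1/2 + \<nu>)) (of_real (1/2 - \<nu>)) (1/2) (of_real (- (sinh (\<phi> / 2))\<^sup>2)) =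
     complex_of_real (cosh (\<nu> * \<phi>))"
proof -
  define f where "f = hyp_reg (of_real (1/2 + \<nu>)) (of_real (1/2 - \<nu>)) (1/2)"
  define s where "s \<phi> = complex_of_real (- (sinh (\<phi> / 2))\<^sup>2)" for \<phi> :: real
  define Ch Sh where "Ch \<phi> = complex_of_real (cosh (\<phi> / 2))" and "Sh \<phi> = complex_of_real (sinh (\<phi> / 2))" for \<phi> :: real
  have s_eq: "s \<phi> = - (Sh \<phi>)\<^sup>2" for \<phi> by (simp add: s_def Sh_def)
  have ChSh: "(Ch \<phi>)\<^sup>2 = 1 + (Sh \<phi>)\<^sup>2" for \<phi>
  proof -
    have "(cosh (\<phi> / 2))\<^sup>2 = 1 + (sinh (\<phi> / 2))\<^sup>2" using cosh_square_eq[of "\<phi> / 2"] by simp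
    hence "complex_of_real ((cosh (\<phi> / 2))\<^sup>2) = of_real (1 + (sinh (\<phi> / 2))\<^sup>2)" by (rule arg_cong)
    thus ?thesis by (simp add: Ch_def Sh_def)
  qed
  have dCh: "(Ch has_vector_derivative Sh x / 2) (at x)" for x
  proof -
    have "((\<lambda>x. cosh (x / 2)) has_field_derivative sinh (x / 2) / 2) (at x)"
      by (auto intro!: derivative_eq_intros)
    hence "((\<lambda>x. complex_of_real (cosh (x / 2))) has_vector_derivative of_real (sinh (x / 2) / 2)) (at x)"
      by (rule has_vector_derivative_of_real)
    thus ?thesis by (simp add: Ch_def[abs_def] Sh_def)
  qed
  have dSh: "(Sh has_vector_derivative Ch x / 2) (at x)" for x
  proof -
    have "((\<lambda>x. sinh (x / 2)) has_field_derivative cosh (x / 2) / 2) (at x)"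
      by (auto intro!: derivative_eq_intros)
    hence "((\<lambda>x. complex_of_real (sinh (x / 2))) has_vector_derivative of_real (cosh (x / 2) / 2)) (at x)"
      by (rule has_vector_derivative_of_real)
    thus ?thesis by (simp add: Sh_def[abs_def] Ch_def)
  qed
  have ds: "(s has_vector_derivative - (Sh x * Ch x)) (at x)" for x
  proof -
    have "((\<lambda>x. - (Sh x * Sh x)) has_vector_derivative - (Sh x * (Ch x / 2) + Ch x / 2 * Sh x)) (at x)"
      by (intro derivative_intros dSh)
    thus ?thesis by (simp add: s_eq[abs_def] power2_eq_square algebra_simps)
  qed
  have sS: "s x \<in> slit_plane" for x
    unfolding s_def by (rule of_real_in_slit_plane) (smt (verit) zero_le_power2)
  have f_hol: "f holomorphic_on slit_plane" unfolding f_def by (rule holomorphic_hyp_reg)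
  have dfs: "((\<lambda>x. f (s x)) has_vector_derivative - (Sh x * Ch x) * deriv f (s x)) (at x)" for x
    using field_vector_diff_chain_at[OF ds holomorphic_derivI[OF f_hol open_slit_plane sS]]
    by (simp add: o_def)
  have df's: "((\<lambda>x. deriv f (s x)) has_vector_derivative - (Sh x * Ch x) * deriv (deriv f) (s x)) (at x)" for x
    using field_vector_diff_chain_at[OF ds
        holomorphic_derivI[OF holomorphic_deriv[OF f_hol open_slit_plane] open_slit_plane sS]]
    by (simp add: o_def)
  define n where "n = complex_of_real \<nu>"
  \<comment> \<open>The factor cosh (\<phi>/2) removes the first-order term from the equation in the
    variable \<phi>.\<close>
  define G where "G x = Ch x * f (s x)" for x
  define G1 where "G1 x = Sh x / 2 * f (s x) - (Sh x * (Ch x * Ch x)) * deriv f (s x)" for x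
  have dG: "(G has_vector_derivative G1 x) (at x)" for x
  proof -
    have "((\<lambda>x. Ch x * f (s x)) has_vector_derivative (Ch x * (- (Sh x * Ch x) * deriv f (s x)) + Sh x / 2 * f (s x))) (at x)"
      by (intro derivative_intros dCh dfs)
    thus ?thesis by (simp add: G_def[abs_def] G1_def algebra_simps)
  qed
  have dG1: "(G1 has_vector_derivative n\<^sup>2 * G x) (at x)" for x
  proof -
    have 1: "((\<lambda>x. Sh x / 2 * f (s x) - (Sh x * (Ch x * Ch x)) * deriv f (s x)) has_vector_derivative
       (Sh x / 2 * (- (Sh x * Ch x) * deriv f (s x)) + Ch x / 2 / 2 * f (s x)) -
       ((Sh x * (Ch x * Ch x)) * (- (Sh x * Ch x) * deriv (deriv f) (s x)) +
        (Sh x * (Ch x * (Sh x / 2) + Sh x / 2 * Ch x) + Ch x / 2 * (Ch x * Ch x)) * deriv f (s x))) (at x)"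
      by (intro derivative_intros dCh dSh dfs df's)
    have "s x * (1 - s x) * deriv (deriv f) (s x) +
        (1/2 - (of_real (1/2 + \<nu>) + of_real (1/2 - \<nu>) + 1) * s x) * deriv f (s x)
        - of_real (1/2 + \<nu>) * of_real (1/2 - \<nu>) * f (s x) = 0"
      unfolding f_def by (rule hyp_reg_ode[OF sS])
    hence ode: "s x * (1 - s x) * deriv (deriv f) (s x) + (1/2 - 2 * s x) * deriv f (s x) - (1/2 + n) * (1/2 - n) * f (s x) = 0"
      by (simp add: n_def)
    have c: "Ch x * Ch x = 1 + Sh x * Sh x" using ChSh[of x] by (simp add: power2_eq_square)
    have "(Sh x / 2 * (- (Sh x * Ch x) * deriv f (s x)) + Ch x / 2 / 2 * f (s x)) -
       ((Sh x * (Ch x * Ch x)) * (- (Sh x * Ch x) * deriv (deriv f) (s x)) +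
        (Sh x * (Ch x * (Sh x / 2) + Sh x / 2 * Ch x) + Ch x / 2 * (Ch x * Ch x)) * deriv f (s x)) = n\<^sup>2 * G x"
      using ode c unfolding s_eq G_def power2_eq_square
      by (simp add: field_simps) algebra
    thus ?thesis using 1 by (simp add: G1_def[abs_def])
  qed
  have f0: "f 0 = rGamma (1/2)"
  proof -
    have "f has_fps_expansion hyp_fps (of_real (1/2 + \<nu>)) (of_real (1/2 - \<nu>)) (1/2)"
      unfolding f_def by (rule has_fps_expansion_hyp_reg)
    hence "f 0 = fps_nth (hyp_fps (of_real (1/2 + \<nu>)) (of_real (1/2 - \<nu>)) (1/2)) 0"
      by (rule has_fps_expansion_imp_0_eq_fps_nth_0)
    thus ?thesis by simp
  qed
  have G0: "G 0 = rGamma (1/2)" "G1 0 = 0"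
    using f0 by (simp_all add: G_def G1_def Ch_def Sh_def s_def)
  \<comment> \<open>A first integral of G'' = n^2 G for each root e of e^2 = n^2. Taking e = n and e
    = - n and eliminating \<open>G1\<close> gives G.\<close>
  have E: "(G1 x - e * G x) * exp (e * of_real x) = - e * rGamma (1/2)" if e: "e\<^sup>2 = n\<^sup>2" for e x
  proof -
    have dexp: "((\<lambda>x. exp (e * of_real x)) has_vector_derivative e * exp (e * of_real y)) (at y)" for y
    proof -
      have "((\<lambda>x. e * complex_of_real x) has_vector_derivative e * 1) (at y)"
        by (intro derivative_intros has_vector_derivative_of_real[where D=1, simplified])
      from field_vector_diff_chain_at[OF this DERIV_exp] show ?thesis by (simp add: o_def)
    qed
    have "((\<lambda>x. (G1 x - e * G x) * exp (e * of_real x)) has_vector_derivative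
        (G1 y - e * G y) * (e * exp (e * of_real y)) + (n\<^sup>2 * G y - e * G1 y) * exp (e * of_real y)) (at y)" for y
      by (intro derivative_intros dG dG1 dexp)
    moreover have "(G1 y - e * G y) * (e * exp (e * of_real y)) + (n\<^sup>2 * G y - e * G1 y) * exp (e * of_real y) = 0" for y
      using e by algebra
    ultimately have "((\<lambda>x. (G1 x - e * G x) * exp (e * of_real x)) has_vector_derivative 0) (at y within UNIV)" for y
      by simp
    then obtain c where c: "\<And>x. (G1 x - e * G x) * exp (e * of_real x) = c"
      using has_vector_derivative_zero_constant[of UNIV "\<lambda>x. (G1 x - e * G x) * exp (e * of_real x)"] by auto
    have "c = - e * rGamma (1/2)" using c[of 0] G0 by simp
    thus ?thesis using c by simp
  qed
  have nz: "n \<noteq> 0" using assms by (simp add: n_def)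
  have "2 * n * G \<phi> = n * rGamma (1/2) * (exp (n * of_real \<phi>) + exp (- (n * of_real \<phi>)))"
  proof -
    have a: "exp (n * of_real \<phi>) * exp (- (n * of_real \<phi>)) = 1" by (simp add: exp_minus)
    have "(G1 \<phi> - n * G \<phi>) * exp (n * of_real \<phi>) = - n * rGamma (1/2)" by (rule E) simp
    moreover have "(G1 \<phi> + n * G \<phi>) * exp (- (n * of_real \<phi>)) = n * rGamma (1/2)"
      using E[of "- n" \<phi>] by simp
    ultimately show ?thesis using a by algebra
  qed
  hence "n * (2 * G \<phi>) = n * (rGamma (1/2) * (exp (n * of_real \<phi>) + exp (- (n * of_real \<phi>))))"
    by (simp only: mult_ac)
  hence "2 * G \<phi> = rGamma (1/2) * (exp (n * of_real \<phi>) + exp (- (n * of_real \<phi>)))"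
    using nz by (metis mult_left_cancel)
  hence "G \<phi> = rGamma (1/2) * ((exp (n * of_real \<phi>) + exp (- (n * of_real \<phi>))) / 2)"
    by (simp add: mult.commute[of 2])
  also have "(exp (n * of_real \<phi>) + exp (- (n * of_real \<phi>))) / 2 = complex_of_real (cosh (\<nu> * \<phi>))"
    unfolding n_def cosh_field_def by (simp add: exp_of_real[symmetric])
  finally have Gc: "G \<phi> = rGamma (1/2) * complex_of_real (cosh (\<nu> * \<phi>))" .
  have "of_real (sqrt pi) * rGamma (1/2) = (1 :: complex)"
    by (simp add: rGamma_inverse_Gamma Gamma_one_half_complex)
  hence "of_real (sqrt pi) * G \<phi> = complex_of_real (cosh (\<nu> * \<phi>))" unfolding Gc by (simp add: mult.assoc[symmetric])
  thus ?thesis by (simp add: G_def f_def s_def Ch_def mult_ac)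
qed

text \<open>In \<rho> = exp \<phi> the hyperbolic cosine becomes a sum of two powers, which Beta
  integrals can absorb.\<close>

lemma hyp_reg_cosh_rho:
  fixes \<nu> \<rho> :: real
  assumes "\<nu> \<noteq> 0" "\<rho> > 0"
  shows "hyp_reg (of_real (1/2 + \<nu>)) (of_real (1/2 - \<nu>)) (1/2) (of_real (- (((\<rho> + 1/\<rho>) / 2 - 1) / 2))) =
     complex_of_real ((\<rho> powr \<nu> + \<rho> powr (- \<nu>)) / 2 / (sqrt pi * sqrt (((\<rho> + 1/\<rho>) / 2 + 1) / 2)))"
proof -
  define \<phi> where "\<phi> = ln \<rho>"
  have "cosh (2 * (\<phi> / 2)) = (\<rho> + 1/\<rho>) / 2" using assms by (simp add: \<phi>_def cosh_ln_real inverse_eq_divide)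
  hence Y: "(\<rho> + 1/\<rho>) / 2 = 2 * (cosh (\<phi> / 2))\<^sup>2 - 1" by (simp only: cosh_double_cosh)
  have s: "(sinh (\<phi> / 2))\<^sup>2 = ((\<rho> + 1/\<rho>) / 2 - 1) / 2" unfolding sinh_square_eq Y by simp
  have c: "cosh (\<phi> / 2) = sqrt (((\<rho> + 1/\<rho>) / 2 + 1) / 2)" unfolding Y by simp
  have p: "cosh (\<nu> * \<phi>) = (\<rho> powr \<nu> + \<rho> powr (- \<nu>)) / 2"
    using assms by (simp add: cosh_field_def powr_def \<phi>_def)
  have nz: "sqrt (((\<rho> + 1/\<rho>) / 2 + 1) / 2) \<noteq> 0" unfolding c[symmetric] by simp
  have "complex_of_real (sqrt (((\<rho> + 1/\<rho>) / 2 + 1) / 2)) * of_real (sqrt pi) *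
     hyp_reg (of_real (1/2 + \<nu>)) (of_real (1/2 - \<nu>)) (1/2) (of_real (- (((\<rho> + 1/\<rho>) / 2 - 1) / 2))) =
     of_real ((\<rho> powr \<nu> + \<rho> powr (- \<nu>)) / 2)"
    using hyp_reg_cosh[OF assms(1), of \<phi>] unfolding s p c .
  moreover have "complex_of_real (sqrt (((\<rho> + 1/\<rho>) / 2 + 1) / 2)) \<noteq> 0" "complex_of_real (sqrt pi) \<noteq> 0"
    using nz by simp_all
  moreover have "h = c / (B * A)" if "A * B * h = c" "A \<noteq> 0" "B \<noteq> 0" for A B c h :: complex
    using that by (simp add: field_simps)
  ultimately have "hyp_reg (of_real (1/2 + \<nu>)) (of_real (1/2 - \<nu>)) (1/2) (of_real (- (((\<rho> + 1/\<rho>) / 2 - 1) / 2))) =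
     of_real ((\<rho> powr \<nu> + \<rho> powr (- \<nu>)) / 2) / (of_real (sqrt pi) * of_real (sqrt (((\<rho> + 1/\<rho>) / 2 + 1) / 2)))"
    by blast
  thus ?thesis by (simp only: of_real_divide of_real_mult)
qed

lemma joukowski_gt_1:
  fixes \<rho> :: real
  assumes "\<rho> > 1"
  shows "(\<rho> + 1/\<rho>) / 2 > 1"
proof -
  have "(\<rho> - 1)\<^sup>2 / \<rho> > 0" using assms by simp
  also have "(\<rho> - 1)\<^sup>2 / \<rho> = 2 * ((\<rho> + 1/\<rho>) / 2 - 1)" using assms
    by (simp add: field_simps power2_eq_square)
  finally show ?thesis by simp
qed

lemma joukowski_image: "(\<lambda>\<rho>::real. ((\<rho> + 1/\<rho>) / 2 - 1) / (2 * y)) ` {1<..} = {0<..}" if "y > 0" for y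
proof (intro equalityI subsetI)
  fix t assume "t \<in> (\<lambda>\<rho>::real. ((\<rho> + 1/\<rho>) / 2 - 1) / (2 * y)) ` {1<..}"
  then obtain \<rho> :: real where "\<rho> \<in> {1<..}" and t: "t = ((\<rho> + 1/\<rho>) / 2 - 1) / (2 * y)" by blast
  hence "(\<rho> + 1/\<rho>) / 2 > 1" using joukowski_gt_1 by simp
  thus "t \<in> {0<..}" using that t by simp
next
  fix t :: real assume "t \<in> {0<..}"
  hence "t > 0" by simp
  define Y where "Y = 1 + 2 * y * t"
  have Y: "Y > 1" using \<open>t > 0\<close> that by (simp add: Y_def)
  \<comment> \<open>The larger root of \<rho>^2 - 2 Y \<rho> + 1 = 0; the other root is its
    reciprocal.\<close>
  define \<rho> where "\<rho> = Y + sqrt (Y\<^sup>2 - 1)"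
  have Y2: "Y\<^sup>2 - 1 > 0" using Y by (simp add: power2_eq_square less_1_mult)
  have r1: "\<rho> > 1" unfolding \<rho>_def using Y real_sqrt_gt_zero[OF Y2] by linarith
  have "\<rho> * (Y - sqrt (Y\<^sup>2 - 1)) = 1" using Y2 by (simp add: \<rho>_def algebra_simps power2_eq_square[symmetric] real_sqrt_pow2)
  hence "1 / \<rho> = Y - sqrt (Y\<^sup>2 - 1)" using r1 by (simp add: field_simps)
  hence "(\<rho> + 1/\<rho>) / 2 = Y" by (simp add: \<rho>_def)
  hence "(\<rho> + 1/\<rho>) / 2 - 1 = t * (2 * y)" unfolding Y_def by (simp only:) simp
  hence "t = ((\<rho> + 1/\<rho>) / 2 - 1) / (2 * y)" using that by (simp only:) simp
  thus "t \<in> (\<lambda>\<rho>. ((\<rho> + 1/\<rho>) / 2 - 1) / (2 * y)) ` {1<..}" using r1 by auto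
qed

text \<open>The expression \<rho> + 1/\<rho> is invariant under inversion, which carries
  \<rho>^(\<nu> - 1) d\<rho> to \<rho>^(- \<nu> - 1) d\<rho>. Two powers on (1,\<infinity>) thus
  become one power on the half-line, where \<rho> can later be rescaled freely.\<close>

lemma nn_integral_joukowski:
  fixes \<nu> x \<beta> :: real
  shows "(\<integral>\<^sup>+\<rho>. ennreal ((x - (\<rho> + 1/\<rho>) / 2) powr (\<beta> - 1) * (\<rho> powr (\<nu> - 1) + \<rho> powr (- \<nu> - 1)))
        * indicator {\<rho>. (\<rho> + 1/\<rho>) / 2 < x} \<rho> * indicator {1<..} \<rho> \<partial>lborel) =
      (\<integral>\<^sup>+\<rho>. ennreal ((x - (\<rho> + 1/\<rho>) / 2) powr (\<beta> - 1) * \<rho> powr (- \<nu> - 1))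
        * indicator {\<rho>. (\<rho> + 1/\<rho>) / 2 < x} \<rho> * indicator {0<..} \<rho> \<partial>lborel)"
proof -
  define F where "F \<rho> = ennreal ((x - (\<rho> + 1/\<rho>) / 2) powr (\<beta> - 1) * \<rho> powr (- \<nu> - 1))
        * indicator {\<rho>. (\<rho> + 1/\<rho>) / 2 < x} \<rho>" for \<rho> :: real
  have F[measurable]: "F \<in> borel_measurable borel" unfolding F_def by measurable
  have inv: "F (1 / \<rho>) * ennreal (1 / \<rho>\<^sup>2) = ennreal ((x - (\<rho> + 1/\<rho>) / 2) powr (\<beta> - 1) * \<rho> powr (\<nu> - 1))
        * indicator {\<rho>. (\<rho> + 1/\<rho>) / 2 < x} \<rho>" if "\<rho> > 1" for \<rho>
  proof -
    have "(1 / \<rho>) powr (- \<nu> - 1) = \<rho> powr (\<nu> + 1)"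
      using powr_divide_pos[of 1 \<rho> "- \<nu> - 1"] that by (simp add: add.commute)
    moreover have "1 / \<rho>\<^sup>2 = \<rho> powr (- 2)"
      using that by (simp add: powr_minus divide_inverse)
    ultimately have "(1 / \<rho>) powr (- \<nu> - 1) * (1 / \<rho>\<^sup>2) = \<rho> powr (\<nu> + 1) * \<rho> powr (- 2)"
      by simp
    also have "\<dots> = \<rho> powr (\<nu> - 1)" unfolding powr_add[symmetric] by simp
    finally have e: "(1 / \<rho>) powr (- \<nu> - 1) * (1 / \<rho>\<^sup>2) = \<rho> powr (\<nu> - 1)" .
    have "ennreal ((x - (\<rho> + 1/\<rho>) / 2) powr (\<beta> - 1) * (1 / \<rho>) powr (- \<nu> - 1)) * ennreal (1 / \<rho>\<^sup>2) =
        ennreal ((x - (\<rho> + 1/\<rho>) / 2) powr (\<beta> - 1) * \<rho> powr (\<nu> - 1))"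
      unfolding e[symmetric] by (subst ennreal_mult'[symmetric]) (auto simp: mult_ac)
    moreover have "indicator {\<rho>. (\<rho> + 1/\<rho>) / 2 < x} (1 / \<rho>) = (indicator {\<rho>. (\<rho> + 1/\<rho>) / 2 < x} \<rho> :: ennreal)"
      by (simp add: indicator_def add.commute)
    hence "F (1 / \<rho>) = ennreal ((x - (\<rho> + 1/\<rho>) / 2) powr (\<beta> - 1) * (1 / \<rho>) powr (- \<nu> - 1))
        * indicator {\<rho>. (\<rho> + 1/\<rho>) / 2 < x} \<rho>"
      unfolding F_def by (simp add: add.commute)
    hence "F (1 / \<rho>) * ennreal (1 / \<rho>\<^sup>2) =
        (ennreal ((x - (\<rho> + 1/\<rho>) / 2) powr (\<beta> - 1) * (1 / \<rho>) powr (- \<nu> - 1)) * ennreal (1 / \<rho>\<^sup>2))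
        * indicator {\<rho>. (\<rho> + 1/\<rho>) / 2 < x} \<rho>"
      by (simp only: mult_ac)
    ultimately show ?thesis by (simp only:)
  qed
  have "(\<integral>\<^sup>+\<rho>. ennreal ((x - (\<rho> + 1/\<rho>) / 2) powr (\<beta> - 1) * (\<rho> powr (\<nu> - 1) + \<rho> powr (- \<nu> - 1)))
        * indicator {\<rho>. (\<rho> + 1/\<rho>) / 2 < x} \<rho> * indicator {1<..} \<rho> \<partial>lborel) =
     (\<integral>\<^sup>+\<rho>. F (1 / \<rho>) * ennreal (1 / \<rho>\<^sup>2) * indicator {1<..} \<rho> + F \<rho> * indicator {1<..} \<rho> \<partial>lborel)"
  proof (intro nn_integral_cong, goal_cases)
    case (1 \<rho>)
    show ?case
    proof (cases "\<rho> > 1")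
      case True
      show ?thesis unfolding inv[OF True] unfolding F_def
        by (simp add: distrib_left distrib_right)
    qed simp
  qed
  also have "\<dots> = (\<integral>\<^sup>+\<rho>. F \<rho> * indicator {0<..<1} \<rho> \<partial>lborel) + (\<integral>\<^sup>+\<rho>. F \<rho> * indicator {1<..} \<rho> \<partial>lborel)"
    by (subst nn_integral_add) (auto simp: nn_integral_inversion[OF F])
  also have "\<dots> = (\<integral>\<^sup>+\<rho>. F \<rho> * indicator {0<..<1} \<rho> + F \<rho> * indicator {1<..} \<rho> \<partial>lborel)"
    by (subst nn_integral_add) auto
  also have "\<dots> = (\<integral>\<^sup>+\<rho>. F \<rho> * indicator {0<..} \<rho> \<partial>lborel)"
  proof (rule nn_integral_cong_AE)
    have "AE \<rho> in lborel. \<rho> \<noteq> (1::real)" by (rule AE_lborel_singleton)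
    thus "AE \<rho> in lborel. F \<rho> * indicator {0<..<1} \<rho> + F \<rho> * indicator {1<..} \<rho> = F \<rho> * indicator {0<..} \<rho>"
      by eventually_elim (auto simp: indicator_def)
  qed
  finally show ?thesis unfolding F_def .
qed

text \<open>Euler's transformation replaces the first two parameters by 1/2 + \<nu> and 1/2 - \<nu>
  with \<nu> = \<beta> + \<mu>. Bateman's integral of order \<beta> then starts from third parameter
  1/2, where the function is a hyperbolic cosine of \<nu> \<phi> divided by one of \<phi>/2, up to
  sqrt pi.\<close>

lemma hyp_reg_gegenbauer_fractional:
  fixes \<beta> \<mu> x :: real
  assumes \<beta>: "\<beta> > 0" and \<nu>0: "\<beta> + \<mu> \<noteq> 0" and x: "x > 1"
  obtains h where "h \<ge> 0"
    "hyp_reg (of_real (- \<mu>)) (of_real (2 * \<beta> + \<mu>)) (of_real (\<beta> + 1/2)) (of_real ((1 - x) / 2)) = of_real h"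
    "ennreal ((x\<^sup>2 - 1) powr (\<beta> - 1/2) * h) = ennreal (2 powr (\<beta> - 1) / (sqrt pi * Gamma \<beta>)) *
      (\<integral>\<^sup>+\<rho>. ennreal ((x - (\<rho> + 1/\<rho>) / 2) powr (\<beta> - 1) * \<rho> powr (- (\<beta> + \<mu>) - 1))
        * indicator {\<rho>. (\<rho> + 1/\<rho>) / 2 < x} \<rho> * indicator {0<..} \<rho> \<partial>lborel)"
proof -
  define \<nu> where "\<nu> = \<beta> + \<mu>"
  define y where "y = (x - 1) / 2"
  have y: "y > 0" using x by (simp add: y_def)
  define f where "f = hyp_reg (of_real (1/2 + \<nu>)) (of_real (1/2 - \<nu>)) (1/2)"
  define h0 where "h0 t = Re (f (of_real (- t)))" for t
  have f_rho: "f (of_real (- (((\<rho> + 1/\<rho>) / 2 - 1) / 2))) =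
     complex_of_real ((\<rho> powr \<nu> + \<rho> powr (- \<nu>)) / 2 / (sqrt pi * sqrt (((\<rho> + 1/\<rho>) / 2 + 1) / 2)))" if "\<rho> > 0" for \<rho>
    using hyp_reg_cosh_rho[of \<nu> \<rho>] that \<nu>0 unfolding f_def \<nu>_def by blast
  have h0_rho: "h0 (((\<rho> + 1/\<rho>) / 2 - 1) / 2) = (\<rho> powr \<nu> + \<rho> powr (- \<nu>)) / 2 / (sqrt pi * sqrt (((\<rho> + 1/\<rho>) / 2 + 1) / 2))"
    if "\<rho> > 0" for \<rho>
    unfolding h0_def f_rho[OF that] by (rule Re_complex_of_real)
  have h0: "f (of_real (- t)) = of_real (h0 t) \<and> h0 t \<ge> 0" if "t > 0" for t
  proof -
    have "t \<in> (\<lambda>\<rho>::real. ((\<rho> + 1/\<rho>) / 2 - 1) / (2 * 1)) ` {1<..}"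
      using that by (subst joukowski_image) auto
    then obtain \<rho> where \<rho>: "\<rho> > 1" "t = ((\<rho> + 1/\<rho>) / 2 - 1) / 2" by auto
    hence "\<rho> > 0" by simp
    thus ?thesis unfolding \<rho>(2) h0_rho[OF \<open>\<rho> > 0\<close>] f_rho[OF \<open>\<rho> > 0\<close>] by simp
  qed
  have f_hol: "f holomorphic_on slit_plane" unfolding f_def by (rule holomorphic_hyp_reg)
  have ys: "complex_of_real (- y) \<in> slit_plane" using y by (intro of_real_in_slit_plane) simp
  obtain H where H: "H \<ge> 0"
    "(\<integral>r. beta_kernel (of_real (1/2)) (of_real \<beta>) r * f (of_real r * of_real (- y)) \<partial>lborel) = of_real H"
    "(\<integral>\<^sup>+r. ennreal (r powr (1/2 - 1) * (1 - r) powr (\<beta> - 1) * h0 (r * y)) * indicator {0<..<1} r \<partial>lborel) = ennreal H"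
  proof (rule beta_average_of_real[OF f_hol ys, of "1/2" \<beta> "\<lambda>r. h0 (r * y)"])
    show "f (of_real (r * - y)) = of_real (h0 (r * y))" "h0 (r * y) \<ge> 0" if "0 < r" for r
      using h0[of "r * y"] that y by simp_all
  qed (use \<beta> in auto)
  have G: "Gamma \<beta> > 0" using \<beta> by simp
  have "hyp_reg (of_real (1/2 + \<nu>)) (of_real (1/2 - \<nu>)) (of_real (1/2) + of_real \<beta>) (of_real (- y)) =
     rGamma (of_real \<beta>) * (\<integral>r. beta_kernel (of_real (1/2)) (of_real \<beta>) r * f (of_real r * of_real (- y)) \<partial>lborel)"
    using hyp_reg_bateman[of "of_real (1/2)" "of_real \<beta>" "of_real (- y)" "of_real (1/2 + \<nu>)" "of_real (1/2 - \<nu>)"]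
      \<beta> ys unfolding f_def by simp
  also have "\<dots> = of_real (H / Gamma \<beta>)"
    unfolding H(2) by (simp add: rGamma_inverse_Gamma Gamma_complex_of_real[symmetric] divide_inverse mult.commute)
  finally have bat: "hyp_reg (of_real (1/2 + \<nu>)) (of_real (1/2 - \<nu>)) (of_real (1/2) + of_real \<beta>) (of_real (- y)) = of_real (H / Gamma \<beta>)" .
  define h where "h = (1 + y) powr (1/2 - \<beta>) * (H / Gamma \<beta>)"
  have hyp: "hyp_reg (of_real (- \<mu>)) (of_real (2 * \<beta> + \<mu>)) (of_real (\<beta> + 1/2)) (of_real ((1 - x) / 2)) = of_real h"
  proof -
    have z: "(1 - x) / 2 = - y" by (simp add: y_def field_simps)
    have "complex_of_real (\<beta> + 1/2) \<notin> \<int>\<^sub>\<le>\<^sub>0" using nonpos_Ints_Re[of "complex_of_real (\<beta> + 1/2)"] \<beta> by auto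
    hence "hyp_reg (of_real (- \<mu>)) (of_real (2 * \<beta> + \<mu>)) (of_real (\<beta> + 1/2)) (of_real (- y)) =
      (1 - of_real (- y)) powr (of_real (\<beta> + 1/2) - of_real (- \<mu>) - of_real (2 * \<beta> + \<mu>)) *
      hyp_reg (of_real (\<beta> + 1/2) - of_real (- \<mu>)) (of_real (\<beta> + 1/2) - of_real (2 * \<beta> + \<mu>)) (of_real (\<beta> + 1/2)) (of_real (- y))"
      by (rule hyp_reg_euler_transformation[OF ys])
    also have "complex_of_real (\<beta> + 1/2) - of_real (- \<mu>) = of_real (1/2 + \<nu>)" by (simp add: \<nu>_def)
    also have "complex_of_real (\<beta> + 1/2) - of_real (2 * \<beta> + \<mu>) = of_real (1/2 - \<nu>)" by (simp add: \<nu>_def)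
    also have "complex_of_real (\<beta> + 1/2) = of_real (1/2) + of_real \<beta>" by simp
    also note bat
    also have "(1 - complex_of_real (- y)) powr (of_real (1/2 + \<nu>) - of_real (2 * \<beta> + \<mu>)) = of_real ((1 + y) powr (1/2 - \<beta>))"
    proof -
      have "complex_of_real (1/2 + \<nu>) - of_real (2 * \<beta> + \<mu>) = of_real (1/2 - \<beta>)" by (simp add: \<nu>_def)
      moreover have "1 - complex_of_real (- y) = of_real (1 + y)" by simp
      moreover have "complex_of_real (1 + y) powr of_real (1/2 - \<beta>) = of_real ((1 + y) powr (1/2 - \<beta>))"
        using powr_of_real[of "1 + y" "1/2 - \<beta>"] y by simp
      ultimately show ?thesis by (simp only:)
    qed
    finally show ?thesis unfolding z h_def by (simp only: of_real_add of_real_mult add.commute)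
  qed
  define F where "F r = ennreal (r powr (1/2 - 1) * (1 - r) powr (\<beta> - 1) * h0 (r * y)) * indicator {0<..<1} r" for r
  define k where "k = (2 * y) powr (1/2 - \<beta>) / sqrt (2 * pi)"
  define X where "X = (\<integral>\<^sup>+\<rho>. ennreal ((x - (\<rho> + 1/\<rho>) / 2) powr (\<beta> - 1) * \<rho> powr (- \<nu> - 1))
        * indicator {\<rho>. (\<rho> + 1/\<rho>) / 2 < x} \<rho> * indicator {0<..} \<rho> \<partial>lborel)"
  have k: "k \<ge> 0" by (simp add: k_def)
  have "F \<in> borel_measurable borel"
  proof -
    \<comment> \<open>For negative r the argument of f may lie on the cut; continuity of
      \<open>h0\<close> is used only for positive r.\<close>
    have "(\<lambda>r. indicator {0<..} r *\<^sub>R h0 (r * y)) \<in> borel_measurable borel"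
    proof (rule borel_measurable_continuous_on_indicator)
      have "continuous_on {0<..} (\<lambda>r. f (of_real (- (r * y))))"
        by (rule continuous_on_compose2[OF holomorphic_on_imp_continuous_on[OF f_hol]])
           (use y in \<open>auto intro!: continuous_intros of_real_in_slit_plane simp: mult_pos_pos order.strict_trans2[of _ 0]\<close>,
            metis add.inverse_inverse less_minus_iff mult_pos_pos neg_less_0_iff_less of_real_in_slit_plane of_real_minus of_real_mult order_less_trans zero_less_one)
      thus "continuous_on {0<..} (\<lambda>r. h0 (r * y))" unfolding h0_def by (intro continuous_intros)
    qed simp
    hence "(\<lambda>r. ennreal (r powr (1/2 - 1) * (1 - r) powr (\<beta> - 1) * (indicator {0<..} r *\<^sub>R h0 (r * y))) * indicator {0<..<1} r) \<in> borel_measurable borel"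
      by measurable
    also have "(\<lambda>r. ennreal (r powr (1/2 - 1) * (1 - r) powr (\<beta> - 1) * (indicator {0<..} r *\<^sub>R h0 (r * y))) * indicator {0<..<1} r) = F"
      by (auto simp: F_def fun_eq_iff indicator_def)
    finally show ?thesis .
  qed
  note Fm = this
  \<comment> \<open>F vanishes beyond 1, so the range may be enlarged to the half-line, the full
    image of the next substitution.\<close>
  have "ennreal H = (\<integral>\<^sup>+r. F r * indicator {0<..} r \<partial>lborel)"
    unfolding H(3)[symmetric] F_def by (intro nn_integral_cong) (auto simp: indicator_def)
  \<comment> \<open>With Y = (\<rho> + 1/\<rho>)/2 the substitution r = (Y - 1)/(2 y) puts the
    argument r y = (Y - 1)/2 where \<open>h0_rho\<close> applies, and r < 1 means Y < x.\<close>
  also have "\<dots> = (\<integral>\<^sup>+\<rho>. F (((\<rho> + 1/\<rho>) / 2 - 1) / (2 * y)) * ennreal ((1 - 1/\<rho>\<^sup>2) / (4 * y)) * indicator {1<..} \<rho> \<partial>lborel)"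
  proof (rule nn_integral_substitution_greaterThan[OF Fm])
    fix \<rho> :: real assume r: "\<rho> > 1"
    show "((\<lambda>\<rho>. ((\<rho> + 1/\<rho>) / 2 - 1) / (2 * y)) has_real_derivative (1 - 1/\<rho>\<^sup>2) / (4 * y)) (at \<rho>)"
      using r y by (auto intro!: derivative_eq_intros simp: power2_eq_square field_simps)
    show "(1 - 1/\<rho>\<^sup>2) / (4 * y) \<ge> 0" using r y by (simp add: field_simps)
  qed (use joukowski_image[OF y] in \<open>auto intro!: continuous_intros\<close>)
  also have "\<dots> = (\<integral>\<^sup>+\<rho>. ennreal k * (ennreal ((x - (\<rho> + 1/\<rho>) / 2) powr (\<beta> - 1) * (\<rho> powr (\<nu> - 1) + \<rho> powr (- \<nu> - 1)))
        * indicator {\<rho>. (\<rho> + 1/\<rho>) / 2 < x} \<rho> * indicator {1<..} \<rho>) \<partial>lborel)"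
  proof (intro nn_integral_cong, goal_cases)
    case (1 \<rho>)
    show ?case
    proof (cases "\<rho> > 1")
      case True
      define Y where "Y = (\<rho> + 1/\<rho>) / 2"
      define g where "g = (Y - 1) / (2 * y)"
      have Y1: "Y > 1"
        using joukowski_gt_1[OF True] by (simp add: Y_def)
      have g: "g > 0" using Y1 y by (simp add: g_def)
      have glt: "g < 1 \<longleftrightarrow> Y < x" using y by (simp add: g_def y_def field_simps)
      show ?thesis
      proof (cases "Y < x")
        case False
        hence ind0: "indicator {\<rho>. (\<rho> + 1/\<rho>) / 2 < x} \<rho> = (0 :: ennreal)"
          by (simp add: Y_def indicator_def)
        show ?thesis unfolding ind0 unfolding Y_def[symmetric] unfolding g_def[symmetric] F_def
          using glt False by simp
      next
        case Yx: True
        have e1: "g powr (1/2 - 1) = (Y - 1) powr (- (1/2)) * (2 * y) powr (1/2)"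
          unfolding g_def using Y1 y by (simp add: powr_divide_pos)
        have e2: "(1 - g) powr (\<beta> - 1) = (x - Y) powr (\<beta> - 1) * (2 * y) powr (1 - \<beta>)"
        proof -
          have "1 - g = (x - Y) / (2 * y)" using y by (simp add: g_def y_def field_simps)
          thus ?thesis using Yx y by (simp add: powr_divide_pos)
        qed
        have e3: "h0 (g * y) = (\<rho> powr \<nu> + \<rho> powr (- \<nu>)) / 2 / (sqrt pi * sqrt ((Y + 1) / 2))"
          using h0_rho[of \<rho>] True y by (simp add: g_def Y_def[symmetric])
        have e4: "(1 - 1/\<rho>\<^sup>2) / (4 * y) = (\<rho> - 1/\<rho>) / \<rho> / (4 * y)"
          using True by (simp add: field_simps power2_eq_square)
        \<comment> \<open>Since Y^2 - 1 is the square of (\<rho> - 1/\<rho>)/2, the two square roots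
          cancel the nontrivial factor of the derivative in \<open>e4\<close>.\<close>
        have e5: "(Y - 1) powr (- (1/2)) / sqrt (Y + 1) = 2 / (\<rho> - 1/\<rho>)"
        proof -
          have r: "\<rho> - 1/\<rho> > 0" using True by (simp add: field_simps less_1_mult)
          have "(Y - 1) * (Y + 1) = ((\<rho> - 1/\<rho>) / 2)\<^sup>2" using True by (simp add: Y_def field_simps power2_eq_square)
          hence "sqrt (Y - 1) * sqrt (Y + 1) = (\<rho> - 1/\<rho>) / 2"
            unfolding real_sqrt_mult[symmetric] using r by simp
          hence "1 / (sqrt (Y - 1) * sqrt (Y + 1)) = 1 / ((\<rho> - 1/\<rho>) / 2)" by (simp only:)
          hence "1 / (sqrt (Y - 1) * sqrt (Y + 1)) = 2 / (\<rho> - 1/\<rho>)" by simp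
          moreover have "(Y - 1) powr (- (1/2)) = inverse (sqrt (Y - 1))"
            unfolding powr_minus using Y1 by (subst powr_half_sqrt) simp_all
          ultimately show ?thesis by (simp add: inverse_eq_divide)
        qed
        have e6: "(\<rho> powr \<nu> + \<rho> powr (- \<nu>)) / \<rho> = \<rho> powr (\<nu> - 1) + \<rho> powr (- \<nu> - 1)"
          using True by (simp add: powr_diff add_divide_distrib)
        have e7: "(2 * y) powr (1/2) * (2 * y) powr (1 - \<beta>) / (2 * y) = (2 * y) powr (1/2 - \<beta>)"
        proof -
          have "(2 * y) powr (1/2) * (2 * y) powr (1 - \<beta>) = (2 * y) powr (1 + (1/2 - \<beta>))"
            unfolding powr_add[symmetric] by simp
          also have "\<dots> = 2 * y * (2 * y) powr (1/2 - \<beta>)" using y by (subst powr_add) simp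
          finally show ?thesis using y by simp
        qed
        have R0: "(1 - 1/\<rho>\<^sup>2) / (4 * y) \<ge> 0" using True y by (simp add: field_simps)
        have "g powr (1/2 - 1) * (1 - g) powr (\<beta> - 1) * h0 (g * y) * ((1 - 1/\<rho>\<^sup>2) / (4 * y)) =
           ((2 * y) powr (1/2) * (2 * y) powr (1 - \<beta>) / (2 * y)) * ((Y - 1) powr (- (1/2)) / sqrt (Y + 1))
           * ((x - Y) powr (\<beta> - 1)) * ((\<rho> powr \<nu> + \<rho> powr (- \<nu>)) / \<rho>) * (\<rho> - 1/\<rho>) * (sqrt 2 / (4 * sqrt pi))"
          unfolding e1 e2 e3 e4 real_sqrt_divide by (simp add: mult_ac)
        also have "\<dots> = (2 * y) powr (1/2 - \<beta>) * (2 / (\<rho> - 1/\<rho>) * (\<rho> - 1/\<rho>)) * (sqrt 2 / (4 * sqrt pi)) *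
            ((x - Y) powr (\<beta> - 1) * (\<rho> powr (\<nu> - 1) + \<rho> powr (- \<nu> - 1)))"
          unfolding e5 e6 e7 by (simp only: mult_ac)
        also have "2 / (\<rho> - 1/\<rho>) * (\<rho> - 1/\<rho>) = 2"
        proof -
          have "\<rho> - 1/\<rho> \<noteq> 0" using True by (simp add: field_simps) (smt (verit) less_1_mult)
          thus ?thesis by (rule nonzero_eq_divide_eq[THEN iffD1, OF _ refl])
        qed
        also have "(2 * y) powr (1/2 - \<beta>) * 2 * (sqrt 2 / (4 * sqrt pi)) = k"
        proof -
          have "2 * (sqrt 2 / (4 * sqrt pi)) = 1 / sqrt (2 * pi)"
            by (simp add: real_sqrt_mult field_simps)
          hence "(2 * y) powr (1/2 - \<beta>) * 2 * (sqrt 2 / (4 * sqrt pi)) = (2 * y) powr (1/2 - \<beta>) * (1 / sqrt (2 * pi))"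
            by (simp only: mult.assoc)
          thus ?thesis unfolding k_def by (simp only: times_divide_eq_right mult_1_right)
        qed
        finally have "g powr (1/2 - 1) * (1 - g) powr (\<beta> - 1) * h0 (g * y) * ((1 - 1/\<rho>\<^sup>2) / (4 * y)) =
            k * ((x - Y) powr (\<beta> - 1) * (\<rho> powr (\<nu> - 1) + \<rho> powr (- \<nu> - 1)))" .
        hence "ennreal (g powr (1/2 - 1) * (1 - g) powr (\<beta> - 1) * h0 (g * y)) * ennreal ((1 - 1/\<rho>\<^sup>2) / (4 * y)) =
            ennreal k * ennreal ((x - Y) powr (\<beta> - 1) * (\<rho> powr (\<nu> - 1) + \<rho> powr (- \<nu> - 1)))"
          unfolding ennreal_mult''[OF R0, symmetric] ennreal_mult'[OF k, symmetric] by (simp only:)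
        moreover have ind1: "indicator {\<rho>. (\<rho> + 1/\<rho>) / 2 < x} \<rho> = (1 :: ennreal)"
          using Yx by (simp add: Y_def indicator_def)
        moreover have "indicator {0<..<1} g = (1 :: ennreal)" using Yx glt g by simp
        ultimately show ?thesis unfolding ind1 unfolding Y_def[symmetric] unfolding g_def[symmetric] F_def
          using True by simp
      qed
    qed simp
  qed
  also have "\<dots> = ennreal k * X"
    unfolding X_def nn_integral_joukowski[symmetric] by (rule nn_integral_cmult) measurable
  finally have HX: "ennreal H = ennreal k * X" .
  have main: "ennreal ((x\<^sup>2 - 1) powr (\<beta> - 1/2) * h) = ennreal (2 powr (\<beta> - 1) / (sqrt pi * Gamma \<beta>)) * X"
  proof -
    \<comment> \<open>The power of 1 + y cancels the prefactor from Euler's transformation, and the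
      power of 2 y cancels the one in k; only a constant remains.\<close>
    have x2: "x\<^sup>2 - 1 = 2 * (2 * y) * (1 + y)" by (simp add: y_def field_simps power2_eq_square)
    have "(x\<^sup>2 - 1) powr (\<beta> - 1/2) * (1 + y) powr (1/2 - \<beta>) = 2 powr (\<beta> - 1/2) * (2 * y) powr (\<beta> - 1/2) *
        ((1 + y) powr (\<beta> - 1/2) * (1 + y) powr (1/2 - \<beta>))"
      unfolding x2 powr_mult[of "2 * (2 * y)" "1 + y"] powr_mult[of 2 "2 * y"] by (simp only: mult_ac)
    also have "(1 + y) powr (\<beta> - 1/2) * (1 + y) powr (1/2 - \<beta>) = 1"
      unfolding powr_add[symmetric] using y by simp
    finally have "(x\<^sup>2 - 1) powr (\<beta> - 1/2) * h = 2 powr (\<beta> - 1/2) * (2 * y) powr (\<beta> - 1/2) / Gamma \<beta> * H"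
      by (simp add: h_def)
    hence "ennreal ((x\<^sup>2 - 1) powr (\<beta> - 1/2) * h) = ennreal (2 powr (\<beta> - 1/2) * (2 * y) powr (\<beta> - 1/2) / Gamma \<beta>) * (ennreal k * X)"
      unfolding HX[symmetric] ennreal_mult''[OF H(1), symmetric] by (simp only:)
    also have "\<dots> = ennreal (2 powr (\<beta> - 1/2) * (2 * y) powr (\<beta> - 1/2) / Gamma \<beta> * k) * X"
      unfolding ennreal_mult''[OF k] by (simp only: mult.assoc)
    also have "2 powr (\<beta> - 1/2) * (2 * y) powr (\<beta> - 1/2) / Gamma \<beta> * k = 2 powr (\<beta> - 1) / (sqrt pi * Gamma \<beta>)"
    proof -
      have "(2 * y) powr (\<beta> - 1/2) * (2 * y) powr (1/2 - \<beta>) = 1"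
        unfolding powr_add[symmetric] using y by simp
      moreover have "2 powr (\<beta> - 1/2) = 2 powr (\<beta> - 1) * sqrt 2"
        using powr_add[of 2 "\<beta> - 1" "1/2"] by (simp add: powr_half_sqrt)
      ultimately show ?thesis by (simp add: k_def real_sqrt_mult field_simps)
    qed
    finally show ?thesis .
  qed
  have "h \<ge> 0" using H G by (simp add: h_def)
  from that[OF this hyp] main show ?thesis unfolding X_def \<nu>_def by simp
qed

section \<open>The double integral for real parameters\<close>

lemma joukowski_ge_1:
  fixes \<rho> :: real
  assumes "\<rho> > 0"
  shows "(\<rho> + 1/\<rho>) / 2 \<ge> 1"
proof -
  have "(\<rho> - 1)\<^sup>2 / \<rho> \<ge> 0" using assms by simp
  also have "(\<rho> - 1)\<^sup>2 / \<rho> = 2 * ((\<rho> + 1/\<rho>) / 2 - 1)" using assms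
    by (simp add: field_simps power2_eq_square)
  finally show ?thesis by simp
qed

text \<open>Inserting the integral over \<rho> and integrating x first replaces x in the denominator
  by Y(\<rho>) and lowers the exponent from s to s - b. The new base X + Y(\<rho>) = (p + \<rho>)(1
  + p \<rho>) / (2 p \<rho>) factorises.\<close>

lemma nn_integral_gegenbauer:
  fixes b m s p :: real
  assumes b: "b > 0" and bm: "b + m \<noteq> 0" and s: "s > b" and p: "p > 0"
  shows "(\<integral>\<^sup>+x. ennreal ((x\<^sup>2 - 1) powr (b - 1/2) *
        Re (hyp_reg (of_real (- m)) (of_real (2 * b + m)) (of_real (b + 1/2)) (of_real ((1 - x) / 2)))
        * (1 + 2 * p * x + p\<^sup>2) powr (- s)) * indicator {1<..} x \<partial>lborel) =
     ennreal (Gamma (s - b) / (2 * sqrt pi * Gamma s) * p powr (- 2 * b - m)) *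
     (\<integral>\<^sup>+\<tau>. ennreal (\<tau> powr (s - 2 * b - m - 1) * ((1 + \<tau>) * (1 + p\<^sup>2 * \<tau>)) powr (- (s - b)))
        * indicator {0<..} \<tau> \<partial>lborel)"
proof -
  define Y where "Y \<rho> = (\<rho> + 1/\<rho>) / 2" for \<rho> :: real
  define X where "X = (p + 1/p) / 2"
  define C where "C = 2 powr (b - 1) / (sqrt pi * Gamma b)"
  define h where "h x = Re (hyp_reg (of_real (- m)) (of_real (2 * b + m)) (of_real (b + 1/2)) (of_real ((1 - x) / 2)))" for x
  define J where "J x \<rho> = (if 0 < \<rho> \<and> Y \<rho> < x then ennreal ((x - Y \<rho>) powr (b - 1) * (X + x) powr (- s)) * ennreal (\<rho> powr (- (b + m) - 1)) else 0)" for x \<rho>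
  have X: "X > 0" using p by (simp add: X_def add_pos_pos)
  have Gb: "Gamma b > 0" "Gamma s > 0" "Gamma (s - b) > 0" using b s by auto
  have C: "C > 0" using Gb by (simp add: C_def)
  have Jm[measurable]: "(\<lambda>(x, \<rho>). J x \<rho>) \<in> borel_measurable (lborel \<Otimes>\<^sub>M lborel)"
    unfolding J_def Y_def by measurable
  have pt: "ennreal ((x\<^sup>2 - 1) powr (b - 1/2) * h x * (1 + 2 * p * x + p\<^sup>2) powr (- s)) * indicator {1<..} x =
      ennreal (C * (2 * p) powr (- s)) * (\<integral>\<^sup>+\<rho>. J x \<rho> \<partial>lborel)" for x
  proof (cases "x > 1")
    case False
    have "J x \<rho> = 0" for \<rho> using joukowski_ge_1[of \<rho>] False by (auto simp: J_def Y_def)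
    thus ?thesis using False by simp
  next
    case True
    obtain h' where h': "h' \<ge> 0"
      "hyp_reg (of_real (- m)) (of_real (2 * b + m)) (of_real (b + 1/2)) (of_real ((1 - x) / 2)) = of_real h'"
      "ennreal ((x\<^sup>2 - 1) powr (b - 1/2) * h') = ennreal C *
      (\<integral>\<^sup>+\<rho>. ennreal ((x - (\<rho> + 1/\<rho>) / 2) powr (b - 1) * \<rho> powr (- (b + m) - 1))
        * indicator {\<rho>. (\<rho> + 1/\<rho>) / 2 < x} \<rho> * indicator {0<..} \<rho> \<partial>lborel)"
      using hyp_reg_gegenbauer_fractional[OF b bm True] unfolding C_def by blast
    have hh: "h x = h'" unfolding h_def h'(2) by (rule Re_complex_of_real)
    have Xx: "X + x > 0" using X True by simp
    \<comment> \<open>1 + 2 p x + p^2 = 2 p (X + x) with X = (p + 1/p)/2, which is linear in x with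
      unit coefficient.\<close>
    have e: "(1 + 2 * p * x + p\<^sup>2) powr (- s) = (2 * p) powr (- s) * (X + x) powr (- s)"
    proof -
      have "1 + 2 * p * x + p\<^sup>2 = (2 * p) * (X + x)" using p by (simp add: X_def field_simps power2_eq_square)
      thus ?thesis using p Xx by (simp only: powr_mult)
    qed
    have "ennreal ((x\<^sup>2 - 1) powr (b - 1/2) * h x * (1 + 2 * p * x + p\<^sup>2) powr (- s)) =
        ennreal ((x\<^sup>2 - 1) powr (b - 1/2) * h') * ennreal ((2 * p) powr (- s) * (X + x) powr (- s))"
      unfolding hh e using h'(1) by (subst ennreal_mult'') auto
    also have "\<dots> = ennreal (C * (2 * p) powr (- s)) * ((\<integral>\<^sup>+\<rho>. ennreal ((x - (\<rho> + 1/\<rho>) / 2) powr (b - 1) * \<rho> powr (- (b + m) - 1))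
        * indicator {\<rho>. (\<rho> + 1/\<rho>) / 2 < x} \<rho> * indicator {0<..} \<rho> \<partial>lborel) * ennreal ((X + x) powr (- s)))"
      unfolding h'(3) using C by (simp add: ennreal_mult mult_ac)
    also have "(\<integral>\<^sup>+\<rho>. ennreal ((x - (\<rho> + 1/\<rho>) / 2) powr (b - 1) * \<rho> powr (- (b + m) - 1))
        * indicator {\<rho>. (\<rho> + 1/\<rho>) / 2 < x} \<rho> * indicator {0<..} \<rho> \<partial>lborel) * ennreal ((X + x) powr (- s)) =
       (\<integral>\<^sup>+\<rho>. (ennreal ((x - (\<rho> + 1/\<rho>) / 2) powr (b - 1) * \<rho> powr (- (b + m) - 1))
        * indicator {\<rho>. (\<rho> + 1/\<rho>) / 2 < x} \<rho> * indicator {0<..} \<rho>) * ennreal ((X + x) powr (- s)) \<partial>lborel)"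
      by (rule nn_integral_multc[symmetric]) measurable
    also have "\<dots> = (\<integral>\<^sup>+\<rho>. J x \<rho> \<partial>lborel)"
      by (intro nn_integral_cong) (simp add: J_def Y_def indicator_def ennreal_mult mult_ac)
    finally show ?thesis using True by simp
  qed
  have Jx: "(\<integral>\<^sup>+x. J x \<rho> \<partial>lborel) = ennreal (Beta b (s - b)) *
      (ennreal (\<rho> powr (- (b + m) - 1) * (X + Y \<rho>) powr (- (s - b))) * indicator {0<..} \<rho>)" for \<rho>
  proof (cases "\<rho> > 0")
    case True
    have XY: "X + 1 * Y \<rho> > 0" unfolding Y_def using X joukowski_ge_1[OF True] by linarith
    have "(\<integral>\<^sup>+x. J x \<rho> \<partial>lborel) = (\<integral>\<^sup>+x. (ennreal ((x - Y \<rho>) powr (b - 1) * (X + 1 * x) powr (- (b + (s - b)))) * indicator {Y \<rho><..} x) * ennreal (\<rho> powr (- (b + m) - 1)) \<partial>lborel)"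
      using True by (intro nn_integral_cong) (simp add: J_def indicator_def)
    also have "\<dots> = ennreal (1 powr (- b) * (X + 1 * Y \<rho>) powr (- (s - b)) * Beta b (s - b)) * ennreal (\<rho> powr (- (b + m) - 1))"
      by (subst nn_integral_multc, measurable, subst nn_integral_beta_linear) (use b s XY in auto)
    finally show ?thesis using True Beta_real_pos[of b "s - b"] b s by (simp add: ennreal_mult mult_ac)
  qed (simp add: J_def)
  define T where "T = (\<integral>\<^sup>+\<tau>. ennreal (\<tau> powr (s - 2 * b - m - 1) * ((1 + \<tau>) * (1 + p\<^sup>2 * \<tau>)) powr (- (s - b)))
        * indicator {0<..} \<tau> \<partial>lborel)"
  define c2 where "c2 = p powr (- (b + m) - 1) * (2 * p) powr (s - b)"
  \<comment> \<open>The scaling \<rho> = p \<tau> turns the base into (1 + \<tau>)(1 + p^2 \<tau>) /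
    (2 p \<tau>): apart from prefactors p survives only through p^2.\<close>
  have "(\<integral>\<^sup>+\<rho>. ennreal (\<rho> powr (- (b + m) - 1) * (X + Y \<rho>) powr (- (s - b))) * indicator {0<..} \<rho> \<partial>lborel) =
     ennreal p * (\<integral>\<^sup>+\<tau>. ennreal ((p * \<tau>) powr (- (b + m) - 1) * (X + Y (p * \<tau>)) powr (- (s - b))) * indicator {0<..} \<tau> \<partial>lborel)"
    using p by (intro nn_integral_scale) (auto simp: Y_def)
  also have "(\<integral>\<^sup>+\<tau>. ennreal ((p * \<tau>) powr (- (b + m) - 1) * (X + Y (p * \<tau>)) powr (- (s - b))) * indicator {0<..} \<tau> \<partial>lborel) =
     (\<integral>\<^sup>+\<tau>. ennreal c2 * (ennreal (\<tau> powr (s - 2 * b - m - 1) * ((1 + \<tau>) * (1 + p\<^sup>2 * \<tau>)) powr (- (s - b)))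
        * indicator {0<..} \<tau>) \<partial>lborel)"
  proof (intro nn_integral_cong, goal_cases)
    case (1 \<tau>)
    show ?case
    proof (cases "\<tau> > 0")
      case True
      define D where "D = (1 + \<tau>) * (1 + p\<^sup>2 * \<tau>)"
      have D: "D > 0" unfolding D_def using True p by (intro mult_pos_pos add_pos_pos) auto
      have "X + Y (p * \<tau>) = D / ((2 * p) * \<tau>)"
        using True p by (simp add: X_def Y_def D_def field_simps power2_eq_square)
      hence "(X + Y (p * \<tau>)) powr (- (s - b)) = D powr (- (s - b)) * ((2 * p) powr (s - b) * \<tau> powr (s - b))"
        using True p D by (simp add: powr_divide_pos powr_mult)
      moreover have "(p * \<tau>) powr (- (b + m) - 1) = p powr (- (b + m) - 1) * \<tau> powr (- (b + m) - 1)"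
        using True p by (intro powr_mult)
      moreover have "\<tau> powr (- (b + m) - 1) * \<tau> powr (s - b) = \<tau> powr (s - 2 * b - m - 1)"
        unfolding powr_add[symmetric] by (simp add: algebra_simps)
      ultimately have "(p * \<tau>) powr (- (b + m) - 1) * (X + Y (p * \<tau>)) powr (- (s - b)) =
          c2 * (\<tau> powr (s - 2 * b - m - 1) * D powr (- (s - b)))"
        by (simp add: c2_def mult_ac)
      thus ?thesis using True unfolding D_def by (simp add: ennreal_mult c2_def)
    qed simp
  qed
  also have "\<dots> = ennreal c2 * T" unfolding T_def by (rule nn_integral_cmult) measurable
  finally have R: "(\<integral>\<^sup>+\<rho>. ennreal (\<rho> powr (- (b + m) - 1) * (X + Y \<rho>) powr (- (s - b))) * indicator {0<..} \<rho> \<partial>lborel) =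
     ennreal p * (ennreal c2 * T)" .
  have "(\<integral>\<^sup>+x. ennreal ((x\<^sup>2 - 1) powr (b - 1/2) * h x * (1 + 2 * p * x + p\<^sup>2) powr (- s)) * indicator {1<..} x \<partial>lborel) =
      ennreal (C * (2 * p) powr (- s)) * (\<integral>\<^sup>+x. (\<integral>\<^sup>+\<rho>. J x \<rho> \<partial>lborel) \<partial>lborel)"
    unfolding pt by (rule nn_integral_cmult) measurable
  also have "(\<integral>\<^sup>+x. (\<integral>\<^sup>+\<rho>. J x \<rho> \<partial>lborel) \<partial>lborel) = (\<integral>\<^sup>+\<rho>. (\<integral>\<^sup>+x. J x \<rho> \<partial>lborel) \<partial>lborel)"
    by (rule lborel_pair.Fubini'[symmetric]) measurable
  also have "\<dots> = ennreal (Beta b (s - b)) * (ennreal p * (ennreal c2 * T))"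
    unfolding Jx R[symmetric] by (rule nn_integral_cmult) (simp add: Y_def)
  also have "ennreal (C * (2 * p) powr (- s)) * \<dots> = ennreal (C * (2 * p) powr (- s) * Beta b (s - b) * p * c2) * T"
    using C p Beta_real_pos[of b "s - b"] b s by (simp add: ennreal_mult mult.assoc c2_def)
  also have "C * (2 * p) powr (- s) * Beta b (s - b) * p * c2 = Gamma (s - b) / (2 * sqrt pi * Gamma s) * p powr (- 2 * b - m)"
  proof -
    have "(2 * p) powr (- s) * (2 * p) powr (s - b) = (2 * p) powr (- b)"
      unfolding powr_add[symmetric] by simp
    also have "\<dots> = 2 powr (- b) * p powr (- b)" using p by (simp add: powr_mult)
    finally have 1: "(2 * p) powr (- s) * (2 * p) powr (s - b) = 2 powr (- b) * p powr (- b)" .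
    have 2: "p * p powr (- (b + m) - 1) * p powr (- b) = p powr (- 2 * b - m)"
    proof -
      have "p * p powr (- (b + m) - 1) * p powr (- b) = p powr 1 * p powr (- (b + m) - 1) * p powr (- b)" using p by simp
      thus ?thesis unfolding powr_add[symmetric] by simp
    qed
    have 3: "2 powr (b - 1) * 2 powr (- b) = (1/2 :: real)"
      unfolding powr_add[symmetric] by (simp add: powr_minus)
    have "C * (2 * p) powr (- s) * Beta b (s - b) * p * c2 =
        (2 powr (b - 1) / (sqrt pi * Gamma b)) * ((2 * p) powr (- s) * (2 * p) powr (s - b)) * (Gamma b * Gamma (s - b) / Gamma s) * (p * p powr (- (b + m) - 1))"
      by (simp add: C_def c2_def Beta_def mult_ac)
    also have "\<dots> = (2 powr (b - 1) * 2 powr (- b)) * (p * p powr (- (b + m) - 1) * p powr (- b)) * (Gamma (s - b) / (sqrt pi * Gamma s))"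
      unfolding 1 using Gb by (simp add: field_simps)
    also have "\<dots> = Gamma (s - b) / (2 * sqrt pi * Gamma s) * p powr (- 2 * b - m)"
      unfolding 2 3 by (simp add: mult_ac)
    finally show ?thesis .
  qed
  finally show ?thesis unfolding h_def T_def .
qed

text \<open>Here p^2 = \<kappa> (1 + u), so 1 + \<kappa> (1 + u) \<tau> = (1 + \<kappa> \<tau>) +
  \<kappa> \<tau> u is linear in u and the u-integral is of Beta type. It leaves a power of 1 +
  \<kappa> \<tau> (1 + t), in which \<tau> and t occur only through the product \<tau> (1 + t) that
  the scaling uses.\<close>

lemma nn_integral_jacobi:
  fixes b m d l s \<kappa> :: real
  assumes l: "l < 0" and dl: "d + l > 0" and q: "s - b - d - l > 0" and sbl: "s - b + l > 0" and \<kappa>: "\<kappa> > 0"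
  shows "(\<integral>\<^sup>+u. (\<integral>\<^sup>+t. ennreal ((u - t) powr (d + l - 1) * (t powr (- l - 1) * (1 + t) powr (- (d + b + l + m)))) * indicator {0<..<u} t \<partial>lborel)
       * (\<integral>\<^sup>+\<tau>. ennreal (\<tau> powr (s - 2 * b - m - 1) * ((1 + \<tau>) * (1 + \<kappa> * (1 + u) * \<tau>)) powr (- (s - b))) * indicator {0<..} \<tau> \<partial>lborel)
       * indicator {0<..} u \<partial>lborel) =
     ennreal (Beta (d + l) (s - b - d - l) * Beta (- l) (s - b + l) * \<kappa> powr (2 * b + m - s)) *
     (\<integral>\<^sup>+\<eta>. ennreal (\<eta> powr (s - 2 * b - m - d - l - 1) * (1 + \<eta>) powr (- (s - b - d - l)) * (1 + 1 / \<kappa> * \<eta>) powr (- (s - b + l)))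
        * indicator {0<..} \<eta> \<partial>lborel)"
proof -
  define A where "A = s - 2 * b - m"
  define q where "q = s - b - d - l"
  define f1 where "f1 t = ennreal (t powr (- l - 1) * (1 + t) powr (- (d + b + l + m))) * indicator {0<..} t" for t :: real
  define f2 where "f2 \<tau> = ennreal (\<tau> powr (A - 1) * (1 + \<tau>) powr (- (s - b))) * indicator {0<..} \<tau>" for \<tau> :: real
  define M where "M u t \<tau> = (if t < u then ennreal ((u - t) powr (d + l - 1) * (1 + \<kappa> * \<tau> + \<kappa> * \<tau> * u) powr (- (s - b))) else 0)" for u t \<tau> :: real
  have f1m[measurable]: "f1 \<in> borel_measurable borel" unfolding f1_def by measurable
  have f2m[measurable]: "f2 \<in> borel_measurable borel" unfolding f2_def by measurable
  have Mm[measurable]: "(\<lambda>x. M (f x) (g x) (h x)) \<in> borel_measurable N"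
    if [measurable]: "f \<in> borel_measurable N" "g \<in> borel_measurable N" "h \<in> borel_measurable N" for f g h and N :: "'c measure"
    unfolding M_def by measurable
  have q0: "q > 0" using assms by (simp add: q_def)
  have pt: "(\<integral>\<^sup>+t. ennreal ((u - t) powr (d + l - 1) * (t powr (- l - 1) * (1 + t) powr (- (d + b + l + m)))) * indicator {0<..<u} t \<partial>lborel)
       * (\<integral>\<^sup>+\<tau>. ennreal (\<tau> powr (s - 2 * b - m - 1) * ((1 + \<tau>) * (1 + \<kappa> * (1 + u) * \<tau>)) powr (- (s - b))) * indicator {0<..} \<tau> \<partial>lborel)
       * indicator {0<..} u = (\<integral>\<^sup>+t. (\<integral>\<^sup>+\<tau>. f1 t * f2 \<tau> * M u t \<tau> \<partial>lborel) \<partial>lborel)" for u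
  proof (cases "u > 0")
    case False
    hence "f1 t * f2 \<tau> * M u t \<tau> = 0" for t \<tau> by (auto simp: f1_def M_def)
    thus ?thesis using False by (simp only:) simp
  next
    case True
    have "(\<integral>\<^sup>+t. ennreal ((u - t) powr (d + l - 1) * (t powr (- l - 1) * (1 + t) powr (- (d + b + l + m)))) * indicator {0<..<u} t \<partial>lborel)
       * (\<integral>\<^sup>+\<tau>. ennreal (\<tau> powr (s - 2 * b - m - 1) * ((1 + \<tau>) * (1 + \<kappa> * (1 + u) * \<tau>)) powr (- (s - b))) * indicator {0<..} \<tau> \<partial>lborel) =
      (\<integral>\<^sup>+t. (\<integral>\<^sup>+\<tau>. (ennreal ((u - t) powr (d + l - 1) * (t powr (- l - 1) * (1 + t) powr (- (d + b + l + m)))) * indicator {0<..<u} t)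
       * (ennreal (\<tau> powr (s - 2 * b - m - 1) * ((1 + \<tau>) * (1 + \<kappa> * (1 + u) * \<tau>)) powr (- (s - b))) * indicator {0<..} \<tau>) \<partial>lborel) \<partial>lborel)"
      by (subst nn_integral_cmult, measurable, subst nn_integral_multc, measurable)
    also have "\<dots> = (\<integral>\<^sup>+t. (\<integral>\<^sup>+\<tau>. f1 t * f2 \<tau> * M u t \<tau> \<partial>lborel) \<partial>lborel)"
    proof (intro nn_integral_cong, goal_cases)
      case (1 t \<tau>)
      show ?case
      proof (cases "0 < t \<and> t < u \<and> 0 < \<tau>")
        case T: True
        have "((1 + \<tau>) * (1 + \<kappa> * (1 + u) * \<tau>)) powr (- (s - b)) =
            (1 + \<tau>) powr (- (s - b)) * (1 + \<kappa> * \<tau> + \<kappa> * \<tau> * u) powr (- (s - b))"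
        proof -
          have "1 + \<kappa> * (1 + u) * \<tau> = 1 + \<kappa> * \<tau> + \<kappa> * \<tau> * u" by (simp add: algebra_simps)
          moreover have "1 + \<kappa> * \<tau> + \<kappa> * \<tau> * u > 0" using T \<kappa> by (intro add_pos_pos mult_pos_pos) auto
          ultimately show ?thesis by (simp only: powr_mult)
        qed
        thus ?thesis using T by (simp add: f1_def f2_def M_def A_def ennreal_mult mult_ac)
      qed (auto simp: f1_def f2_def M_def indicator_def)
    qed
    finally show ?thesis using True by simp
  qed
  have Mu: "(\<integral>\<^sup>+u. M u t \<tau> \<partial>lborel) = ennreal ((\<kappa> * \<tau>) powr (- (d + l)) * (1 + \<kappa> * \<tau> + \<kappa> * \<tau> * t) powr (- q) * Beta (d + l) q)"
    if "t > 0" "\<tau> > 0" for t \<tau>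
  proof -
    have "(\<integral>\<^sup>+u. M u t \<tau> \<partial>lborel) =
       (\<integral>\<^sup>+u. ennreal ((u - t) powr (d + l - 1) * ((1 + \<kappa> * \<tau>) + \<kappa> * \<tau> * u) powr (- ((d + l) + q))) * indicator {t<..} u \<partial>lborel)"
      by (intro nn_integral_cong) (auto simp: M_def q_def)
    also have "\<dots> = ennreal ((\<kappa> * \<tau>) powr (- (d + l)) * ((1 + \<kappa> * \<tau>) + \<kappa> * \<tau> * t) powr (- q) * Beta (d + l) q)"
      using that \<kappa> dl q0 by (intro nn_integral_beta_linear) (simp_all add: add_pos_pos)
    finally show ?thesis .
  qed
  \<comment> \<open>After the scaling 1 + \<tau> becomes ((\<kappa> + \<eta>) + \<kappa> t) /
    (\<kappa> (1 + t)), whose numerator is again linear in t; g collects the factors free of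
    t.\<close>
  define N where "N \<eta> t = ennreal (t powr (- l - 1) * ((\<kappa> + \<eta>) + \<kappa> * t) powr (- (s - b))) * indicator {0<..} t" for \<eta> t :: real
  define g where "g \<eta> = ennreal (\<eta> powr (A - d - l - 1) * (1 + \<eta>) powr (- q)) * indicator {0<..} \<eta>" for \<eta> :: real
  have Nm[measurable]: "(\<lambda>x. N (f x) (h x)) \<in> borel_measurable M"
    if [measurable]: "f \<in> borel_measurable M" "h \<in> borel_measurable M" for f h and M :: "'c measure"
    unfolding N_def by measurable
  have gm[measurable]: "g \<in> borel_measurable borel" unfolding g_def by measurable
  have Bpos: "Beta (d + l) q > 0" "Beta (- l) (s - b + l) > 0" using Beta_real_pos dl q0 l sbl by auto
  have tau: "(\<integral>\<^sup>+\<tau>. (\<integral>\<^sup>+u. f1 t * f2 \<tau> * M u t \<tau> \<partial>lborel) \<partial>lborel) =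
      ennreal (Beta (d + l) q * \<kappa> powr (b + m)) * (\<integral>\<^sup>+\<eta>. g \<eta> * N \<eta> t \<partial>lborel)" for t
  proof (cases "t > 0")
    case False
    thus ?thesis by (simp add: f1_def N_def)
  next
    case t: True
    define F where "F \<tau> = ennreal (t powr (- l - 1) * (1 + t) powr (- (d + b + l + m)) * (\<tau> powr (A - 1) * (1 + \<tau>) powr (- (s - b))) *
         ((\<kappa> * \<tau>) powr (- (d + l)) * (1 + \<kappa> * \<tau> + \<kappa> * \<tau> * t) powr (- q) * Beta (d + l) q))" for \<tau>
    have Fm[measurable]: "F \<in> borel_measurable borel" unfolding F_def by measurable
    \<comment> \<open>The substitution \<open>\<tau> = \<eta> / (\<kappa> * (1 + t))\<close> cancels all powers of \<open>1 + t\<close>, which makes the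
      integral over \<open>t\<close> a Beta integral.\<close>
    define c where "c = 1 / (\<kappa> * (1 + t))"
    have c: "c > 0" using \<kappa> t by (simp add: c_def)
    have "(\<integral>\<^sup>+\<tau>. (\<integral>\<^sup>+u. f1 t * f2 \<tau> * M u t \<tau> \<partial>lborel) \<partial>lborel) = (\<integral>\<^sup>+\<tau>. F \<tau> * indicator {0<..} \<tau> \<partial>lborel)"
    proof (intro nn_integral_cong, goal_cases)
      case (1 \<tau>)
      show ?case
      proof (cases "\<tau> > 0")
        case True
        have "(\<integral>\<^sup>+u. f1 t * f2 \<tau> * M u t \<tau> \<partial>lborel) = f1 t * f2 \<tau> * (\<integral>\<^sup>+u. M u t \<tau> \<partial>lborel)"
          by (rule nn_integral_cmult) measurable
        thus ?thesis unfolding Mu[OF t True] using t True Bpos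
          by (simp add: f1_def f2_def F_def ennreal_mult[symmetric])
      qed (simp add: f2_def)
    qed
    also have "\<dots> = ennreal c * (\<integral>\<^sup>+\<eta>. F (c * \<eta>) * indicator {0<..} \<eta> \<partial>lborel)"
      by (rule nn_integral_scale[OF Fm c])
    also have "(\<integral>\<^sup>+\<eta>. F (c * \<eta>) * indicator {0<..} \<eta> \<partial>lborel) =
        (\<integral>\<^sup>+\<eta>. ennreal (Beta (d + l) q * \<kappa> powr (b + m) / c) * (g \<eta> * N \<eta> t) \<partial>lborel)"
    proof (intro nn_integral_cong, goal_cases)
      case (1 \<eta>)
      show ?case
      proof (cases "\<eta> > 0")
        case True
        define k where "k = \<kappa> * (1 + t)"
        have k: "k > 0" using \<kappa> t by (simp add: k_def)
        have c': "c = 1 / k" by (simp add: c_def k_def)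
        have kc: "\<kappa> * (c * \<eta>) = \<eta> / (1 + t)" using \<kappa> t by (simp add: c_def)
        have e1: "1 + \<kappa> * (c * \<eta>) + \<kappa> * (c * \<eta>) * t = 1 + \<eta>"
        proof -
          have "1 + \<eta> / (1 + t) + \<eta> / (1 + t) * t = 1 + \<eta> / (1 + t) * (1 + t)"
            by (simp only: distrib_left mult_1_right add.assoc)
          thus ?thesis unfolding kc using t by simp
        qed
        have e2: "1 + c * \<eta> = (\<kappa> + \<eta> + \<kappa> * t) / k" using k by (simp add: c' k_def field_simps)
        have pos: "\<kappa> + \<eta> + \<kappa> * t > 0" using \<kappa> t True by (intro add_pos_pos mult_pos_pos) auto
        have e3: "(1 + c * \<eta>) powr (- (s - b)) = (\<kappa> + \<eta> + \<kappa> * t) powr (- (s - b)) * k powr (s - b)"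
          unfolding e2 using pos k by (simp add: powr_divide_pos)
        have e4: "(c * \<eta>) powr (A - 1) = k powr (- (A - 1)) * \<eta> powr (A - 1)"
          unfolding c' using k True powr_divide_pos[of \<eta> k "A - 1"] by (simp add: mult.commute)
        have e5: "(\<kappa> * (c * \<eta>)) powr (- (d + l)) = \<eta> powr (- (d + l)) * (1 + t) powr (d + l)"
          unfolding kc using t True powr_divide_pos[of \<eta> "1 + t" "- (d + l)"] by (simp add: add.commute)
        have e6: "k powr (- (A - 1)) * k powr (s - b) = k * (\<kappa> powr (b + m) * (1 + t) powr (b + m))"
        proof -
          have "k powr (- (A - 1)) * k powr (s - b) = k powr (1 + (b + m))"
            unfolding powr_add[symmetric] by (simp add: A_def)
          also have "\<dots> = k * k powr (b + m)" using k by (subst powr_add) simp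
          also have "k powr (b + m) = \<kappa> powr (b + m) * (1 + t) powr (b + m)"
            unfolding k_def using \<kappa> t by (intro powr_mult)
          finally show ?thesis .
        qed
        have e7: "(1 + t) powr (- (d + b + l + m)) * (1 + t) powr (d + l) * (1 + t) powr (b + m) = 1"
          unfolding powr_add[symmetric] using t by (simp add: algebra_simps)
        have e8: "\<eta> powr (A - 1) * \<eta> powr (- (d + l)) = \<eta> powr (A - d - l - 1)"
          unfolding powr_add[symmetric] by (simp add: algebra_simps)
        have "t powr (- l - 1) * (1 + t) powr (- (d + b + l + m)) * ((c * \<eta>) powr (A - 1) * (1 + c * \<eta>) powr (- (s - b))) *
            ((\<kappa> * (c * \<eta>)) powr (- (d + l)) * (1 + \<kappa> * (c * \<eta>) + \<kappa> * (c * \<eta>) * t) powr (- q) * Beta (d + l) q) =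
            (k powr (- (A - 1)) * k powr (s - b)) * ((1 + t) powr (- (d + b + l + m)) * (1 + t) powr (d + l)) *
            (\<eta> powr (A - 1) * \<eta> powr (- (d + l))) * (1 + \<eta>) powr (- q) *
            (t powr (- l - 1) * (\<kappa> + \<eta> + \<kappa> * t) powr (- (s - b))) * Beta (d + l) q"
          unfolding e1 e3 e4 e5 by (simp only: mult_ac)
        also have "\<dots> = k * \<kappa> powr (b + m) * ((1 + t) powr (- (d + b + l + m)) * (1 + t) powr (d + l) * (1 + t) powr (b + m)) *
            \<eta> powr (A - d - l - 1) * (1 + \<eta>) powr (- q) *
            (t powr (- l - 1) * (\<kappa> + \<eta> + \<kappa> * t) powr (- (s - b))) * Beta (d + l) q"
          unfolding e6 e8 by (simp only: mult_ac)
        also have "\<dots> = Beta (d + l) q * \<kappa> powr (b + m) / c * ((\<eta> powr (A - d - l - 1) * (1 + \<eta>) powr (- q)) *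
            (t powr (- l - 1) * (\<kappa> + \<eta> + \<kappa> * t) powr (- (s - b))))"
          unfolding e7 c' by (simp add: mult_ac)
        finally have "F (c * \<eta>) = ennreal (Beta (d + l) q * \<kappa> powr (b + m) / c * ((\<eta> powr (A - d - l - 1) * (1 + \<eta>) powr (- q)) *
            (t powr (- l - 1) * (\<kappa> + \<eta> + \<kappa> * t) powr (- (s - b)))))"
          unfolding F_def by (simp only:)
        also have "\<dots> = ennreal (Beta (d + l) q * \<kappa> powr (b + m) / c) * (g \<eta> * N \<eta> t)"
        proof -
          have "g \<eta> * N \<eta> t = ennreal (\<eta> powr (A - d - l - 1) * (1 + \<eta>) powr (- q)) *
              ennreal (t powr (- l - 1) * (\<kappa> + \<eta> + \<kappa> * t) powr (- (s - b)))"
            using True t by (simp add: g_def N_def)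
          also have "\<dots> = ennreal ((\<eta> powr (A - d - l - 1) * (1 + \<eta>) powr (- q)) *
              (t powr (- l - 1) * (\<kappa> + \<eta> + \<kappa> * t) powr (- (s - b))))"
            by (rule ennreal_mult'[symmetric]) simp
          finally have "g \<eta> * N \<eta> t = \<dots>" .
          moreover have "Beta (d + l) q * \<kappa> powr (b + m) / c \<ge> 0" using Bpos c by simp
          ultimately show ?thesis by (simp only: ennreal_mult')
        qed
        finally show ?thesis using True by simp
      qed (simp add: g_def)
    qed
    also have "\<dots> = ennreal (Beta (d + l) q * \<kappa> powr (b + m) / c) * (\<integral>\<^sup>+\<eta>. g \<eta> * N \<eta> t \<partial>lborel)"
      by (rule nn_integral_cmult) measurable
    also have "ennreal c * \<dots> = ennreal (Beta (d + l) q * \<kappa> powr (b + m)) * (\<integral>\<^sup>+\<eta>. g \<eta> * N \<eta> t \<partial>lborel)"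
      using c Bpos by (simp add: mult.assoc[symmetric] ennreal_mult[symmetric])
    finally show ?thesis .
  qed
  have Nt: "(\<integral>\<^sup>+t. g \<eta> * N \<eta> t \<partial>lborel) = ennreal (\<kappa> powr (b - s) * Beta (- l) (s - b + l)) *
      (ennreal (\<eta> powr (A - d - l - 1) * (1 + \<eta>) powr (- q) * (1 + 1 / \<kappa> * \<eta>) powr (- (s - b + l))) * indicator {0<..} \<eta>)" for \<eta>
  proof (cases "\<eta> > 0")
    case True
    have "(\<integral>\<^sup>+t. N \<eta> t \<partial>lborel) = (\<integral>\<^sup>+t. ennreal ((t - 0) powr (- l - 1) * ((\<kappa> + \<eta>) + \<kappa> * t) powr (- (- l + (s - b + l)))) * indicator {0<..} t \<partial>lborel)"
      by (simp add: N_def)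
    also have "\<dots> = ennreal (\<kappa> powr (- (- l)) * ((\<kappa> + \<eta>) + \<kappa> * 0) powr (- (s - b + l)) * Beta (- l) (s - b + l))"
      using \<kappa> True l sbl by (intro nn_integral_beta_linear) auto
    also have "((\<kappa> + \<eta>) + \<kappa> * 0) powr (- (s - b + l)) = \<kappa> powr (- (s - b + l)) * (1 + 1 / \<kappa> * \<eta>) powr (- (s - b + l))"
    proof -
      have "(\<kappa> + \<eta>) + \<kappa> * 0 = \<kappa> * (1 + 1 / \<kappa> * \<eta>)" using \<kappa> by (simp add: field_simps)
      moreover have "1 + 1 / \<kappa> * \<eta> > 0" using \<kappa> True by (simp add: add_pos_pos)
      ultimately show ?thesis using \<kappa> by (simp only: powr_mult)
    qed
    also have "\<kappa> powr (- (- l)) * (\<kappa> powr (- (s - b + l)) * (1 + 1 / \<kappa> * \<eta>) powr (- (s - b + l))) * Beta (- l) (s - b + l) =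
        \<kappa> powr (b - s) * Beta (- l) (s - b + l) * (1 + 1 / \<kappa> * \<eta>) powr (- (s - b + l))"
    proof -
      have "\<kappa> powr (- (- l)) * \<kappa> powr (- (s - b + l)) = \<kappa> powr (b - s)"
        unfolding powr_add[symmetric] by (simp add: algebra_simps)
      thus ?thesis by (simp add: mult_ac)
    qed
    finally have "(\<integral>\<^sup>+t. N \<eta> t \<partial>lborel) = ennreal (\<kappa> powr (b - s) * Beta (- l) (s - b + l) * (1 + 1 / \<kappa> * \<eta>) powr (- (s - b + l)))" .
    moreover have "(\<integral>\<^sup>+t. g \<eta> * N \<eta> t \<partial>lborel) = g \<eta> * (\<integral>\<^sup>+t. N \<eta> t \<partial>lborel)"
      by (rule nn_integral_cmult) measurable
    ultimately show ?thesis using True Bpos by (simp add: g_def ennreal_mult mult_ac)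
  qed (simp add: g_def)
  have "(\<integral>\<^sup>+u. (\<integral>\<^sup>+t. (\<integral>\<^sup>+\<tau>. f1 t * f2 \<tau> * M u t \<tau> \<partial>lborel) \<partial>lborel) \<partial>lborel) =
      (\<integral>\<^sup>+t. (\<integral>\<^sup>+u. (\<integral>\<^sup>+\<tau>. f1 t * f2 \<tau> * M u t \<tau> \<partial>lborel) \<partial>lborel) \<partial>lborel)"
    by (rule lborel_pair.Fubini'[symmetric]) measurable
  also have "\<dots> = (\<integral>\<^sup>+t. (\<integral>\<^sup>+\<tau>. (\<integral>\<^sup>+u. f1 t * f2 \<tau> * M u t \<tau> \<partial>lborel) \<partial>lborel) \<partial>lborel)"
    by (intro nn_integral_cong lborel_pair.Fubini'[symmetric]) measurable
  also have "\<dots> = ennreal (Beta (d + l) q * \<kappa> powr (b + m)) * (\<integral>\<^sup>+t. (\<integral>\<^sup>+\<eta>. g \<eta> * N \<eta> t \<partial>lborel) \<partial>lborel)"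
    unfolding tau by (rule nn_integral_cmult) measurable
  also have "(\<integral>\<^sup>+t. (\<integral>\<^sup>+\<eta>. g \<eta> * N \<eta> t \<partial>lborel) \<partial>lborel) = (\<integral>\<^sup>+\<eta>. (\<integral>\<^sup>+t. g \<eta> * N \<eta> t \<partial>lborel) \<partial>lborel)"
    by (rule lborel_pair.Fubini'[symmetric]) measurable
  also have "\<dots> = ennreal (\<kappa> powr (b - s) * Beta (- l) (s - b + l)) *
     (\<integral>\<^sup>+\<eta>. ennreal (\<eta> powr (A - d - l - 1) * (1 + \<eta>) powr (- q) * (1 + 1 / \<kappa> * \<eta>) powr (- (s - b + l))) * indicator {0<..} \<eta> \<partial>lborel)"
    unfolding Nt by (rule nn_integral_cmult) measurable
  also have "ennreal (Beta (d + l) q * \<kappa> powr (b + m)) * \<dots> =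
     ennreal (Beta (d + l) q * Beta (- l) (s - b + l) * (\<kappa> powr (b + m) * \<kappa> powr (b - s))) *
     (\<integral>\<^sup>+\<eta>. ennreal (\<eta> powr (A - d - l - 1) * (1 + \<eta>) powr (- q) * (1 + 1 / \<kappa> * \<eta>) powr (- (s - b + l))) * indicator {0<..} \<eta> \<partial>lborel)"
    using Bpos by (simp add: ennreal_mult mult_ac)
  finally show ?thesis unfolding pt[symmetric] powr_add[symmetric] by (simp add: A_def q_def algebra_simps)
qed

section \<open>The stripped integrand and its value for real parameters\<close>

definition laplace_base :: "complex \<Rightarrow> real \<Rightarrow> real \<Rightarrow> complex" where
  "laplace_base z w x =
     z + sqrt_sq_minus_1 z * of_real x * of_real w + (z - 1) * of_real (w\<^sup>2 - 1) / 2"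

text \<open>The integrand of the theorem stripped of its Gamma factors, with $\delta = \alpha - \beta$ and
  $s = \alpha + \beta + \gamma + 1$ as parameters in place of $\alpha$ and $\gamma$.\<close>

definition core_integrand ::
    "complex \<Rightarrow> complex \<Rightarrow> complex \<Rightarrow> complex \<Rightarrow> complex \<Rightarrow> complex \<Rightarrow> real \<Rightarrow> real \<Rightarrow> complex" where
  "core_integrand lam \<mu> \<beta> \<delta> s z w x =
     hyp_reg (- lam) (\<delta> + \<beta> + lam + \<mu>) \<delta> (of_real (1 - w\<^sup>2))
     * hyp_reg (- \<mu>) (2 * \<beta> + \<mu>) (\<beta> + 1/2) (of_real ((1 - x) / 2))
     * (of_real w powr (2 * \<beta> + \<mu> + 1) * of_real (w\<^sup>2 - 1) powr (\<delta> - 1)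
        * of_real (x\<^sup>2 - 1) powr (\<beta> - 1/2) / laplace_base z w x powr s)"

text \<open>Extended by 0 so that it can be integrated over the plane; for x \<le> -1, for instance,
  the argument of the second \<open>hyp_reg\<close> lies on the cut. The pair is ordered (w,
  x).\<close>

definition core_kernel ::
    "complex \<Rightarrow> complex \<Rightarrow> complex \<Rightarrow> complex \<Rightarrow> complex \<Rightarrow> complex \<Rightarrow> real \<times> real \<Rightarrow> complex" where
  "core_kernel lam \<mu> \<beta> \<delta> s z t =
     (if fst t > 1 \<and> snd t > 1 then core_integrand lam \<mu> \<beta> \<delta> s z (fst t) (snd t) else 0)"

text \<open>Up to factors free of z this is the left-hand side of the theorem. Here and in
  \<open>core_factor\<close> Gamma functions enter only through the entire function
  \<open>rGamma\<close>, so that the continuation meets no poles.\<close>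

definition core_rhs :: "complex \<Rightarrow> complex \<Rightarrow> complex \<Rightarrow> complex \<Rightarrow> complex \<Rightarrow> complex \<Rightarrow> complex" where
  "core_rhs lam \<mu> \<beta> \<delta> s z =
     2 powr s * rGamma (s - \<beta>) * rGamma s * (z - 1) powr (\<mu> / 2 - s + \<beta>) * (z + 1) powr (- \<beta> - \<mu> / 2)
     * hyp_reg (s - 2 * \<beta> - \<delta> - lam - \<mu>) (s - \<beta> + lam) (2 * s - 2 * \<beta> - \<delta>) (2 / (1 - z))"

definition core_factor :: "complex \<Rightarrow> complex \<Rightarrow> complex \<Rightarrow> complex \<Rightarrow> complex \<Rightarrow> complex" where
  "core_factor lam \<mu> \<beta> \<delta> s = 4 * of_real (sqrt pi) * rGamma (s - 2 * \<beta> - \<delta> - lam - \<mu>)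
     * rGamma (s + lam + \<mu>) * rGamma (s - \<beta> + lam) * rGamma (s - \<beta> - \<delta> - lam)"

lemma borel_measurable_hyp_reg_comp:
  assumes g: "continuous_on {1<..} g" "\<And>x. x > 1 \<Longrightarrow> g x < (1::real)"
  shows "(\<lambda>x::real. if x > 1 then hyp_reg a b c (of_real (g x)) else 0) \<in> borel_measurable borel"
proof -
  have "(\<lambda>x. indicator {1<..} x *\<^sub>R hyp_reg a b c (of_real (g x))) \<in> borel_measurable borel"
    by (intro borel_measurable_continuous_on_indicator
          continuous_on_compose2[OF holomorphic_on_imp_continuous_on[OF holomorphic_hyp_reg]] continuous_intros g)
       (use g in \<open>auto intro!: of_real_in_slit_plane\<close>)
  also have "(\<lambda>x. indicator {1<..} x *\<^sub>R hyp_reg a b c (of_real (g x))) =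
      (\<lambda>x. if x > 1 then hyp_reg a b c (of_real (g x)) else 0)"
    by (auto simp: indicator_def fun_eq_iff)
  finally show ?thesis .
qed

lemma borel_measurable_core_kernel [measurable]:
  "core_kernel lam \<mu> \<beta> \<delta> s z \<in> borel_measurable (lborel \<Otimes>\<^sub>M lborel)"
proof -
  define P where "P w = (if w > 1 then hyp_reg (- lam) (\<delta> + \<beta> + lam + \<mu>) \<delta> (of_real (1 - w\<^sup>2)) else 0)" for w :: real
  define C where "C x = (if x > 1 then hyp_reg (- \<mu>) (2 * \<beta> + \<mu>) (\<beta> + 1/2) (of_real ((1 - x) / 2)) else 0)" for x :: real
  have [measurable]: "P \<in> borel_measurable borel" "C \<in> borel_measurable borel"
    unfolding P_def C_def by (intro borel_measurable_hyp_reg_comp continuous_intros; simp)+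
  have "core_kernel lam \<mu> \<beta> \<delta> s z = (\<lambda>t. P (fst t) * C (snd t) *
      (of_real (fst t) powr (2 * \<beta> + \<mu> + 1) * of_real ((fst t)\<^sup>2 - 1) powr (\<delta> - 1)
        * of_real ((snd t)\<^sup>2 - 1) powr (\<beta> - 1/2) / laplace_base z (fst t) (snd t) powr s))"
    by (auto simp: fun_eq_iff core_kernel_def core_integrand_def P_def C_def)
  also have "\<dots> \<in> borel_measurable (lborel \<Otimes>\<^sub>M lborel)"
    unfolding laplace_base_def by measurable
  finally show ?thesis .
qed

text \<open>For z > 1 the root of z^2 - 1 is (z + 1) sqrt ((z - 1)/(z + 1)), which brings the base
  into the form 1 + 2 p x + p^2 known from the Gegenbauer generating function.\<close>

lemma laplace_base_real:
  fixes z w x :: real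
  assumes z: "z > 1" and w: "w > 1"
  defines "p \<equiv> sqrt ((z - 1) / (z + 1)) * w"
  shows "laplace_base (of_real z) w x = of_real ((z + 1) / 2 * (1 + 2 * p * x + p\<^sup>2))"
proof -
  have s: "sqrt_sq_minus_1 (of_real z) = of_real (sqrt (z - 1) * sqrt (z + 1))"
  proof -
    have "csqrt (of_real z - 1) = of_real (sqrt (z - 1))"
      using csqrt_of_real_nonneg[of "z - 1"] z by simp
    moreover have "csqrt (of_real z + 1) = of_real (sqrt (z + 1))"
      using csqrt_of_real_nonneg[of "z + 1"] z by simp
    ultimately show ?thesis by (simp add: sqrt_sq_minus_1_def)
  qed
  have p2: "p\<^sup>2 = (z - 1) / (z + 1) * w\<^sup>2" using z by (simp add: p_def power_mult_distrib)
  have "sqrt (z - 1) = sqrt ((z - 1) / (z + 1)) * sqrt (z + 1)"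
    unfolding real_sqrt_mult[symmetric] using z by simp
  hence "sqrt (z - 1) * sqrt (z + 1) = sqrt ((z - 1) / (z + 1)) * (sqrt (z + 1) * sqrt (z + 1))" by (simp only: mult.assoc)
  hence ps: "sqrt (z - 1) * sqrt (z + 1) * w = p * (z + 1)" using z by (simp add: p_def)
  have "z + sqrt (z - 1) * sqrt (z + 1) * x * w + (z - 1) * (w\<^sup>2 - 1) / 2 = (z + 1) / 2 * (1 + 2 * p * x + p\<^sup>2)"
  proof -
    have "(z + 1) / 2 * p\<^sup>2 = (z - 1) * w\<^sup>2 / 2" unfolding p2 using z by (simp add: divide_simps)
    moreover have "sqrt (z - 1) * sqrt (z + 1) * x * w = (z + 1) * p * x" using ps by (simp add: mult_ac)
    ultimately show ?thesis by (simp add: field_simps)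
  qed
  moreover have "laplace_base (of_real z) w x = of_real (z + sqrt (z - 1) * sqrt (z + 1) * x * w + (z - 1) * (w\<^sup>2 - 1) / 2)"
    unfolding laplace_base_def s by simp
  ultimately show ?thesis by (simp only:)
qed

text \<open>The conditions on l, d and b make the kernels of both special functions positive and
  integrable, with \<open>bm\<close> for the hyperbolic cosine. \<open>sb\<close>, \<open>q\<close>
  and \<open>sbl\<close> make the Beta integrals over x, u and t converge; \<open>g1\<close> and
  \<open>slm\<close> do the same for Euler's integral of the function in Q.\<close>

lemma core_identity_real:
  fixes l m b d s z :: real
  assumes b: "b > 0" and l: "l < 0" and dl: "d + l > 0" and bm: "b + m \<noteq> 0" and sb: "s > b"
    and q: "s - b - d - l > 0" and sbl: "s - b + l > 0" and g1: "s - 2 * b - d - l - m > 0"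
    and slm: "s + l + m > 0" and z: "z > 1"
  shows "core_factor (of_real l) (of_real m) (of_real b) (of_real d) (of_real s) *
      (\<integral>t. core_kernel (of_real l) (of_real m) (of_real b) (of_real d) (of_real s) (of_real z) t \<partial>(lborel \<Otimes>\<^sub>M lborel)) =
     core_rhs (of_real l) (of_real m) (of_real b) (of_real d) (of_real s) (of_real z)"
proof -
  define FP where "FP w = Re (hyp_reg (of_real (- l)) (of_real (d + b + l + m)) (of_real d) (of_real (1 - w\<^sup>2)))" for w :: real
  define FC where "FC x = Re (hyp_reg (of_real (- m)) (of_real (2 * b + m)) (of_real (b + 1/2)) (of_real ((1 - x) / 2)))" for x :: real
  define \<kappa> where "\<kappa> = (z - 1) / (z + 1)"
  have \<kappa>: "\<kappa> > 0" using z by (simp add: \<kappa>_def)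
  define p where "p w = sqrt \<kappa> * w" for w
  define k where "k w x = FP w * FC x * (w powr (2 * b + m + 1) * (w\<^sup>2 - 1) powr (d - 1) * (x\<^sup>2 - 1) powr (b - 1/2)
     * ((z + 1) / 2 * (1 + 2 * p w * x + (p w)\<^sup>2)) powr (- s))" for w x
  have w2: "w\<^sup>2 - 1 > 0" if "w > 1" for w :: real using that by (simp add: power2_eq_square less_1_mult)
  have FP: "hyp_reg (of_real (- l)) (of_real (d + b + l + m)) (of_real d) (of_real (1 - w\<^sup>2)) = of_real (FP w) \<and>
      FP w \<ge> 0 \<and> ennreal ((w\<^sup>2 - 1) powr (d - 1) * FP w) = ennreal (1 / (Gamma (- l) * Gamma (d + l))) *
      (\<integral>\<^sup>+t. ennreal (((w\<^sup>2 - 1) - t) powr (d + l - 1) * (t powr (- l - 1) * (1 + t) powr (- (d + b + l + m)))) * indicator {0<..<w\<^sup>2 - 1} t \<partial>lborel)"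
    if w: "w > 1" for w
  proof -
    have l': "0 < - l" "- l < d" using l dl by simp_all
    obtain h where h: "h \<ge> 0" "hyp_reg (of_real (d + b + l + m)) (of_real (- l)) (of_real d) (of_real (- (w\<^sup>2 - 1))) = of_real h"
      "ennreal ((w\<^sup>2 - 1) powr (d - 1) * h) = ennreal (1 / (Gamma (- l) * Gamma (d - (- l)))) *
      (\<integral>\<^sup>+t. ennreal (((w\<^sup>2 - 1) - t) powr (d - (- l) - 1) * (t powr (- l - 1) * (1 + t) powr (- (d + b + l + m)))) * indicator {0<..<w\<^sup>2 - 1} t \<partial>lborel)"
      using hyp_reg_real_fractional[OF l' w2[OF w], where a="d + b + l + m"] by blast
    have "hyp_reg (of_real (- l)) (of_real (d + b + l + m)) (of_real d) (of_real (1 - w\<^sup>2)) = of_real h"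
    proof (subst hyp_reg_commute)
      show "complex_of_real (1 - w\<^sup>2) \<in> slit_plane" using w w2[OF w] by (intro of_real_in_slit_plane) simp
      show "hyp_reg (of_real (d + b + l + m)) (of_real (- l)) (of_real d) (of_real (1 - w\<^sup>2)) = of_real h"
        using h(2) by (simp only: minus_diff_eq)
    qed
    moreover from this have "FP w = h" unfolding FP_def by (simp only: Re_complex_of_real)
    ultimately show ?thesis using h by simp
  qed
  have FC: "hyp_reg (of_real (- m)) (of_real (2 * b + m)) (of_real (b + 1/2)) (of_real ((1 - x) / 2)) = of_real (FC x) \<and> FC x \<ge> 0"
    if x: "x > 1" for x
  proof -
    obtain h where h: "h \<ge> 0" "hyp_reg (of_real (- m)) (of_real (2 * b + m)) (of_real (b + 1/2)) (of_real ((1 - x) / 2)) = of_real h"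
      using hyp_reg_gegenbauer_fractional[OF b bm x] by blast
    moreover from this have "FC x = h" unfolding FC_def by (simp only: Re_complex_of_real)
    ultimately show ?thesis by simp
  qed
  have Dpos: "1 + 2 * p w * x + (p w)\<^sup>2 > 0" if "w > 1" "x > 1" for w x
    using that \<kappa> by (intro add_pos_pos mult_pos_pos) (auto simp: p_def)
  have k: "core_integrand (of_real l) (of_real m) (of_real b) (of_real d) (of_real s) (of_real z) w x = of_real (k w x)"
    if w: "w > 1" and x: "x > 1" for w x
  proof -
    have D: "laplace_base (of_real z) w x = of_real ((z + 1) / 2 * (1 + 2 * p w * x + (p w)\<^sup>2))"
      unfolding p_def \<kappa>_def by (rule laplace_base_real[OF z w])
    have D0: "(z + 1) / 2 * (1 + 2 * p w * x + (p w)\<^sup>2) > 0" using Dpos[OF w x] z by (intro mult_pos_pos) auto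
    have e: "complex_of_real y powr of_real e = of_real (y powr e)" if "y > 0" for y e
      using that by (simp add: powr_of_real)
    have 1: "hyp_reg (- complex_of_real l) (of_real d + of_real b + of_real l + of_real m) (of_real d) (of_real (1 - w\<^sup>2)) = of_real (FP w)"
      using FP[OF w] by simp
    have 2: "hyp_reg (- complex_of_real m) (2 * of_real b + of_real m) (of_real b + 1/2) (of_real ((1 - x) / 2)) = of_real (FC x)"
      using FC[OF x] by simp
    have 3: "complex_of_real w powr (2 * of_real b + of_real m + 1) = of_real (w powr (2 * b + m + 1))"
      using e[of w "2 * b + m + 1"] w by simp
    have 4: "complex_of_real (w\<^sup>2 - 1) powr (of_real d - 1) = of_real ((w\<^sup>2 - 1) powr (d - 1))"
      using e[OF w2[OF w], of "d - 1"] by simp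
    have 5: "complex_of_real (x\<^sup>2 - 1) powr (of_real b - 1/2) = of_real ((x\<^sup>2 - 1) powr (b - 1/2))"
      using e[OF w2[OF x], of "b - 1/2"] by simp
    show ?thesis unfolding core_integrand_def 1 2 3 4 5 D e[OF D0] k_def powr_minus
      by (simp only: divide_inverse of_real_mult of_real_inverse)
  qed
  have k0: "k w x \<ge> 0" if "w > 1" "x > 1" for w x
  proof -
    have "FP w \<ge> 0" "FC x \<ge> 0" using FP[OF that(1)] FC[OF that(2)] by blast+
    thus ?thesis unfolding k_def by (intro mult_nonneg_nonneg) auto
  qed
  define ck where "ck t = (if fst t > 1 \<and> snd t > 1 then k (fst t) (snd t) else 0)" for t :: "real \<times> real"
  have ck: "core_kernel (of_real l) (of_real m) (of_real b) (of_real d) (of_real s) (of_real z) t = of_real (ck t)" for t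
    by (auto simp: core_kernel_def ck_def k)
  have ck0: "ck t \<ge> 0" for t by (auto simp: ck_def k0)
  have ckm[measurable]: "ck \<in> borel_measurable (lborel \<Otimes>\<^sub>M lborel)"
  proof -
    have "(\<lambda>t. Re (core_kernel (of_real l) (of_real m) (of_real b) (of_real d) (of_real s) (of_real z) t)) \<in> borel_measurable (lborel \<Otimes>\<^sub>M lborel)"
      by measurable
    thus ?thesis unfolding ck by simp
  qed
  \<comment> \<open>\<open>c1\<close> comes from the integral over x and \<open>c3\<close> from
    Euler's integral for the Jacobi factor; \<open>c4\<close> gathers \<open>c1\<close> and the
    powers free of w. The remaining powers of w combine to w itself, half the derivative of w^2 -
    1.\<close>
  define c1 where "c1 = Gamma (s - b) / (2 * sqrt pi * Gamma s)"
  define c3 where "c3 = 1 / (Gamma (- l) * Gamma (d + l))"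
  define c4 where "c4 = ((z + 1) / 2) powr (- s) * c1 * \<kappa> powr (- b - m / 2)"
  have s0: "s > 0" using b sb by simp
  have G: "Gamma (s - b) > 0" "Gamma s > 0" "Gamma (- l) > 0" "Gamma (d + l) > 0" "Gamma (s - b + l) > 0"
    "Gamma (s - b - d - l) > 0" "Gamma (s - 2 * b - d - l - m) > 0" "Gamma (s + l + m) > 0"
    using assms s0 by auto
  have c: "c1 > 0" "c3 > 0" "c4 > 0" using G z \<kappa> by (simp_all add: c1_def c3_def c4_def)
  define T where "T u = (\<integral>\<^sup>+\<tau>. ennreal (\<tau> powr (s - 2 * b - m - 1) * ((1 + \<tau>) * (1 + \<kappa> * (1 + u) * \<tau>)) powr (- (s - b))) * indicator {0<..} \<tau> \<partial>lborel)" for u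
  define L where "L u = (\<integral>\<^sup>+t. ennreal ((u - t) powr (d + l - 1) * (t powr (- l - 1) * (1 + t) powr (- (d + b + l + m)))) * indicator {0<..<u} t \<partial>lborel)" for u
  have Tm[measurable]: "T \<in> borel_measurable borel" unfolding T_def by measurable
  have Lm[measurable]: "L \<in> borel_measurable borel"
  proof -
    have L_eq: "L = (\<lambda>u. \<integral>\<^sup>+t. (if 0 < t \<and> t < u then ennreal ((u - t) powr (d + l - 1) * (t powr (- l - 1) * (1 + t) powr (- (d + b + l + m)))) else 0) \<partial>lborel)"
      unfolding L_def by (intro ext nn_integral_cong) (auto simp: indicator_def)
    show ?thesis unfolding L_eq by measurable
  qed
  have inner: "(\<integral>\<^sup>+x. ennreal (ck (w, x)) \<partial>lborel) =
      ennreal (c4 * c3 / 2) * (L (w\<^sup>2 - 1) * T (w\<^sup>2 - 1) * ennreal (2 * w) * indicator {1<..} w)" for w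
  proof (cases "w > 1")
    case w: True
    have pw: "p w > 0" using w \<kappa> by (simp add: p_def)
    have p2: "(p w)\<^sup>2 = \<kappa> * (1 + (w\<^sup>2 - 1))" using \<kappa> by (simp add: p_def power_mult_distrib)
    define K where "K = FP w * (w powr (2 * b + m + 1) * (w\<^sup>2 - 1) powr (d - 1)) * ((z + 1) / 2) powr (- s)"
    have K0: "K \<ge> 0" using FP[OF w] by (simp add: K_def)
    have "(\<integral>\<^sup>+x. ennreal (ck (w, x)) \<partial>lborel) = (\<integral>\<^sup>+x. ennreal K * (ennreal ((x\<^sup>2 - 1) powr (b - 1/2) * FC x * (1 + 2 * p w * x + (p w)\<^sup>2) powr (- s)) * indicator {1<..} x) \<partial>lborel)"
    proof (intro nn_integral_cong, goal_cases)
      case (1 x)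
      show ?case
      proof (cases "x > 1")
        case True
        have "k w x = K * ((x\<^sup>2 - 1) powr (b - 1/2) * FC x * (1 + 2 * p w * x + (p w)\<^sup>2) powr (- s))"
          unfolding k_def K_def powr_mult[of "(z + 1) / 2"] by (simp only: mult_ac)
        thus ?thesis using True w K0 by (simp add: ck_def ennreal_mult')
      qed (simp add: ck_def)
    qed
    also have "\<dots> = ennreal K * (\<integral>\<^sup>+x. ennreal ((x\<^sup>2 - 1) powr (b - 1/2) * FC x * (1 + 2 * p w * x + (p w)\<^sup>2) powr (- s)) * indicator {1<..} x \<partial>lborel)"
    proof (rule nn_integral_cmult)
      have [measurable]: "(\<lambda>x. if x > 1 then hyp_reg (of_real (- m)) (of_real (2 * b + m)) (of_real (b + 1/2)) (of_real ((1 - x) / 2)) else 0) \<in> borel_measurable borel"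
        by (intro borel_measurable_hyp_reg_comp continuous_intros) auto
      have "(\<lambda>x. ennreal ((x\<^sup>2 - 1) powr (b - 1/2) * Re (if x > 1 then hyp_reg (of_real (- m)) (of_real (2 * b + m)) (of_real (b + 1/2)) (of_real ((1 - x) / 2)) else 0) * (1 + 2 * p w * x + (p w)\<^sup>2) powr (- s)) * indicator {1<..} x) \<in> borel_measurable borel"
        by measurable
      also have "(\<lambda>x. ennreal ((x\<^sup>2 - 1) powr (b - 1/2) * Re (if x > 1 then hyp_reg (of_real (- m)) (of_real (2 * b + m)) (of_real (b + 1/2)) (of_real ((1 - x) / 2)) else 0) * (1 + 2 * p w * x + (p w)\<^sup>2) powr (- s)) * indicator {1<..} x) =
        (\<lambda>x. ennreal ((x\<^sup>2 - 1) powr (b - 1/2) * FC x * (1 + 2 * p w * x + (p w)\<^sup>2) powr (- s)) * indicator {1<..} x)"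
        unfolding FC_def by (auto simp: fun_eq_iff indicator_def)
      finally show "(\<lambda>x. ennreal ((x\<^sup>2 - 1) powr (b - 1/2) * FC x * (1 + 2 * p w * x + (p w)\<^sup>2) powr (- s)) * indicator {1<..} x) \<in> borel_measurable lborel"
        by simp
    qed
    also have "(\<integral>\<^sup>+x. ennreal ((x\<^sup>2 - 1) powr (b - 1/2) * FC x * (1 + 2 * p w * x + (p w)\<^sup>2) powr (- s)) * indicator {1<..} x \<partial>lborel) =
        ennreal (c1 * p w powr (- 2 * b - m)) * T (w\<^sup>2 - 1)"
      unfolding FC_def c1_def T_def p2[symmetric] by (rule nn_integral_gegenbauer[OF b bm sb pw])
    also have "ennreal K * (ennreal (c1 * p w powr (- 2 * b - m)) * T (w\<^sup>2 - 1)) =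
        ennreal (K * (c1 * p w powr (- 2 * b - m))) * T (w\<^sup>2 - 1)"
      unfolding ennreal_mult'[OF K0] by (simp only: mult.assoc)
    also have "K * (c1 * p w powr (- 2 * b - m)) = (c4 / 2 * (2 * w)) * ((w\<^sup>2 - 1) powr (d - 1) * FP w)"
    proof -
      have "p w powr (- 2 * b - m) = sqrt \<kappa> powr (- 2 * b - m) * w powr (- 2 * b - m)"
        unfolding p_def by (rule powr_mult)
      also have "sqrt \<kappa> powr (- 2 * b - m) = \<kappa> powr (- b - m / 2)"
      proof -
        have "sqrt \<kappa> = \<kappa> powr (1/2)" using \<kappa> by (simp add: powr_half_sqrt)
        thus ?thesis by (simp add: powr_powr field_simps)
      qed
      finally have e1: "p w powr (- 2 * b - m) = \<kappa> powr (- b - m / 2) * w powr (- 2 * b - m)" .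
      have "w powr (2 * b + m + 1) * w powr (- 2 * b - m) = w powr 1" unfolding powr_add[symmetric] by simp
      hence e2: "w powr (2 * b + m + 1) * w powr (- 2 * b - m) = w" using w by simp
      have "K * (c1 * p w powr (- 2 * b - m)) = (w powr (2 * b + m + 1) * w powr (- 2 * b - m)) * c4 * ((w\<^sup>2 - 1) powr (d - 1) * FP w)"
        unfolding K_def c4_def e1 by (simp only: mult_ac)
      thus ?thesis unfolding e2 by simp
    qed
    also have "ennreal ((c4 / 2 * (2 * w)) * ((w\<^sup>2 - 1) powr (d - 1) * FP w)) =
        ennreal (c4 / 2 * (2 * w)) * (ennreal c3 * L (w\<^sup>2 - 1))"
    proof -
      have "ennreal ((w\<^sup>2 - 1) powr (d - 1) * FP w) = ennreal c3 * L (w\<^sup>2 - 1)"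
        using FP[OF w] unfolding c3_def L_def by blast
      moreover have "c4 / 2 * (2 * w) \<ge> 0" using c w by simp
      ultimately show ?thesis by (simp only: ennreal_mult')
    qed
    also have "ennreal (c4 / 2 * (2 * w)) = ennreal (c4 / 2) * ennreal (2 * w)"
      using c by (intro ennreal_mult') simp
    also have "ennreal (c4 / 2) * ennreal (2 * w) * (ennreal c3 * L (w\<^sup>2 - 1)) * T (w\<^sup>2 - 1) =
        (ennreal (c4 / 2) * ennreal c3) * (L (w\<^sup>2 - 1) * T (w\<^sup>2 - 1) * ennreal (2 * w))"
      by (simp only: mult_ac)
    also have "ennreal (c4 / 2) * ennreal c3 = ennreal (c4 * c3 / 2)"
      using c by (simp add: ennreal_mult'[symmetric])
    finally show ?thesis using w by simp
  qed (simp add: ck_def)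
  \<comment> \<open>X = 1/\<kappa> is forced by the last factor of the remaining integral, and 1 -
    1/\<kappa> = 2/(1 - z) is the argument in Q.\<close>
  obtain E where E: "E \<ge> 0"
    "hyp_reg (of_real (s - b + l)) (of_real (s - 2 * b - d - l - m)) (of_real (2 * s - 2 * b - d)) (of_real (1 - 1 / \<kappa>)) =
      of_real (E / (Gamma (s - 2 * b - d - l - m) * Gamma ((2 * s - 2 * b - d) - (s - 2 * b - d - l - m))))"
    "(\<integral>\<^sup>+\<tau>. ennreal (\<tau> powr ((s - 2 * b - d - l - m) - 1) * (1 + \<tau>) powr ((s - b + l) - (2 * s - 2 * b - d)) * (1 + 1 / \<kappa> * \<tau>) powr (- (s - b + l))) * indicator {0<..} \<tau> \<partial>lborel) = ennreal E"
    by (rule hyp_reg_real_euler_halfline[of "s - 2 * b - d - l - m" "2 * s - 2 * b - d" "1 / \<kappa>" "s - b + l"])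
       (use g1 slm \<kappa> in auto)
  define B where "B = Beta (d + l) (s - b - d - l) * Beta (- l) (s - b + l) * \<kappa> powr (2 * b + m - s)"
  have B: "B \<ge> 0" using Beta_real_pos[of "d + l" "s - b - d - l"] Beta_real_pos[of "- l" "s - b + l"] dl q l sbl
    by (simp add: B_def)
  define V where "V = c4 * c3 / 2 * (B * E)"
  have V0: "V \<ge> 0" using c B E by (simp add: V_def)
  have "(\<integral>\<^sup>+t. ennreal (ck t) \<partial>(lborel \<Otimes>\<^sub>M lborel)) = (\<integral>\<^sup>+w. (\<integral>\<^sup>+x. ennreal (ck (w, x)) \<partial>lborel) \<partial>lborel)"
    by (rule lborel.nn_integral_fst[symmetric]) measurable
  also have "\<dots> = ennreal (c4 * c3 / 2) * (\<integral>\<^sup>+w. L (w\<^sup>2 - 1) * T (w\<^sup>2 - 1) * ennreal (2 * w) * indicator {1<..} w \<partial>lborel)"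
    unfolding inner by (rule nn_integral_cmult) measurable
  \<comment> \<open>The factor 2 w was split off to serve as the derivative in u = w^2 - 1.\<close>
  also have "(\<integral>\<^sup>+w. L (w\<^sup>2 - 1) * T (w\<^sup>2 - 1) * ennreal (2 * w) * indicator {1<..} w \<partial>lborel) =
      (\<integral>\<^sup>+u. L u * T u * indicator {0<..} u \<partial>lborel)"
  proof (rule nn_integral_substitution_greaterThan[where f="\<lambda>u. L u * T u", symmetric])
    show "(\<lambda>w::real. w\<^sup>2 - 1) ` {1<..} = {0<..}"
    proof (intro equalityI subsetI)
      fix u :: real assume "u \<in> {0<..}"
      thus "u \<in> (\<lambda>w. w\<^sup>2 - 1) ` {1<..}"
        by (intro image_eqI[of _ _ "sqrt (1 + u)"]) auto
    qed (use w2 in auto)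
  qed (auto intro!: derivative_eq_intros continuous_intros)
  also have "\<dots> = ennreal B * ennreal E"
  proof -
    have "(\<integral>\<^sup>+u. L u * T u * indicator {0<..} u \<partial>lborel) = ennreal B *
     (\<integral>\<^sup>+\<eta>. ennreal (\<eta> powr (s - 2 * b - m - d - l - 1) * (1 + \<eta>) powr (- (s - b - d - l)) * (1 + 1 / \<kappa> * \<eta>) powr (- (s - b + l)))
        * indicator {0<..} \<eta> \<partial>lborel)"
      unfolding L_def T_def B_def by (rule nn_integral_jacobi[OF l dl q sbl \<kappa>])
    also have "s - 2 * b - m - d - l - 1 = (s - 2 * b - d - l - m) - 1" by simp
    also have "- (s - b - d - l) = (s - b + l) - (2 * s - 2 * b - d)" by simp
    also note E(3)
    finally show ?thesis .
  qed
  also have "ennreal (c4 * c3 / 2) * (ennreal B * ennreal E) = ennreal V"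
  proof -
    have "c4 * c3 / 2 \<ge> 0" using c by simp
    thus ?thesis unfolding V_def using B by (simp only: ennreal_mult')
  qed
  finally have nnV: "(\<integral>\<^sup>+t. ennreal (ck t) \<partial>(lborel \<Otimes>\<^sub>M lborel)) = ennreal V" .
  hence "(\<integral>t. ck t \<partial>(lborel \<Otimes>\<^sub>M lborel)) = V"
    using nn_integral_eq_integrable[OF ckm _ V0] ck0 by auto
  hence K: "(\<integral>t. core_kernel (of_real l) (of_real m) (of_real b) (of_real d) (of_real s) (of_real z) t \<partial>(lborel \<Otimes>\<^sub>M lborel)) = of_real V"
    unfolding ck by simp
  have rG: "rGamma (complex_of_real y) = of_real (1 / Gamma y)" for y
    by (simp add: rGamma_inverse_Gamma Gamma_complex_of_real inverse_eq_divide)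
  have fac: "core_factor (of_real l) (of_real m) (of_real b) (of_real d) (of_real s) =
     of_real (4 * sqrt pi / Gamma (s - 2 * b - d - l - m) / Gamma (s + l + m) / Gamma (s - b + l) / Gamma (s - b - d - l))"
    using rG[of "s - 2 * b - d - l - m"] rG[of "s + l + m"] rG[of "s - b + l"] rG[of "s - b - d - l"]
    by (simp add: core_factor_def)
  have rhs: "core_rhs (of_real l) (of_real m) (of_real b) (of_real d) (of_real s) (of_real z) =
     of_real (2 powr s / Gamma (s - b) / Gamma s * (z - 1) powr (m / 2 - s + b) * (z + 1) powr (- b - m / 2)
       * (E / (Gamma (s - 2 * b - d - l - m) * Gamma (s + l + m))))"
  proof -
    have e: "complex_of_real y powr of_real e = of_real (y powr e)" if "y > 0" for y e
      using that by (simp add: powr_of_real)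
    have 1: "2 powr complex_of_real s = of_real (2 powr s)" using e[of 2 s] by simp
    have 2: "(complex_of_real z - 1) powr (of_real m / 2 - of_real s + of_real b) = of_real ((z - 1) powr (m / 2 - s + b))"
      using e[of "z - 1" "m / 2 - s + b"] z by simp
    have 3: "(complex_of_real z + 1) powr (- of_real b - of_real m / 2) = of_real ((z + 1) powr (- b - m / 2))"
      using e[of "z + 1" "- b - m / 2"] z by simp
    have 4: "rGamma (complex_of_real s - of_real b) = of_real (1 / Gamma (s - b))" using rG[of "s - b"] by simp
    have 5: "2 / (1 - complex_of_real z) = of_real (1 - 1 / \<kappa>)"
    proof -
      have "2 / (1 - z) = 1 - 1 / \<kappa>" using z by (simp add: \<kappa>_def field_simps)
      hence "complex_of_real (2 / (1 - z)) = of_real (1 - 1 / \<kappa>)" by (rule arg_cong)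
      thus ?thesis by simp
    qed
    have sl: "complex_of_real (1 - 1 / \<kappa>) \<in> slit_plane" using \<kappa> by (intro of_real_in_slit_plane) simp
    have 6: "hyp_reg (of_real s - 2 * of_real b - of_real d - of_real l - of_real m) (of_real s - of_real b + of_real l)
        (2 * of_real s - 2 * of_real b - of_real d) (of_real (1 - 1 / \<kappa>)) =
        of_real (E / (Gamma (s - 2 * b - d - l - m) * Gamma (s + l + m)))"
    proof -
      have "(2 * s - 2 * b - d) - (s - 2 * b - d - l - m) = s + l + m" by simp
      with E(2) have "hyp_reg (of_real (s - b + l)) (of_real (s - 2 * b - d - l - m)) (of_real (2 * s - 2 * b - d)) (of_real (1 - 1 / \<kappa>)) =
        of_real (E / (Gamma (s - 2 * b - d - l - m) * Gamma (s + l + m)))" by (simp only:)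
      thus ?thesis by (subst hyp_reg_commute[OF sl]) simp
    qed
    show ?thesis unfolding core_rhs_def 1 2 3 4 5 6 rG[of s] by simp
  qed
  have Bs: "Beta (d + l) (s - b - d - l) = Gamma (d + l) * Gamma (s - b - d - l) / Gamma (s - b)"
    "Beta (- l) (s - b + l) = Gamma (- l) * Gamma (s - b + l) / Gamma (s - b)"
    by (simp_all add: Beta_def)
  have pw: "((z + 1) / 2) powr (- s) * (\<kappa> powr (- b - m / 2) * \<kappa> powr (2 * b + m - s)) =
      2 powr s * (z - 1) powr (m / 2 - s + b) * (z + 1) powr (- b - m / 2)"
  proof -
    have "\<kappa> powr (- b - m / 2) * \<kappa> powr (2 * b + m - s) = \<kappa> powr (m / 2 - s + b)"
      unfolding powr_add[symmetric] by (simp add: algebra_simps)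
    also have "\<dots> = (z - 1) powr (m / 2 - s + b) * (z + 1) powr (- (m / 2 - s + b))"
      unfolding \<kappa>_def using z by (intro powr_divide_pos) auto
    finally have "((z + 1) / 2) powr (- s) * (\<kappa> powr (- b - m / 2) * \<kappa> powr (2 * b + m - s)) =
       ((z + 1) powr (- s) * 2 powr s) * ((z - 1) powr (m / 2 - s + b) * (z + 1) powr (- (m / 2 - s + b)))"
      using powr_divide_pos[of "z + 1" 2 "- s"] z by simp
    also have "\<dots> = 2 powr s * (z - 1) powr (m / 2 - s + b) * ((z + 1) powr (- s) * (z + 1) powr (- (m / 2 - s + b)))"
      by (simp only: mult_ac)
    also have "(z + 1) powr (- s) * (z + 1) powr (- (m / 2 - s + b)) = (z + 1) powr (- b - m / 2)"
      unfolding powr_add[symmetric] by (rule arg_cong[where f="\<lambda>e. (z + 1) powr e"]) simp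
    finally show ?thesis .
  qed
  have "4 * sqrt pi * V = (((z + 1) / 2) powr (- s) * (\<kappa> powr (- b - m / 2) * \<kappa> powr (2 * b + m - s)))
      * (Gamma (s - b - d - l) * Gamma (s - b + l) / (Gamma s * Gamma (s - b)) * E)"
    unfolding V_def c4_def c1_def c3_def B_def Bs using G by (simp add: field_simps)
  hence "4 * sqrt pi / Gamma (s - 2 * b - d - l - m) / Gamma (s + l + m) / Gamma (s - b + l) / Gamma (s - b - d - l) * V =
     2 powr s / Gamma (s - b) / Gamma s * (z - 1) powr (m / 2 - s + b) * (z + 1) powr (- b - m / 2)
       * (E / (Gamma (s - 2 * b - d - l - m) * Gamma (s + l + m)))"
    unfolding pw using G by (simp add: field_simps)
  thus ?thesis unfolding K fac rhs of_real_mult[symmetric] by (simp only:)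
qed

section \<open>Continuation in the parameters\<close>

definition cut_plane :: "complex set" where
  "cut_plane = - (complex_of_real ` {..1})"

lemma mem_cut_plane_iff: "z \<in> cut_plane \<longleftrightarrow> Im z \<noteq> 0 \<or> Re z > 1"
proof -
  have "z \<in> complex_of_real ` {..1} \<longleftrightarrow> Im z = 0 \<and> Re z \<le> 1"
    by (auto simp: complex_eq_iff image_iff intro!: bexI[of _ "Re z"])
  thus ?thesis by (auto simp: cut_plane_def)
qed

lemma open_cut_plane: "open cut_plane"
proof -
  have "open ({z. Im z \<noteq> 0} \<union> {z. Re z > 1})"
    by (intro open_Un open_Collect_neq open_Collect_less continuous_intros)
  also have "{z. Im z \<noteq> 0} \<union> {z. Re z > 1} = cut_plane" by (auto simp: mem_cut_plane_iff)
  finally show ?thesis .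
qed

lemma cut_plane_not_nonpos_Reals:
  assumes "z \<in> cut_plane"
  shows "z - 1 \<notin> \<real>\<^sub>\<le>\<^sub>0" "z + 1 \<notin> \<real>\<^sub>\<le>\<^sub>0"
  using assms by (auto simp: mem_cut_plane_iff complex_nonpos_Reals_iff)

lemma cut_plane_imp_slit_plane:
  assumes "z \<in> cut_plane"
  shows "2 / (1 - z) \<in> slit_plane"
proof -
  have "2 / (1 - z) \<notin> complex_of_real ` {1..}"
  proof
    assume "2 / (1 - z) \<in> complex_of_real ` {1..}"
    then obtain r where r: "r \<ge> 1" "2 / (1 - z) = of_real r" by auto
    have "1 - z \<noteq> 0" using assms by (auto simp: mem_cut_plane_iff)
    hence "1 - z = 2 / of_real r" using r by (auto simp: field_simps)
    hence "z = of_real (1 - 2 / r)" by (simp add: algebra_simps)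
    thus False using assms r by (simp add: mem_cut_plane_iff)
  qed
  thus ?thesis by (simp add: slit_plane_def)
qed

lemma csqrt_Re_pos:
  assumes "z \<notin> \<real>\<^sub>\<le>\<^sub>0"
  shows "Re (csqrt z) > 0"
proof (rule ccontr)
  assume neg: "\<not> ?thesis"
  define y where "y = csqrt z"
  have "Re y = 0" using neg csqrt_principal[of z] unfolding y_def by linarith
  have y2: "y\<^sup>2 = z" unfolding y_def by (rule power2_csqrt)
  have "Re z = (Re y)\<^sup>2 - (Im y)\<^sup>2" "Im z = 2 * Re y * Im y"
    unfolding y2[symmetric] by (rule Re_power2 Im_power2)+
  thus False using assms \<open>Re y = 0\<close> by (simp add: complex_nonpos_Reals_iff)
qed

lemma csqrt_Im: "2 * Re (csqrt z) * Im (csqrt z) = Im z"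
  by (metis Im_power2 power2_csqrt)

lemma laplace_base_eq:
  "laplace_base z w x = (csqrt (z + 1))\<^sup>2 / 2 + csqrt (z + 1) * csqrt (z - 1) * of_real (x * w)
     + (csqrt (z - 1))\<^sup>2 * of_real (w\<^sup>2) / 2"
  by (simp add: laplace_base_def sqrt_sq_minus_1_def field_simps)

text \<open>Both roots lie in the open right half-plane, and their imaginary parts have the sign of
  Im z. Hence their arguments differ by less than pi/2.\<close>

lemma csqrt_ratio_Re_pos:
  assumes "z \<in> cut_plane"
  shows "Re (csqrt (z + 1) / csqrt (z - 1)) > 0" "Re (csqrt (z - 1) / csqrt (z + 1)) > 0"
proof -
  define A B where "A = csqrt (z + 1)" and "B = csqrt (z - 1)"
  have "Re A > 0" "Re B > 0"
    unfolding A_def B_def by (rule csqrt_Re_pos cut_plane_not_nonpos_Reals[OF assms])+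
  moreover have "2 * Re A * Im A = Im (z + 1)" "2 * Re B * Im B = Im (z - 1)"
    unfolding A_def B_def by (rule csqrt_Im)+
  ultimately have A: "Re A > 0" "2 * Re A * Im A = Im z" and B: "Re B > 0" "2 * Re B * Im B = Im z"
    by simp_all
  have "Im A * Im B \<ge> 0"
  proof -
    have "4 * (Re A * Re B) * (Im A * Im B) = (2 * Re A * Im A) * (2 * Re B * Im B)" by simp
    also have "\<dots> = (Im z)\<^sup>2" unfolding A(2) B(2) power2_eq_square ..
    finally have "4 * (Re A * Re B) * (Im A * Im B) = (Im z)\<^sup>2" .
    hence "4 * (Re A * Re B) * (Im A * Im B) \<ge> 0" by simp
    moreover have "4 * (Re A * Re B) > 0" using A B by simp
    ultimately show ?thesis by (metis zero_le_mult_iff not_le)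
  qed
  hence p: "Re A * Re B + Im A * Im B > 0" using A B by (simp add: add_pos_nonneg)
  have n: "(Re A)\<^sup>2 + (Im A)\<^sup>2 > 0" "(Re B)\<^sup>2 + (Im B)\<^sup>2 > 0" using A B by (simp_all add: add_pos_nonneg)
  show "Re (csqrt (z + 1) / csqrt (z - 1)) > 0" "Re (csqrt (z - 1) / csqrt (z + 1)) > 0"
    using p n unfolding A_def[symmetric] B_def[symmetric]
    by (simp_all add: Re_divide mult.commute)
qed

text \<open>With A = csqrt (z + 1) and B = csqrt (z - 1) the base is A B (A / (2 B) + x w + w^2 B /
  (2 A)), and both ratios have positive real part. The bound grows in x and w together, so a single
  exponent s controls the decay in both.\<close>

lemma laplace_base_lower:
  assumes "z \<in> cut_plane" "w \<ge> 0" "x \<ge> 0"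
  shows "norm (sqrt_sq_minus_1 z) * (x * w) \<le> norm (laplace_base z w x)"
proof -
  define A B where "A = csqrt (z + 1)" and "B = csqrt (z - 1)"
  have nz: "A \<noteq> 0" "B \<noteq> 0"
    using csqrt_Re_pos cut_plane_not_nonpos_Reals[OF assms(1)] unfolding A_def B_def by force+
  define q where "q = of_real (1/2) * (A / B) + of_real (x * w) + of_real (w\<^sup>2 / 2) * (B / A)"
  have eq: "laplace_base z w x = A * B * q"
    unfolding laplace_base_eq A_def[symmetric] B_def[symmetric] q_def using nz
    by (simp add: field_simps power2_eq_square)
  have "Re (A / B) > 0" "Re (B / A) > 0"
    using csqrt_ratio_Re_pos[OF assms(1)] by (simp_all add: A_def B_def)
  moreover have "Re q = 1/2 * Re (A / B) + x * w + w\<^sup>2 / 2 * Re (B / A)"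
  proof -
    have "Re (of_real r * y) = r * Re y" for r y by simp
    thus ?thesis unfolding q_def by (simp only: plus_complex.sel Re_complex_of_real)
  qed
  ultimately have "x * w \<le> Re q" by simp
  also have "\<dots> \<le> norm q" by (rule complex_Re_le_cmod)
  finally have "norm (A * B) * (x * w) \<le> norm (A * B) * norm q" by (intro mult_left_mono) auto
  thus ?thesis unfolding eq by (simp add: norm_mult sqrt_sq_minus_1_def A_def B_def mult_ac)
qed

lemma sqrt_sq_minus_1_nonzero: "z \<in> cut_plane \<Longrightarrow> sqrt_sq_minus_1 z \<noteq> 0"
  by (auto simp: sqrt_sq_minus_1_def mem_cut_plane_iff add_eq_0_iff2)

text \<open>Every summand of the imaginary part has the sign of Im z; when Im z = 0 one has z > 1
  and every summand of the real part is positive.\<close>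

lemma laplace_base_not_nonpos_Reals:
  assumes z: "z \<in> cut_plane" and w: "w > 0" and x: "x > 0"
  shows "laplace_base z w x \<notin> \<real>\<^sub>\<le>\<^sub>0"
proof -
  define A B where "A = csqrt (z + 1)" and "B = csqrt (z - 1)"
  have "Re A > 0" "Re B > 0"
    unfolding A_def B_def by (rule csqrt_Re_pos cut_plane_not_nonpos_Reals[OF z])+
  moreover have "2 * Re A * Im A = Im (z + 1)" "2 * Re B * Im B = Im (z - 1)"
    unfolding A_def B_def by (rule csqrt_Im)+
  ultimately have A: "Re A > 0" "2 * Re A * Im A = Im z" and B: "Re B > 0" "2 * Re B * Im B = Im z"
    by simp_all
  have AB2: "A\<^sup>2 = z + 1" "B\<^sup>2 = z - 1" unfolding A_def B_def by (rule power2_csqrt)+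
  have ImD: "Im (laplace_base z w x) = Im z / 2 + (Re A * Im B + Im A * Re B) * (x * w) + Im z * w\<^sup>2 / 2"
    unfolding laplace_base_eq A_def[symmetric] B_def[symmetric] AB2 by simp
  have ReD: "Re (laplace_base z w x) = Re (A\<^sup>2) / 2 + (Re A * Re B - Im A * Im B) * (x * w) + Re (B\<^sup>2) * w\<^sup>2 / 2"
    unfolding laplace_base_eq A_def[symmetric] B_def[symmetric] by simp
  consider "Im z > 0" | "Im z < 0" | "Im z = 0" "Re z > 1" using z unfolding mem_cut_plane_iff by linarith
  thus ?thesis
  proof cases
    case 1
    hence "Im A > 0" "Im B > 0" using A B by (metis mult_pos_pos zero_less_mult_pos zero_less_numeral)+
    hence "Im (laplace_base z w x) > 0" unfolding ImD using A B w x 1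
      by (intro add_pos_pos mult_pos_pos) (auto intro!: add_pos_pos mult_pos_pos)
    thus ?thesis by (auto simp: complex_nonpos_Reals_iff)
  next
    case 2
    have "2 * Re A * (- Im A) > 0" "2 * Re B * (- Im B) > 0" using A(2) B(2) 2 by simp_all
    hence n: "- Im A > 0" "- Im B > 0" using A(1) B(1) by (metis mult_pos_pos zero_less_mult_pos zero_less_numeral)+
    have "- Im (laplace_base z w x) = (- Im z) / 2 + (Re A * (- Im B) + (- Im A) * Re B) * (x * w) + (- Im z) * w\<^sup>2 / 2"
      unfolding ImD by (simp add: field_simps)
    also have "\<dots> > 0"
    proof (intro add_pos_pos)
      show "(Re A * (- Im B) + (- Im A) * Re B) * (x * w) > 0"
        using A(1) B(1) n w x by (intro mult_pos_pos add_pos_pos)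
      have "(- Im z) * w\<^sup>2 > 0" using 2 w by (intro mult_pos_pos) auto
      thus "(- Im z) * w\<^sup>2 / 2 > 0" by linarith
    qed (use 2 in simp)
    finally show ?thesis by (auto simp: complex_nonpos_Reals_iff)
  next
    case 3
    hence "Im A = 0" "Im B = 0" using A B by auto
    hence "Re (laplace_base z w x) > 0" unfolding ReD using A B w x
      by (simp add: add_pos_pos)
    thus ?thesis by (auto simp: complex_nonpos_Reals_iff)
  qed
qed

section \<open>Domination at the edges and at infinity\<close>

lemma norm_of_real_powr: "x > 0 \<Longrightarrow> norm (complex_of_real x powr e) = x powr Re e"
  by (simp add: norm_powr_real_powr)

text \<open>One bound for a whole range of exponents: the lowest exponent governs small v, the
  highest one governs large v.\<close>

lemma powr_le_endpoint_bound:
  fixes v e \<epsilon> R :: real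
  assumes "v > 0" "\<epsilon> - 1 \<le> e" "e \<le> R"
  shows "v powr e \<le> v powr (\<epsilon> - 1) * (1 + v) powr (R + 1 - \<epsilon>)"
proof -
  have "v powr e = v powr (\<epsilon> - 1) * v powr (e - (\<epsilon> - 1))" using assms by (simp add: powr_add[symmetric])
  also have "v powr (e - (\<epsilon> - 1)) \<le> (1 + v) powr (e - (\<epsilon> - 1))" using assms by (intro powr_mono2) auto
  also have "\<dots> \<le> (1 + v) powr (R + 1 - \<epsilon>)" using assms by (intro powr_mono) auto
  finally show ?thesis by (simp add: mult_left_mono)
qed

lemma square_endpoint_bound:
  fixes w e \<epsilon> R :: real
  assumes w: "w > 1" and e: "\<epsilon> - 1 \<le> e" "e \<le> R" and \<epsilon>: "0 < \<epsilon>" "\<epsilon> \<le> 1"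
  shows "(w\<^sup>2 - 1) powr e \<le> (w - 1) powr (\<epsilon> - 1) * w powr (2 * R + 2)"
proof -
  have w2: "w\<^sup>2 - 1 \<ge> w - 1" using w by (simp add: power2_eq_square)
  have R: "R + 1 - \<epsilon> \<ge> 0" using e by linarith
  have "(w\<^sup>2 - 1) powr e \<le> (w\<^sup>2 - 1) powr (\<epsilon> - 1) * (1 + (w\<^sup>2 - 1)) powr (R + 1 - \<epsilon>)"
    using w w2 e by (intro powr_le_endpoint_bound) auto
  also have "\<dots> \<le> (w - 1) powr (\<epsilon> - 1) * w powr (2 * R + 2)"
  proof (intro mult_mono)
    show "(w\<^sup>2 - 1) powr (\<epsilon> - 1) \<le> (w - 1) powr (\<epsilon> - 1)"
      using w w2 \<epsilon> by (intro powr_mono2') auto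
    have "(1 + (w\<^sup>2 - 1)) powr (R + 1 - \<epsilon>) = w powr (2 * (R + 1 - \<epsilon>))"
    proof -
      have "1 + (w\<^sup>2 - 1) = w powr 2" using w by simp
      thus ?thesis by (simp only: powr_powr)
    qed
    also have "\<dots> \<le> w powr (2 * R + 2)" using w \<epsilon> by (intro powr_mono) auto
    finally show "(1 + (w\<^sup>2 - 1)) powr (R + 1 - \<epsilon>) \<le> w powr (2 * R + 2)" .
  qed auto
  finally show ?thesis .
qed

text \<open>An integrable majorant in one variable: an edge singularity of exponent \<epsilon> - 1
  and decay w^(\<epsilon> - 3) at infinity.\<close>

definition edge_weight :: "real \<Rightarrow> real \<Rightarrow> real" where
  "edge_weight \<epsilon> w = (if w > 1 then (w - 1) powr (\<epsilon> - 1) * w powr (- 2) else 0)"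

lemma edge_weight_nonneg: "edge_weight \<epsilon> w \<ge> 0"
  by (simp add: edge_weight_def)

lemma borel_measurable_edge_weight [measurable]: "edge_weight \<epsilon> \<in> borel_measurable borel"
  unfolding edge_weight_def by measurable

lemma nn_integral_edge_weight:
  assumes "0 < \<epsilon>" "\<epsilon> \<le> 1"
  shows "(\<integral>\<^sup>+w. ennreal (edge_weight \<epsilon> w) \<partial>lborel) = ennreal (Beta \<epsilon> (2 - \<epsilon>))"
proof -
  have "(\<integral>\<^sup>+w. ennreal (edge_weight \<epsilon> w) \<partial>lborel) =
     (\<integral>\<^sup>+u. ennreal ((u - 1) powr (\<epsilon> - 1) * (0 + 1 * u) powr (- (\<epsilon> + (2 - \<epsilon>)))) * indicator {1<..} u \<partial>lborel)"
    by (intro nn_integral_cong) (auto simp: edge_weight_def)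
  also have "\<dots> = ennreal (1 powr (- \<epsilon>) * (0 + 1 * 1) powr (- (2 - \<epsilon>)) * Beta \<epsilon> (2 - \<epsilon>))"
    using assms by (intro nn_integral_beta_linear) auto
  finally show ?thesis by simp
qed

lemma integrable_edge_weight_prod:
  assumes "0 < \<epsilon>" "\<epsilon> \<le> 1"
  shows "integrable (lborel \<Otimes>\<^sub>M lborel) (\<lambda>t. K * (edge_weight \<epsilon> (fst t) * edge_weight \<epsilon> (snd t)))"
proof -
  have "(\<integral>\<^sup>+t. ennreal (edge_weight \<epsilon> (fst t) * edge_weight \<epsilon> (snd t)) \<partial>(lborel \<Otimes>\<^sub>M lborel)) =
      (\<integral>\<^sup>+w. (\<integral>\<^sup>+x. ennreal (edge_weight \<epsilon> w) * ennreal (edge_weight \<epsilon> x) \<partial>lborel) \<partial>lborel)"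
    by (subst lborel.nn_integral_fst[symmetric]) (auto simp: ennreal_mult edge_weight_nonneg)
  also have "\<dots> = ennreal (Beta \<epsilon> (2 - \<epsilon>)) * ennreal (Beta \<epsilon> (2 - \<epsilon>))"
    by (subst nn_integral_cmult, measurable, subst nn_integral_multc, measurable)
       (simp add: nn_integral_edge_weight[OF assms])
  also have "\<dots> < \<infinity>" by (simp add: ennreal_mult_less_top)
  finally have "(\<integral>\<^sup>+t. ennreal (edge_weight \<epsilon> (fst t) * edge_weight \<epsilon> (snd t)) \<partial>(lborel \<Otimes>\<^sub>M lborel)) < \<infinity>" .
  hence "integrable (lborel \<Otimes>\<^sub>M lborel) (\<lambda>t. edge_weight \<epsilon> (fst t) * edge_weight \<epsilon> (snd t))"
    by (intro integrableI_bounded) (auto simp: edge_weight_nonneg abs_mult)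
  thus ?thesis by (rule integrable_mult_right)
qed

text \<open>A path from the real parameter $c$ at $0$ to the given parameter $p$ at $i$.  Its coefficients are
  real, so it takes real values on the real axis, where the identity is known; on the segment from $0$
  to $i$ its real part is a convex combination of $c$ and the real part of $p$, so half-plane
  constraints persist.\<close>

definition real_path :: "real \<Rightarrow> complex \<Rightarrow> complex \<Rightarrow> complex" where
  "real_path c p \<zeta> = of_real c + \<zeta> * of_real (Im p) - \<zeta>\<^sup>2 * of_real (Re p - c)"

lemma real_path_0 [simp]: "real_path c p 0 = of_real c"
  by (simp add: real_path_def)

lemma real_path_ii [simp]: "real_path c p \<i> = p"
  by (simp add: real_path_def complex_eq_iff)

lemma real_path_of_real: "real_path c p (of_real x) = of_real (c + x * Im p - x\<^sup>2 * (Re p - c))"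
  by (simp add: real_path_def)

lemma real_path_imag:
  "Re (real_path c p (of_real t * \<i>)) = (1 - t\<^sup>2) * c + t\<^sup>2 * Re p"
  "Im (real_path c p (of_real t * \<i>)) = t * Im p"
  by (simp_all add: real_path_def power_mult_distrib algebra_simps power2_eq_square)

lemma holomorphic_real_path [holomorphic_intros]: "real_path c p holomorphic_on A"
  unfolding real_path_def by (intro holomorphic_intros)

section \<open>Continuation in the parameters other than s\<close>

lemma holomorphic_laplace_base:
  assumes "Z holomorphic_on W" "\<And>\<zeta>. \<zeta> \<in> W \<Longrightarrow> Z \<zeta> \<in> cut_plane"
  shows "(\<lambda>\<zeta>. laplace_base (Z \<zeta>) w x) holomorphic_on W"
  unfolding laplace_base_def sqrt_sq_minus_1_def
  by (intro holomorphic_intros assms cut_plane_not_nonpos_Reals) auto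

lemma holomorphic_core_kernel:
  assumes "open W" "L holomorphic_on W" "M holomorphic_on W" "B holomorphic_on W" "D holomorphic_on W"
    "S holomorphic_on W" "Z holomorphic_on W" "\<And>\<zeta>. \<zeta> \<in> W \<Longrightarrow> Z \<zeta> \<in> cut_plane"
  shows "(\<lambda>\<zeta>. core_kernel (L \<zeta>) (M \<zeta>) (B \<zeta>) (D \<zeta>) (S \<zeta>) (Z \<zeta>) t) holomorphic_on W"
proof (cases "fst t > 1 \<and> snd t > 1")
  case True
  have 1: "(fst t)\<^sup>2 > 1" using True by (simp add: power2_eq_square less_1_mult)
  have 2: "(\<lambda>\<zeta>. laplace_base (Z \<zeta>) (fst t) (snd t)) holomorphic_on W"
    by (intro holomorphic_laplace_base assms)
  have 3: "laplace_base (Z \<zeta>) (fst t) (snd t) \<notin> \<real>\<^sub>\<le>\<^sub>0" if "\<zeta> \<in> W" for \<zeta>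
    using True assms(8)[OF that] by (intro laplace_base_not_nonpos_Reals) auto
  have 4: "laplace_base (Z \<zeta>) (fst t) (snd t) \<noteq> 0" if "\<zeta> \<in> W" for \<zeta>
    using 3[OF that] by auto
  have "(\<lambda>\<zeta>. core_integrand (L \<zeta>) (M \<zeta>) (B \<zeta>) (D \<zeta>) (S \<zeta>) (Z \<zeta>) (fst t) (snd t)) holomorphic_on W"
    unfolding core_integrand_def
    by (intro holomorphic_on_mult holomorphic_on_divide holomorphic_hyp_reg_params holomorphic_on_powr_right
          holomorphic_on_powr holomorphic_on_add holomorphic_on_diff holomorphic_on_minus holomorphic_on_const
          assms 2 3)
       (use True 1 4 in \<open>auto intro!: of_real_in_slit_plane simp del: of_real_diff of_real_divide\<close>)
  thus ?thesis using True by (simp add: core_kernel_def)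
qed (auto simp: core_kernel_def)

lemma holomorphic_core_rhs:
  assumes "open W" "L holomorphic_on W" "M holomorphic_on W" "B holomorphic_on W" "D holomorphic_on W"
    "S holomorphic_on W" "Z holomorphic_on W" "\<And>\<zeta>. \<zeta> \<in> W \<Longrightarrow> Z \<zeta> \<in> cut_plane"
  shows "(\<lambda>\<zeta>. core_rhs (L \<zeta>) (M \<zeta>) (B \<zeta>) (D \<zeta>) (S \<zeta>) (Z \<zeta>)) holomorphic_on W"
proof -
  have "1 - Z \<zeta> \<noteq> 0" if "\<zeta> \<in> W" for \<zeta> using assms(8)[OF that] by (auto simp: mem_cut_plane_iff)
  thus ?thesis unfolding core_rhs_def
    by (intro holomorphic_intros holomorphic_hyp_reg_params assms cut_plane_not_nonpos_Reals cut_plane_imp_slit_plane) auto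
qed

lemma holomorphic_core_factor:
  assumes "L holomorphic_on W" "M holomorphic_on W" "B holomorphic_on W" "D holomorphic_on W" "S holomorphic_on W"
  shows "(\<lambda>\<zeta>. core_factor (L \<zeta>) (M \<zeta>) (B \<zeta>) (D \<zeta>) (S \<zeta>)) holomorphic_on W"
  unfolding core_factor_def by (intro holomorphic_intros assms)

text \<open>The threshold for s counts powers: away from the edge singularities w has total exponent
  2 N1 + 3 R + 2 - s and x has N2 + 2 R + 2 - s, and both must be at most -2.\<close>

lemma norm_core_kernel_bound:
  fixes s :: real
  assumes w: "w > 1" and x: "x > 1" and z: "z \<in> cut_plane"
    and P: "norm (hyp_reg (- lam) (\<delta> + \<beta> + lam + \<mu>) \<delta> (of_real (1 - w\<^sup>2))) \<le> K1 * (w\<^sup>2) ^ N1"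
    and C: "norm (hyp_reg (- \<mu>) (2 * \<beta> + \<mu>) (\<beta> + 1/2) (of_real ((1 - x) / 2))) \<le> K2 * x ^ N2"
    and K: "K1 \<ge> 0" "K2 \<ge> 0"
    and R: "norm (2 * \<beta> + \<mu> + 1) \<le> R" "norm (\<delta> - 1) \<le> R" "norm (\<beta> - 1/2) \<le> R"
    and \<epsilon>: "0 < \<epsilon>" "\<epsilon> \<le> 1" "\<epsilon> \<le> Re \<delta>" "\<epsilon> \<le> Re \<beta> + 1/2"
    and \<eta>: "\<eta> > 0" "\<eta> \<le> norm (sqrt_sq_minus_1 z)"
    and s: "s \<ge> 2 * real N1 + real N2 + 3 * R + 4"
  shows "norm (core_integrand lam \<mu> \<beta> \<delta> (of_real s) z w x) \<le>
    K1 * K2 * \<eta> powr (- s) * (edge_weight \<epsilon> w * edge_weight \<epsilon> x)"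
proof -
  have w2: "w\<^sup>2 - 1 > 0" "x\<^sup>2 - 1 > 0" using w x by (simp_all add: power2_eq_square less_1_mult)
  have R0: "R \<ge> 0" using R(1) norm_ge_zero order_trans by blast
  have s0: "s > 0" using s R0 by (smt (verit) of_nat_0_le_iff)
  have n3: "norm (complex_of_real w powr (2 * \<beta> + \<mu> + 1)) \<le> w powr R"
    using w R(1) abs_Re_le_cmod[of "2 * \<beta> + \<mu> + 1"] by (subst norm_of_real_powr) (auto intro!: powr_mono)
  have n4: "norm (complex_of_real (w\<^sup>2 - 1) powr (\<delta> - 1)) \<le> (w - 1) powr (\<epsilon> - 1) * w powr (2 * R + 2)"
    using w w2 R(2) \<epsilon> abs_Re_le_cmod[of "\<delta> - 1"]
    by (subst norm_of_real_powr) (auto intro!: square_endpoint_bound)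
  have n5: "norm (complex_of_real (x\<^sup>2 - 1) powr (\<beta> - 1/2)) \<le> (x - 1) powr (\<epsilon> - 1) * x powr (2 * R + 2)"
    using x w2 R(3) \<epsilon> abs_Re_le_cmod[of "\<beta> - 1/2"]
    by (subst norm_of_real_powr) (auto intro!: square_endpoint_bound)
  have "\<eta> * (x * w) \<le> norm (sqrt_sq_minus_1 z) * (x * w)" using \<eta> w x by (intro mult_right_mono) auto
  also have "\<dots> \<le> norm (laplace_base z w x)" using w x by (intro laplace_base_lower z) auto
  finally have low: "\<eta> * (x * w) \<le> norm (laplace_base z w x)" .
  have pos: "\<eta> * (x * w) > 0" using \<eta> w x by simp
  \<comment> \<open>Because s is real, the modulus of the power is the power of the modulus; the
    argument of the base contributes no exponential factor.\<close>
  have "inverse (norm (laplace_base z w x powr of_real s)) = norm (laplace_base z w x) powr (- s)"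
    by (simp add: norm_powr_real_powr' powr_minus)
  also have "\<dots> \<le> (\<eta> * (x * w)) powr (- s)" using low pos s0 by (intro powr_mono2') auto
  also have "\<dots> = \<eta> powr (- s) * x powr (- s) * w powr (- s)" by (simp only: powr_mult mult.assoc)
  finally have n6: "inverse (norm (laplace_base z w x powr of_real s)) \<le> \<eta> powr (- s) * x powr (- s) * w powr (- s)" .
  have "norm (core_integrand lam \<mu> \<beta> \<delta> (of_real s) z w x) =
     norm (hyp_reg (- lam) (\<delta> + \<beta> + lam + \<mu>) \<delta> (of_real (1 - w\<^sup>2))) *
     norm (hyp_reg (- \<mu>) (2 * \<beta> + \<mu>) (\<beta> + 1/2) (of_real ((1 - x) / 2))) *
     (norm (complex_of_real w powr (2 * \<beta> + \<mu> + 1)) * norm (complex_of_real (w\<^sup>2 - 1) powr (\<delta> - 1)) *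
      norm (complex_of_real (x\<^sup>2 - 1) powr (\<beta> - 1/2)) * inverse (norm (laplace_base z w x powr of_real s)))"
    unfolding core_integrand_def by (simp only: norm_mult norm_divide norm_inverse divide_inverse)
  also have "\<dots> \<le>
     (K1 * (w\<^sup>2) ^ N1) * (K2 * x ^ N2) * (w powr R * ((w - 1) powr (\<epsilon> - 1) * w powr (2 * R + 2)) *
       ((x - 1) powr (\<epsilon> - 1) * x powr (2 * R + 2)) * (\<eta> powr (- s) * x powr (- s) * w powr (- s)))"
    using K w x by (intro mult_mono P C n3 n4 n5 n6 mult_nonneg_nonneg) auto
  also have "\<dots> = K1 * K2 * \<eta> powr (- s) *
     (((w - 1) powr (\<epsilon> - 1) * (w powr (2 * real N1) * w powr R * w powr (2 * R + 2) * w powr (- s))) *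
      ((x - 1) powr (\<epsilon> - 1) * (x powr real N2 * x powr (2 * R + 2) * x powr (- s))))"
  proof -
    have "(w\<^sup>2) ^ N1 = w powr (2 * real N1)"
      using w powr_realpow[of w "2 * N1"] by (simp add: power_mult)
    moreover have "x ^ N2 = x powr real N2" using x by (simp add: powr_realpow)
    ultimately show ?thesis by (simp only: mult_ac)
  qed
  also have "w powr (2 * real N1) * w powr R * w powr (2 * R + 2) * w powr (- s) = w powr (2 * real N1 + 3 * R + 2 - s)"
    unfolding powr_add[symmetric] by (rule arg_cong[where f="\<lambda>e. w powr e"]) simp
  also have "x powr real N2 * x powr (2 * R + 2) * x powr (- s) = x powr (real N2 + 2 * R + 2 - s)"
    unfolding powr_add[symmetric] by (rule arg_cong[where f="\<lambda>e. x powr e"]) simp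
  also have "K1 * K2 * \<eta> powr (- s) * (((w - 1) powr (\<epsilon> - 1) * w powr (2 * real N1 + 3 * R + 2 - s)) *
      ((x - 1) powr (\<epsilon> - 1) * x powr (real N2 + 2 * R + 2 - s))) \<le>
     K1 * K2 * \<eta> powr (- s) * (((w - 1) powr (\<epsilon> - 1) * w powr (- 2)) * ((x - 1) powr (\<epsilon> - 1) * x powr (- 2)))"
  proof (intro mult_mono order.refl)
    show "w powr (2 * real N1 + 3 * R + 2 - s) \<le> w powr (- 2)" using w s by (intro powr_mono) auto
    show "x powr (real N2 + 2 * R + 2 - s) \<le> x powr (- 2)" using x s R0 by (intro powr_mono) auto
  qed (use K in auto)
  finally show ?thesis using w x by (simp only: edge_weight_def if_True)
qed

text \<open>All parameters and z move together along \<open>real_path\<close>, so one complex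
  variable \<zeta> suffices. The growth exponents are taken uniform over a disc containing 0 and
  \<i>, which is why S can be fixed before s.\<close>

lemma core_identity_large_s:
  assumes lm: "Re \<beta> > - 1/2" "Re \<delta> > 0" and z: "z \<in> cut_plane"
  shows "\<exists>S. \<forall>s::real\<ge>S. core_factor lam \<mu> \<beta> \<delta> (of_real s) *
      (\<integral>t. core_kernel lam \<mu> \<beta> \<delta> (of_real s) z t \<partial>(lborel \<Otimes>\<^sub>M lborel)) = core_rhs lam \<mu> \<beta> \<delta> (of_real s) z"
proof -
  \<comment> \<open>At \<zeta> = 0 this is l = -1/2, m = -1/4, b = d = 1, z = 2. The positivity
    conditions of \<open>core_identity_real\<close> that do not involve s hold strictly there, hence
    also nearby.\<close>
  define L M B D Z where "L = real_path (- 1/2) lam" and "M = real_path (- 1/4) \<mu>"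
    and "B = real_path 1 \<beta>" and "D = real_path 1 \<delta>" and "Z = real_path 2 z"
  note defs = L_def M_def B_def D_def Z_def
  have hol [holomorphic_intros]: "L holomorphic_on A" "M holomorphic_on A" "B holomorphic_on A"
    "D holomorphic_on A" "Z holomorphic_on A" for A
    unfolding defs by (rule holomorphic_real_path)+
  have bdd: "\<exists>R. \<forall>\<zeta>\<in>ball 0 2. norm (F \<zeta>) \<le> R" if "F holomorphic_on UNIV" for F :: "complex \<Rightarrow> complex"
  proof -
    have "continuous_on (cball 0 2) F"
      using that holomorphic_on_imp_continuous_on continuous_on_subset by blast
    hence "bounded (F ` cball 0 2)" by (intro compact_imp_bounded compact_continuous_image) auto
    then obtain R where "\<forall>y\<in>F ` cball 0 2. norm y \<le> R" unfolding bounded_iff by blast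
    thus ?thesis by (intro exI[of _ R]) auto
  qed
  have "poly_bdd (ball 0 2) (\<lambda>\<zeta> y. hyp_reg (- L \<zeta>) (D \<zeta> + B \<zeta> + L \<zeta> + M \<zeta>) (D \<zeta>) (- of_real y))"
    by (intro poly_bdd_hyp_reg bdd holomorphic_intros)
  from poly_bddE[OF this] obtain K1 N1 where P: "K1 \<ge> 0"
    "\<And>\<zeta> y. \<zeta> \<in> ball 0 2 \<Longrightarrow> y \<ge> 0 \<Longrightarrow> norm (hyp_reg (- L \<zeta>) (D \<zeta> + B \<zeta> + L \<zeta> + M \<zeta>) (D \<zeta>) (- of_real y)) \<le> K1 * (1 + y) ^ N1"
    by blast
  have "poly_bdd (ball 0 2) (\<lambda>\<zeta> y. hyp_reg (- M \<zeta>) (2 * B \<zeta> + M \<zeta>) (B \<zeta> + 1/2) (- of_real y))"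
    by (intro poly_bdd_hyp_reg bdd holomorphic_intros)
  from poly_bddE[OF this] obtain K2 N2 where C: "K2 \<ge> 0"
    "\<And>\<zeta> y. \<zeta> \<in> ball 0 2 \<Longrightarrow> y \<ge> 0 \<Longrightarrow> norm (hyp_reg (- M \<zeta>) (2 * B \<zeta> + M \<zeta>) (B \<zeta> + 1/2) (- of_real y)) \<le> K2 * (1 + y) ^ N2"
    by blast
  have "\<exists>R. \<forall>\<zeta>\<in>ball 0 2. norm (2 * B \<zeta> + M \<zeta> + 1) \<le> R" by (intro bdd holomorphic_intros)
  then obtain R1 where R1: "\<And>\<zeta>. \<zeta> \<in> ball 0 2 \<Longrightarrow> norm (2 * B \<zeta> + M \<zeta> + 1) \<le> R1" by blast
  have "\<exists>R. \<forall>\<zeta>\<in>ball 0 2. norm (D \<zeta> - 1) \<le> R" by (intro bdd holomorphic_intros)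
  then obtain R2 where R2: "\<And>\<zeta>. \<zeta> \<in> ball 0 2 \<Longrightarrow> norm (D \<zeta> - 1) \<le> R2" by blast
  have "\<exists>R. \<forall>\<zeta>\<in>ball 0 2. norm (B \<zeta> - 1/2) \<le> R" by (intro bdd holomorphic_intros) auto
  then obtain R3 where R3: "\<And>\<zeta>. \<zeta> \<in> ball 0 2 \<Longrightarrow> norm (B \<zeta> - 1/2) \<le> R3" by blast
  define R where "R = max R1 (max R2 R3)"
  have R: "norm (2 * B \<zeta> + M \<zeta> + 1) \<le> R" "norm (D \<zeta> - 1) \<le> R" "norm (B \<zeta> - 1/2) \<le> R"
    if "\<zeta> \<in> ball 0 2" for \<zeta>
    using R1[OF that] R2[OF that] R3[OF that] unfolding R_def by (auto intro: max.coboundedI1 max.coboundedI2)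
  \<comment> \<open>The conditions on B and D keep the edge singularities integrable, the one on Z
    keeps the base off its cut, and the disc keeps the growth bounds uniform.\<close>
  define W where "W = ball 0 2 \<inter> {\<zeta>. Re (B \<zeta>) > - 1/2} \<inter> {\<zeta>. Re (D \<zeta>) > 0} \<inter> Z -` cut_plane"
  have cont: "continuous_on UNIV B" "continuous_on UNIV D" "continuous_on UNIV Z"
    by (intro holomorphic_on_imp_continuous_on holomorphic_intros)+
  have oW: "open W" unfolding W_def
    by (intro open_Int open_ball open_Collect_less continuous_intros cont open_vimage open_cut_plane)
  \<comment> \<open>W need not be connected; the component of 0 is enough because the segment from 0
    to \<i> stays in W.\<close>
  define U where "U = connected_component_set W 0"
  have seg: "of_real t * \<i> \<in> W" if t: "0 \<le> t" "t \<le> 1" for t :: real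
  proof -
    have t2: "0 \<le> t\<^sup>2" "t\<^sup>2 \<le> 1" using t by (simp_all add: power_le_one)
    have cc: "(1 - t\<^sup>2) * c + t\<^sup>2 * r > a" if "c > a" "r > a" for a c r :: real
    proof -
      have "(1 - t\<^sup>2) * (c - a) + t\<^sup>2 * (r - a) > 0"
      proof (cases "t = 0")
        case False
        hence "t\<^sup>2 * (r - a) > 0" using that by simp
        moreover have "(1 - t\<^sup>2) * (c - a) \<ge> 0" using that t2 by simp
        ultimately show ?thesis by linarith
      qed (use that in simp)
      thus ?thesis by (simp add: algebra_simps)
    qed
    \<comment> \<open>If Im z \<noteq> 0, the imaginary part t Im z vanishes only at t = 0, where Z
      is 2. If Im z = 0, the values are convex combinations of 2 and Re z > 1.\<close>
    have "Z (of_real t * \<i>) \<in> cut_plane"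
      unfolding mem_cut_plane_iff defs real_path_imag
      using z cc[of 1 2 "Re z"] t by (cases "t = 0") (auto simp: mem_cut_plane_iff)
    moreover have "Re (B (of_real t * \<i>)) > - 1/2"
      unfolding defs real_path_imag using cc[of "- 1/2" 1 "Re \<beta>"] lm by simp
    moreover have "Re (D (of_real t * \<i>)) > 0"
      unfolding defs real_path_imag using cc[of 0 1 "Re \<delta>"] lm by simp
    moreover have "norm (of_real t * \<i>) < 2" using t by (simp add: norm_mult)
    ultimately show ?thesis by (simp add: W_def)
  qed
  have oU: "open U" unfolding U_def by (rule open_connected_component[OF oW])
  have cU: "connected U" unfolding U_def by (rule connected_connected_component)
  have UW: "U \<subseteq> W" unfolding U_def by (rule connected_component_subset)
  have U0: "0 \<in> U" unfolding U_def using seg[of 0] by simp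
  have Ui: "\<i> \<in> U"
  proof -
    define T where "T = (\<lambda>t. of_real t * \<i>) ` {0..1::real}"
    have "connected T" unfolding T_def
      by (intro connected_continuous_image continuous_intros) auto
    moreover have "T \<subseteq> W" unfolding T_def using seg by auto
    moreover have "0 \<in> T" "\<i> \<in> T" unfolding T_def by (auto intro!: image_eqI[of _ _ 0] image_eqI[of _ _ 1])
    ultimately have "connected_component W 0 \<i>" unfolding connected_component_def by blast
    thus ?thesis by (simp add: U_def)
  qed
  \<comment> \<open>The terms with N1, N2 and R meet the threshold of
    \<open>norm_core_kernel_bound\<close>; the constant 10 also covers the lower bounds on s in
    \<open>core_identity_real\<close> for all real parameters in the neighbourhood Q below.\<close>
  define S where "S = 2 * real N1 + real N2 + 3 * \<bar>R\<bar> + 10"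
  have main: "core_factor lam \<mu> \<beta> \<delta> (of_real s) *
      (\<integral>t. core_kernel lam \<mu> \<beta> \<delta> (of_real s) z t \<partial>(lborel \<Otimes>\<^sub>M lborel)) = core_rhs lam \<mu> \<beta> \<delta> (of_real s) z"
    if s: "s \<ge> S" for s :: real
  proof -
    have ZW: "Z \<zeta> \<in> cut_plane" if "\<zeta> \<in> W" for \<zeta> using that by (simp add: W_def)
    define F where "F \<zeta> = (\<integral>t. core_kernel (L \<zeta>) (M \<zeta>) (B \<zeta>) (D \<zeta>) (of_real s) (Z \<zeta>) t \<partial>(lborel \<Otimes>\<^sub>M lborel))" for \<zeta>
    have F: "F holomorphic_on W" unfolding F_def
    proof (rule holomorphic_lebesgue_integral[OF oW])
      show "(\<lambda>\<zeta>. core_kernel (L \<zeta>) (M \<zeta>) (B \<zeta>) (D \<zeta>) (of_real s) (Z \<zeta>) t) holomorphic_on W" for t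
        by (intro holomorphic_core_kernel oW holomorphic_intros ZW)
      fix \<zeta>0 assume z0: "\<zeta>0 \<in> W"
      \<comment> \<open>At most half the distance to the edge conditions, so that the same
        \<epsilon> works in a neighbourhood of \<zeta>0; likewise \<eta> below is half the value of
        the root.\<close>
      define \<epsilon> where "\<epsilon> = min 1 (min (Re (B \<zeta>0) + 1/2) (Re (D \<zeta>0))) / 2"
      have \<epsilon>: "0 < \<epsilon>" "\<epsilon> \<le> 1" "\<epsilon> < Re (D \<zeta>0)" "\<epsilon> < Re (B \<zeta>0) + 1/2"
        using z0 by (auto simp: \<epsilon>_def W_def min_def)
      define \<eta> where "\<eta> = norm (sqrt_sq_minus_1 (Z \<zeta>0)) / 2"
      have \<eta>: "\<eta> > 0" using sqrt_sq_minus_1_nonzero[OF ZW[OF z0]] by (simp add: \<eta>_def)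
      have cs: "continuous_on W (\<lambda>\<zeta>. norm (sqrt_sq_minus_1 (Z \<zeta>)))"
        unfolding sqrt_sq_minus_1_def
        by (intro continuous_on_norm holomorphic_on_imp_continuous_on holomorphic_intros cut_plane_not_nonpos_Reals ZW)
      have oT: "open (W \<inter> (\<lambda>\<zeta>. norm (sqrt_sq_minus_1 (Z \<zeta>))) -` {\<eta><..})"
        by (rule continuous_open_preimage[OF cs oW]) simp
      have "open ((W \<inter> (\<lambda>\<zeta>. norm (sqrt_sq_minus_1 (Z \<zeta>))) -` {\<eta><..}) \<inter> {\<zeta>. Re (D \<zeta>) > \<epsilon>} \<inter> {\<zeta>. Re (B \<zeta>) > \<epsilon> - 1/2})"
        by (rule open_Int[OF open_Int[OF oT]]) (intro open_Collect_less continuous_intros cont)+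
      moreover have "\<zeta>0 \<in> (W \<inter> (\<lambda>\<zeta>. norm (sqrt_sq_minus_1 (Z \<zeta>))) -` {\<eta><..}) \<inter> {\<zeta>. Re (D \<zeta>) > \<epsilon>} \<inter> {\<zeta>. Re (B \<zeta>) > \<epsilon> - 1/2}"
        using z0 \<epsilon> \<eta> by (auto simp: \<eta>_def)
      ultimately obtain e where e: "e > 0" "ball \<zeta>0 e \<subseteq> (W \<inter> (\<lambda>\<zeta>. norm (sqrt_sq_minus_1 (Z \<zeta>))) -` {\<eta><..}) \<inter> {\<zeta>. Re (D \<zeta>) > \<epsilon>} \<inter> {\<zeta>. Re (B \<zeta>) > \<epsilon> - 1/2}"
        using openE by blast
      show "\<exists>r>0. \<exists>g. integrable (lborel \<Otimes>\<^sub>M lborel) g \<and> (\<forall>\<zeta>\<in>ball \<zeta>0 r \<inter> W. \<forall>t\<in>space (lborel \<Otimes>\<^sub>M lborel).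
          norm (core_kernel (L \<zeta>) (M \<zeta>) (B \<zeta>) (D \<zeta>) (of_real s) (Z \<zeta>) t) \<le> g t)"
      proof (intro exI conjI ballI)
        show "integrable (lborel \<Otimes>\<^sub>M lborel) (\<lambda>t. K1 * K2 * \<eta> powr (- s) * (edge_weight \<epsilon> (fst t) * edge_weight \<epsilon> (snd t)))"
          by (rule integrable_edge_weight_prod[OF \<epsilon>(1,2)])
        fix \<zeta> and t :: "real \<times> real" assume \<zeta>: "\<zeta> \<in> ball \<zeta>0 e \<inter> W"
        hence \<zeta>': "\<zeta> \<in> ball 0 2" "\<eta> < norm (sqrt_sq_minus_1 (Z \<zeta>))" "\<epsilon> < Re (D \<zeta>)" "\<epsilon> < Re (B \<zeta>) + 1/2" "\<zeta> \<in> W"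
          using e(2) by (auto simp: W_def)
        show "norm (core_kernel (L \<zeta>) (M \<zeta>) (B \<zeta>) (D \<zeta>) (of_real s) (Z \<zeta>) t) \<le>
            K1 * K2 * \<eta> powr (- s) * (edge_weight \<epsilon> (fst t) * edge_weight \<epsilon> (snd t))"
        proof (cases "fst t > 1 \<and> snd t > 1")
          case True
          have y: "(fst t)\<^sup>2 - 1 \<ge> 0" "(snd t - 1) / 2 \<ge> 0" using True by (simp_all add: one_le_power)
          have p: "norm (hyp_reg (- L \<zeta>) (D \<zeta> + B \<zeta> + L \<zeta> + M \<zeta>) (D \<zeta>) (of_real (1 - (fst t)\<^sup>2))) \<le> K1 * ((fst t)\<^sup>2) ^ N1"
          proof -
            have "- complex_of_real ((fst t)\<^sup>2 - 1) = of_real (1 - (fst t)\<^sup>2)" "1 + ((fst t)\<^sup>2 - 1) = (fst t)\<^sup>2"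
              by simp_all
            thus ?thesis using P(2)[OF \<zeta>'(1) y(1)] by (simp only:)
          qed
          have c: "norm (hyp_reg (- M \<zeta>) (2 * B \<zeta> + M \<zeta>) (B \<zeta> + 1/2) (of_real ((1 - snd t) / 2))) \<le> K2 * (snd t) ^ N2"
          proof -
            have "- complex_of_real ((snd t - 1) / 2) = of_real ((1 - snd t) / 2)"
              unfolding of_real_minus[symmetric] by (rule arg_cong[where f=of_real]) (simp add: field_simps)
            hence "norm (hyp_reg (- M \<zeta>) (2 * B \<zeta> + M \<zeta>) (B \<zeta> + 1/2) (of_real ((1 - snd t) / 2))) \<le> K2 * (1 + (snd t - 1) / 2) ^ N2"
              using C(2)[OF \<zeta>'(1) y(2)] by (simp only:)
            also have "\<dots> \<le> K2 * (snd t) ^ N2"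
              using C(1) True by (intro mult_left_mono power_mono) (auto simp: field_simps)
            finally show ?thesis .
          qed
          have "norm (core_integrand (L \<zeta>) (M \<zeta>) (B \<zeta>) (D \<zeta>) (of_real s) (Z \<zeta>) (fst t) (snd t)) \<le>
            K1 * K2 * \<eta> powr (- s) * (edge_weight \<epsilon> (fst t) * edge_weight \<epsilon> (snd t))"
            using \<zeta>' \<epsilon> s True
            by (intro norm_core_kernel_bound[OF _ _ ZW p c P(1) C(1) R[OF \<zeta>'(1)]] \<eta>) (auto simp: S_def)
          thus ?thesis using True by (simp add: core_kernel_def)
        next
          case False
          thus ?thesis using P(1) C(1) by (auto simp: core_kernel_def edge_weight_def)
        qed
      qed (rule e)
    qed measurable
    define h where "h \<zeta> = core_factor (L \<zeta>) (M \<zeta>) (B \<zeta>) (D \<zeta>) (of_real s) * F \<zeta> - core_rhs (L \<zeta>) (M \<zeta>) (B \<zeta>) (D \<zeta>) (of_real s) (Z \<zeta>)" for \<zeta>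
    have hhol: "h holomorphic_on U" unfolding h_def
      by (intro holomorphic_on_diff holomorphic_on_mult holomorphic_on_subset[OF F UW] holomorphic_core_factor
            holomorphic_core_rhs hol holomorphic_on_const oU ZW subsetD[OF UW])
    \<comment> \<open>A neighbourhood of 0 at whose real points the parameters satisfy all
      hypotheses of \<open>core_identity_real\<close>.\<close>
    define Q where "Q = U \<inter> ball 0 (1/100) \<inter> {\<zeta>. Re (L \<zeta>) < -1/4} \<inter> {\<zeta>. Re (L \<zeta>) > -3/4} \<inter> {\<zeta>. Re (M \<zeta>) > -1/2} \<inter> {\<zeta>. Re (M \<zeta>) < 0}
       \<inter> {\<zeta>. Re (B \<zeta>) > 3/4} \<inter> {\<zeta>. Re (B \<zeta>) < 5/4} \<inter> {\<zeta>. Re (D \<zeta>) > 3/4} \<inter> {\<zeta>. Re (D \<zeta>) < 5/4} \<inter> {\<zeta>. Re (Z \<zeta>) > 1}"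
    have contL: "continuous_on UNIV L" "continuous_on UNIV M"
      by (intro holomorphic_on_imp_continuous_on holomorphic_intros)+
    have oQ: "open Q" unfolding Q_def
      by (intro open_Int oU open_ball open_Collect_less continuous_intros cont contL)
    have Q0: "complex_of_real 0 \<in> Q" using U0 by (simp add: Q_def defs)
    have "h \<i> = 0"
    proof (rule analytic_continuation[OF hhol oU cU])
      show "range complex_of_real \<inter> Q \<subseteq> U" by (auto simp: Q_def)
      show "complex_of_real 0 \<in> U" using U0 by simp
      show "complex_of_real 0 islimpt (range complex_of_real \<inter> Q)" by (rule islimpt_real_axis[OF oQ Q0])
      fix \<zeta> assume "\<zeta> \<in> range complex_of_real \<inter> Q"
      then obtain x where x: "\<zeta> = of_real x" "\<zeta> \<in> Q" by blast
      define r where "r c p = c + x * Im p - x\<^sup>2 * (Re p - c)" for c p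
      have eqs: "L \<zeta> = of_real (r (-1/2) lam)" "M \<zeta> = of_real (r (-1/4) \<mu>)" "B \<zeta> = of_real (r 1 \<beta>)"
         "D \<zeta> = of_real (r 1 \<delta>)" "Z \<zeta> = of_real (r 2 z)"
        unfolding defs x(1) real_path_of_real r_def by (rule refl)+
      have ineq: "r (-1/2) lam < -1/4" "r (-1/2) lam > -3/4" "r (-1/4) \<mu> > -1/2" "r (-1/4) \<mu> < 0"
         "r 1 \<beta> > 3/4" "r 1 \<beta> < 5/4" "r 1 \<delta> > 3/4" "r 1 \<delta> < 5/4" "r 2 z > 1"
        using x(2) unfolding Q_def by (simp_all add: eqs)
      have "s \<ge> 10" using s by (simp add: S_def)
      hence "core_factor (of_real (r (-1/2) lam)) (of_real (r (-1/4) \<mu>)) (of_real (r 1 \<beta>)) (of_real (r 1 \<delta>)) (of_real s) *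
        (\<integral>t. core_kernel (of_real (r (-1/2) lam)) (of_real (r (-1/4) \<mu>)) (of_real (r 1 \<beta>)) (of_real (r 1 \<delta>)) (of_real s) (of_real (r 2 z)) t \<partial>(lborel \<Otimes>\<^sub>M lborel)) =
        core_rhs (of_real (r (-1/2) lam)) (of_real (r (-1/4) \<mu>)) (of_real (r 1 \<beta>)) (of_real (r 1 \<delta>)) (of_real s) (of_real (r 2 z))"
        using ineq by (intro core_identity_real) linarith+
      thus "h \<zeta> = 0" unfolding h_def F_def eqs by simp
    qed (rule Ui)
    thus ?thesis unfolding h_def F_def defs by simp
  qed
  show ?thesis using main by blast
qed

section \<open>Continuation in the exponent s\<close>

text \<open>The exponent s occurs in one power of the base only, so kernels with different s differ
  by a power of the base. This is what permits comparison with the kernel at s0.\<close>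

lemma core_kernel_shift:
  assumes z: "z \<in> cut_plane"
  shows "core_kernel lam \<mu> \<beta> \<delta> s z t = core_kernel lam \<mu> \<beta> \<delta> s0 z t * laplace_base z (fst t) (snd t) powr (s0 - s)"
proof (cases "fst t > 1 \<and> snd t > 1")
  case True
  hence "laplace_base z (fst t) (snd t) \<notin> \<real>\<^sub>\<le>\<^sub>0" using z by (intro laplace_base_not_nonpos_Reals) auto
  hence nz: "laplace_base z (fst t) (snd t) \<noteq> 0" by auto
  hence "laplace_base z (fst t) (snd t) powr s0 \<noteq> 0" by simp
  hence e: "1 / laplace_base z (fst t) (snd t) powr s =
      1 / laplace_base z (fst t) (snd t) powr s0 * laplace_base z (fst t) (snd t) powr (s0 - s)"
    using nz by (simp add: powr_diff)
  have "core_integrand lam \<mu> \<beta> \<delta> s z (fst t) (snd t) =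
     hyp_reg (- lam) (\<delta> + \<beta> + lam + \<mu>) \<delta> (of_real (1 - (fst t)\<^sup>2))
     * hyp_reg (- \<mu>) (2 * \<beta> + \<mu>) (\<beta> + 1/2) (of_real ((1 - snd t) / 2))
     * (of_real (fst t) powr (2 * \<beta> + \<mu> + 1) * of_real ((fst t)\<^sup>2 - 1) powr (\<delta> - 1)
        * of_real ((snd t)\<^sup>2 - 1) powr (\<beta> - 1/2)) * (1 / laplace_base z (fst t) (snd t) powr s)" for s
    by (simp add: core_integrand_def)
  thus ?thesis using True by (simp only: core_kernel_def simp_thms if_True e mult.assoc)
qed (auto simp: core_kernel_def)

text \<open>The modulus of v^e is |v|^(Re e) exp (- Im e arg v). The first factor is bounded because
  Re e \<le> 0 and |v| \<ge> \<eta>, the second because |arg v| \<le> pi.\<close>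

lemma norm_powr_bound:
  fixes v e :: complex
  assumes "v \<noteq> 0" "\<eta> > 0" "\<eta> \<le> norm v" "Re e \<le> 0" "norm e \<le> R"
  shows "norm (v powr e) \<le> max 1 (1 / \<eta>) powr R * exp (R * pi)"
proof -
  have R: "R \<ge> 0" using assms(5) norm_ge_zero order_trans by blast
  have "norm (v powr e) = exp (Re e * ln (norm v) - Im e * Im (Ln v))"
    using assms(1) by (simp add: powr_def norm_exp_eq_Re Re_Ln)
  also have "\<dots> = norm v powr Re e * exp (- Im e * Im (Ln v))"
    using assms(1) by (simp add: powr_def exp_diff exp_minus divide_inverse mult.commute)
  also have "\<dots> \<le> max 1 (1 / \<eta>) powr R * exp (R * pi)"
  proof (intro mult_mono)
    have "norm v powr Re e \<le> \<eta> powr Re e" using assms by (intro powr_mono2') auto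
    also have "\<dots> = (1 / \<eta>) powr (- Re e)" using assms by (simp add: powr_divide_pos powr_minus)
    also have "\<dots> \<le> max 1 (1 / \<eta>) powr (- Re e)" using assms by (intro powr_mono2) auto
    also have "\<dots> \<le> max 1 (1 / \<eta>) powr R"
      using assms abs_Re_le_cmod[of e] by (intro powr_mono) auto
    finally show "norm v powr Re e \<le> max 1 (1 / \<eta>) powr R" .
    have "- Im e * Im (Ln v) \<le> \<bar>Im e\<bar> * \<bar>Im (Ln v)\<bar>" by (metis abs_ge_self abs_minus_cancel abs_mult)
    also have "\<dots> \<le> R * pi"
      using assms(1,5) abs_Im_le_cmod[of e] R mpi_less_Im_Ln[of v] Im_Ln_le_pi[of v] by (intro mult_mono) auto
    finally show "exp (- Im e * Im (Ln v)) \<le> exp (R * pi)" by simp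
  qed auto
  finally show ?thesis .
qed

text \<open>A constant times the kernel at s0 dominates all kernels with s in a bounded part of the
  closed half-plane Re s \<ge> Re s0. The same bound serves holomorphy inside and the limit at the
  edge.\<close>

lemma core_identity:
  assumes lm: "Re \<beta> > - 1/2" "Re \<delta> > 0" and z: "z \<in> cut_plane"
    and int: "integrable (lborel \<Otimes>\<^sub>M lborel) (core_kernel lam \<mu> \<beta> \<delta> s0 z)"
  shows "core_factor lam \<mu> \<beta> \<delta> s0 *
      (\<integral>t. core_kernel lam \<mu> \<beta> \<delta> s0 z t \<partial>(lborel \<Otimes>\<^sub>M lborel)) = core_rhs lam \<mu> \<beta> \<delta> s0 z"
proof -
  define F where "F s = (\<integral>t. core_kernel lam \<mu> \<beta> \<delta> s z t \<partial>(lborel \<Otimes>\<^sub>M lborel))" for s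
  define \<eta> where "\<eta> = norm (sqrt_sq_minus_1 z)"
  have \<eta>: "\<eta> > 0" using sqrt_sq_minus_1_nonzero[OF z] by (simp add: \<eta>_def)
  define K where "K R = max 1 (1 / \<eta>) powr R * exp (R * pi)" for R
  have dom: "norm (core_kernel lam \<mu> \<beta> \<delta> s z t) \<le> norm (core_kernel lam \<mu> \<beta> \<delta> s0 z t) * K R"
    if "Re s \<ge> Re s0" "norm (s0 - s) \<le> R" for s t R
  proof (cases "fst t > 1 \<and> snd t > 1")
    case True
    \<comment> \<open>On the quadrant x w \<ge> 1, so the modulus of the base never falls below
      \<eta>, as \<open>norm_powr_bound\<close> requires.\<close>
    have "1 * 1 \<le> snd t * fst t" using True by (intro mult_mono) auto
    hence "\<eta> * 1 \<le> \<eta> * (snd t * fst t)" using \<eta> by (intro mult_left_mono) auto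
    also have "\<dots> \<le> norm (laplace_base z (fst t) (snd t))"
      unfolding \<eta>_def using True by (intro laplace_base_lower z) auto
    finally have low: "\<eta> \<le> norm (laplace_base z (fst t) (snd t))" by simp
    have "norm (laplace_base z (fst t) (snd t) powr (s0 - s)) \<le> K R"
      unfolding K_def using low \<eta> that by (intro norm_powr_bound) auto
    thus ?thesis unfolding core_kernel_shift[OF z, of lam \<mu> \<beta> \<delta> s t s0] norm_mult by (intro mult_left_mono) auto
  qed (auto simp: core_kernel_def)
  define H where "H = {s. Re s > Re s0}"
  have oH: "open H" unfolding H_def by (intro open_Collect_less continuous_intros)
  have cH: "connected H" unfolding H_def by (rule convex_connected[OF convex_halfspace_Re_gt])
  have intn: "integrable (lborel \<Otimes>\<^sub>M lborel) (\<lambda>t. norm (core_kernel lam \<mu> \<beta> \<delta> s0 z t) * c)" for c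
    using int by (intro integrable_mult_left integrable_norm)
  have F: "F holomorphic_on H" unfolding F_def
  proof (rule holomorphic_lebesgue_integral[OF oH])
    show "(\<lambda>s. core_kernel lam \<mu> \<beta> \<delta> s z t) holomorphic_on H" for t
      using z by (intro holomorphic_core_kernel oH holomorphic_intros)
    fix s1 assume "s1 \<in> H"
    show "\<exists>r>0. \<exists>g. integrable (lborel \<Otimes>\<^sub>M lborel) g \<and> (\<forall>s\<in>ball s1 r \<inter> H. \<forall>t\<in>space (lborel \<Otimes>\<^sub>M lborel).
        norm (core_kernel lam \<mu> \<beta> \<delta> s z t) \<le> g t)"
    proof (intro exI conjI ballI)
      fix s and t :: "real \<times> real" assume s: "s \<in> ball s1 1 \<inter> H"
      have "norm (s0 - s) \<le> norm (s0 - s1) + norm (s1 - s)" by (rule norm_triangle_sub[of "s0 - s" "s0 - s1", simplified, THEN order_trans]) simp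
      hence "norm (s0 - s) \<le> norm (s0 - s1) + 1" using s by (simp add: dist_norm)
      thus "norm (core_kernel lam \<mu> \<beta> \<delta> s z t) \<le> norm (core_kernel lam \<mu> \<beta> \<delta> s0 z t) * K (norm (s0 - s1) + 1)"
        using s by (intro dom) (auto simp: H_def)
    qed (use intn in auto)
  qed measurable
  define h where "h s = core_factor lam \<mu> \<beta> \<delta> s * F s - core_rhs lam \<mu> \<beta> \<delta> s z" for s
  have hol1: "(\<lambda>s. core_factor lam \<mu> \<beta> \<delta> s) holomorphic_on A" for A
    by (intro holomorphic_core_factor holomorphic_intros)
  have hol2: "(\<lambda>s. core_rhs lam \<mu> \<beta> \<delta> s z) holomorphic_on A" if "open A" for A
    using z that by (intro holomorphic_core_rhs holomorphic_intros)
  have hhol: "h holomorphic_on H" unfolding h_def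
    by (intro holomorphic_on_diff holomorphic_on_mult F hol1 hol2 oH)
  obtain S where S: "\<And>s::real. s \<ge> S \<Longrightarrow> core_factor lam \<mu> \<beta> \<delta> (of_real s) *
      (\<integral>t. core_kernel lam \<mu> \<beta> \<delta> (of_real s) z t \<partial>(lborel \<Otimes>\<^sub>M lborel)) = core_rhs lam \<mu> \<beta> \<delta> (of_real s) z"
    using core_identity_large_s[OF lm z] by blast
  \<comment> \<open>Large enough for the identity at real s and for the half-plane Re s > S1 to lie
    inside H.\<close>
  define S1 where "S1 = max S (Re s0) + 1"
  define Q where "Q = {s. Re s > S1}"
  have oQ: "open Q" unfolding Q_def by (intro open_Collect_less continuous_intros)
  have QH: "Q \<subseteq> H" by (auto simp: Q_def H_def S1_def)
  have SQ: "complex_of_real (S1 + 1) \<in> Q" by (simp add: Q_def)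
  have h0: "h s = 0" if "s \<in> H" for s
  proof (rule analytic_continuation[OF hhol oH cH])
    show "range complex_of_real \<inter> Q \<subseteq> H" using QH by auto
    show "complex_of_real (S1 + 1) \<in> H" using SQ QH by blast
    show "complex_of_real (S1 + 1) islimpt (range complex_of_real \<inter> Q)" by (rule islimpt_real_axis[OF oQ SQ])
    fix s assume "s \<in> range complex_of_real \<inter> Q"
    then obtain r where "s = of_real r" "r \<ge> S" by (auto simp: Q_def S1_def)
    thus "h s = 0" unfolding h_def F_def using S[of r] by simp
  qed (rule that)
  \<comment> \<open>Approaches s0 horizontally from inside H; the steps have length at most 1, so
    the single constant \<open>K 1\<close> dominates the whole sequence.\<close>
  define X where "X n = s0 + of_real (1 / real (Suc n))" for n
  have XH: "X n \<in> H" for n by (simp add: X_def H_def)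
  have X1: "norm (s0 - X n) \<le> 1" for n
  proof -
    have "norm (s0 - X n) = norm (complex_of_real (1 / real (Suc n)))" by (simp add: X_def del: of_real_divide)
    thus ?thesis by (simp only: norm_of_real) simp
  qed
  have Xl: "X \<longlonglongrightarrow> s0"
  proof -
    have "(\<lambda>n. complex_of_real (1 / real (Suc n))) \<longlonglongrightarrow> of_real 0"
      by (intro tendsto_of_real) (use LIMSEQ_inverse_real_of_nat in \<open>simp add: inverse_eq_divide\<close>)
    from tendsto_add[OF tendsto_const[of s0] this] show ?thesis by (simp add: X_def[abs_def])
  qed
  have "(\<lambda>n. F (X n)) \<longlonglongrightarrow> F s0"
    unfolding F_def
  proof (rule integral_dominated_convergence)
    show "integrable (lborel \<Otimes>\<^sub>M lborel) (\<lambda>t. norm (core_kernel lam \<mu> \<beta> \<delta> s0 z t) * K 1)" by (rule intn)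
    show "AE t in lborel \<Otimes>\<^sub>M lborel. norm (core_kernel lam \<mu> \<beta> \<delta> (X n) z t) \<le> norm (core_kernel lam \<mu> \<beta> \<delta> s0 z t) * K 1" for n
      using XH[of n] X1[of n] by (intro AE_I2 dom) (auto simp: H_def)
    show "AE t in lborel \<Otimes>\<^sub>M lborel. (\<lambda>n. core_kernel lam \<mu> \<beta> \<delta> (X n) z t) \<longlonglongrightarrow> core_kernel lam \<mu> \<beta> \<delta> s0 z t"
    proof (rule AE_I2)
      fix t :: "real \<times> real"
      have "(\<lambda>s. core_kernel lam \<mu> \<beta> \<delta> s z t) holomorphic_on UNIV"
        using z by (intro holomorphic_core_kernel holomorphic_intros) auto
      hence "isCont (\<lambda>s. core_kernel lam \<mu> \<beta> \<delta> s z t) s0"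
        using holomorphic_on_imp_continuous_on continuous_on_eq_continuous_at open_UNIV by blast
      thus "(\<lambda>n. core_kernel lam \<mu> \<beta> \<delta> (X n) z t) \<longlonglongrightarrow> core_kernel lam \<mu> \<beta> \<delta> s0 z t"
        using Xl by (rule isCont_tendsto_compose)
    qed
  qed measurable
  moreover have "(\<lambda>n. core_factor lam \<mu> \<beta> \<delta> (X n)) \<longlonglongrightarrow> core_factor lam \<mu> \<beta> \<delta> s0"
    "(\<lambda>n. core_rhs lam \<mu> \<beta> \<delta> (X n) z) \<longlonglongrightarrow> core_rhs lam \<mu> \<beta> \<delta> s0 z"
  proof -
    have cont: "(\<lambda>n. G (X n)) \<longlonglongrightarrow> G s0" if "G holomorphic_on UNIV" for G :: "complex \<Rightarrow> complex"
    proof -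
      have "isCont G s0"
        using holomorphic_on_imp_continuous_on[OF that] by (simp add: continuous_on_eq_continuous_at)
      thus ?thesis using Xl by (rule isCont_tendsto_compose)
    qed
    show "(\<lambda>n. core_factor lam \<mu> \<beta> \<delta> (X n)) \<longlonglongrightarrow> core_factor lam \<mu> \<beta> \<delta> s0" by (rule cont[OF hol1])
    show "(\<lambda>n. core_rhs lam \<mu> \<beta> \<delta> (X n) z) \<longlonglongrightarrow> core_rhs lam \<mu> \<beta> \<delta> s0 z"
      by (rule cont[OF hol2[OF open_UNIV]])
  qed
  ultimately have "(\<lambda>n. h (X n)) \<longlonglongrightarrow> core_factor lam \<mu> \<beta> \<delta> s0 * F s0 - core_rhs lam \<mu> \<beta> \<delta> s0 z"
    unfolding h_def by (intro tendsto_intros)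
  hence "(\<lambda>n. 0) \<longlonglongrightarrow> core_factor lam \<mu> \<beta> \<delta> s0 * F s0 - core_rhs lam \<mu> \<beta> \<delta> s0 z"
    using h0[OF XH] by simp
  hence "core_factor lam \<mu> \<beta> \<delta> s0 * F s0 - core_rhs lam \<mu> \<beta> \<delta> s0 z = 0" by (metis LIMSEQ_const_iff)
  thus ?thesis by (simp add: F_def)
qed

section \<open>Restoring the Gamma factors\<close>

lemma Gamma_nonzero: "z \<notin> \<int>\<^sub>\<le>\<^sub>0 \<Longrightarrow> Gamma z \<noteq> (0 :: complex)"
  by (simp add: Gamma_eq_zero_iff)

text \<open>\<open>endpoint\<close> makes the edge singularities, of exponents \<alpha> - \<beta> -
  1 at w = 1 and \<beta> - 1/2 at x = 1, integrable; \<open>convergent\<close> supplies absolute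
  integrability over the quadrant. The last two conditions of \<open>poles_right\<close> concern
  Gamma functions that stand below the fraction bar in the prefactor but in the numerators of
  \<open>jacobi_P\<close> and \<open>gegenbauer_C\<close>.\<close>

theorem corollary43:
  fixes lam \<mu> \<gamma> \<alpha> \<beta> z :: complex
  assumes nonzero: "lam \<noteq> 0" "\<mu> \<noteq> 0" "\<gamma> \<noteq> 0" "\<alpha> \<noteq> 0" "\<beta> \<noteq> 0"
    and z: "z \<notin> complex_of_real ` {..1}"
    and poles_left: "\<alpha> + \<gamma> + lam + 1 \<notin> \<int>\<^sub>\<le>\<^sub>0" "\<beta> + \<gamma> - lam + 1 \<notin> \<int>\<^sub>\<le>\<^sub>0"
    and poles_right: "lam + 1 \<notin> \<int>\<^sub>\<le>\<^sub>0" "\<mu> + 1 \<notin> \<int>\<^sub>\<le>\<^sub>0"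
      "\<alpha> + \<gamma> + 1 \<notin> \<int>\<^sub>\<le>\<^sub>0" "\<alpha> + \<beta> + \<gamma> + 1 \<notin> \<int>\<^sub>\<le>\<^sub>0"
      "\<alpha> - \<beta> + lam \<notin> \<int>\<^sub>\<le>\<^sub>0" "2 * \<beta> + \<mu> \<notin> \<int>\<^sub>\<le>\<^sub>0"
    and endpoint: "Re \<beta> > - 1 / 2" "Re (\<alpha> - \<beta>) > 0"
    and convergent: "set_integrable lborel ({1<..} \<times> {1<..})
      (\<lambda>(w, x). laplace_integrand lam \<mu> \<gamma> \<alpha> \<beta> z w x)"
  shows "(z - 1) powr (lam + \<mu> / 2) * (z + 1) powr (\<mu> / 2)
      * jacobi_Q (\<gamma> - lam - \<mu>) (\<alpha> + 2 * lam + \<mu>) (\<beta> + \<mu>) z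
    = 2 powr (2 * \<beta> + lam + \<mu>)
        * Gamma \<beta> * Gamma (lam + 1) * Gamma (\<mu> + 1)
        * Gamma (\<alpha> + \<gamma> + 1) * Gamma (\<alpha> + \<beta> + \<gamma> + 1)
      / (Gamma (\<alpha> - \<beta> + lam) * Gamma (2 * \<beta> + \<mu>)
        * Gamma (\<gamma> - lam - \<mu> + 1) * Gamma (\<alpha> + \<beta> + \<gamma> + lam + \<mu> + 1))
      * (CLINT x:{1<..}|lborel. (CLINT w:{1<..}|lborel.
           laplace_integrand lam \<mu> \<gamma> \<alpha> \<beta> z w x))"
proof -
  define \<delta> where "\<delta> = \<alpha> - \<beta>"
  define s where "s = \<alpha> + \<beta> + \<gamma> + 1"
  have zc: "z \<in> cut_plane" using z by (simp add: cut_plane_def)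
  \<comment> \<open>Re \<beta> > -1/2 leaves 0 as the only nonpositive integer, and \<beta> \<noteq>
    0 is assumed.\<close>
  have \<beta>np: "\<beta> \<notin> \<int>\<^sub>\<le>\<^sub>0"
  proof
    assume "\<beta> \<in> \<int>\<^sub>\<le>\<^sub>0"
    then obtain n where n: "\<beta> = - of_nat n" by (elim nonpos_Ints_cases')
    hence "n = 0" using endpoint(1) by simp
    thus False using n nonzero(5) by simp
  qed
  have G: "Gamma \<beta> \<noteq> 0" "Gamma (lam + 1) \<noteq> 0" "Gamma (\<mu> + 1) \<noteq> 0" "Gamma (\<alpha> + \<gamma> + 1) \<noteq> 0"
    "Gamma s \<noteq> 0" "Gamma (\<alpha> - \<beta> + lam) \<noteq> 0" "Gamma (2 * \<beta> + \<mu>) \<noteq> 0"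
    "Gamma (\<alpha> + \<gamma> + lam + 1) \<noteq> 0" "Gamma (\<beta> + \<gamma> - lam + 1) \<noteq> 0"
    using poles_left poles_right \<beta>np by (simp_all add: Gamma_nonzero s_def)
  \<comment> \<open>The constant factors of \<open>jacobi_P\<close> and \<open>gegenbauer_C\<close>;
    what they leave of the integrand is \<open>core_integrand\<close>.\<close>
  define k where "k = Gamma (\<alpha> - \<beta> + lam) / Gamma (lam + 1) *
     (of_real (sqrt pi) * Gamma (2 * \<beta> + \<mu>) / (2 powr (2 * \<beta> - 1) * Gamma \<beta> * Gamma (\<mu> + 1)))"
  have k: "k \<noteq> 0" using G by (simp add: k_def)
  have ci: "laplace_integrand lam \<mu> \<gamma> \<alpha> \<beta> z w x = k * core_integrand lam \<mu> \<beta> \<delta> s z w x" for w x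
  proof -
    have "jacobi_P lam (\<alpha> - \<beta> - 1) (\<beta> + \<mu>) (of_real (2 * w\<^sup>2 - 1)) =
      Gamma (\<alpha> - \<beta> + lam) / Gamma (lam + 1) * hyp_reg (- lam) (\<delta> + \<beta> + lam + \<mu>) \<delta> (of_real (1 - w\<^sup>2))"
    proof -
      have "(1 - complex_of_real (2 * w\<^sup>2 - 1)) / 2 = of_real (1 - w\<^sup>2)" by (simp add: field_simps)
      moreover have "\<alpha> - \<beta> - 1 + lam + 1 = \<alpha> - \<beta> + lam" "\<alpha> - \<beta> - 1 + (\<beta> + \<mu>) + lam + 1 = \<delta> + \<beta> + lam + \<mu>" "\<alpha> - \<beta> - 1 + 1 = \<delta>"
        by (simp_all add: \<delta>_def)
      ultimately show ?thesis unfolding jacobi_P_def by (simp only:)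
    qed
    moreover have "gegenbauer_C \<mu> \<beta> (of_real x) = (of_real (sqrt pi) * Gamma (2 * \<beta> + \<mu>) / (2 powr (2 * \<beta> - 1) * Gamma \<beta> * Gamma (\<mu> + 1))) *
       hyp_reg (- \<mu>) (2 * \<beta> + \<mu>) (\<beta> + 1/2) (of_real ((1 - x) / 2))"
      unfolding gegenbauer_C_def by simp
    moreover have "\<alpha> - \<beta> - 1 = \<delta> - 1" by (simp add: \<delta>_def)
    ultimately show ?thesis
      unfolding laplace_integrand_def core_integrand_def laplace_base_def k_def s_def by (simp only: mult_ac)
  qed
  have ck: "indicator ({1<..} \<times> {1<..}) t *\<^sub>R (case t of (w, x) \<Rightarrow> laplace_integrand lam \<mu> \<gamma> \<alpha> \<beta> z w x) = k * core_kernel lam \<mu> \<beta> \<delta> s z t" for t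
    by (cases t) (auto simp: core_kernel_def ci indicator_def)
  have intk: "integrable (lborel \<Otimes>\<^sub>M lborel) (\<lambda>t. k * core_kernel lam \<mu> \<beta> \<delta> s z t)"
    using convergent unfolding set_integrable_def ck by (simp add: lborel_prod)
  have int: "integrable (lborel \<Otimes>\<^sub>M lborel) (core_kernel lam \<mu> \<beta> \<delta> s z)"
    using integrable_mult_right[OF intk, of "1 / k"] k by simp
  have case_prod_pair_eq: "(\<lambda>(w, x). k * core_kernel lam \<mu> \<beta> \<delta> s z (w, x)) = (\<lambda>t. k * core_kernel lam \<mu> \<beta> \<delta> s z t)"
    by auto
  define I where "I = (\<integral>t. core_kernel lam \<mu> \<beta> \<delta> s z t \<partial>(lborel \<Otimes>\<^sub>M lborel))"
  \<comment> \<open>The theorem integrates over w first and x last, while the kernel takes (w, x);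
    hence Fubini's theorem with the second variable outermost.\<close>
  have "(CLINT x:{1<..}|lborel. (CLINT w:{1<..}|lborel. laplace_integrand lam \<mu> \<gamma> \<alpha> \<beta> z w x)) =
      (\<integral>x. (\<integral>w. k * core_kernel lam \<mu> \<beta> \<delta> s z (w, x) \<partial>lborel) \<partial>lborel)"
    unfolding set_lebesgue_integral_def
  proof (intro Bochner_Integration.integral_cong refl)
    fix x :: real
    show "indicator {1<..} x *\<^sub>R (\<integral>w. indicator {1<..} w *\<^sub>R laplace_integrand lam \<mu> \<gamma> \<alpha> \<beta> z w x \<partial>lborel) =
        (\<integral>w. k * core_kernel lam \<mu> \<beta> \<delta> s z (w, x) \<partial>lborel)"
    proof (cases "x > 1")
      case True
      have "indicator {1<..} w *\<^sub>R laplace_integrand lam \<mu> \<gamma> \<alpha> \<beta> z w x = k * core_kernel lam \<mu> \<beta> \<delta> s z (w, x)" for w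
        using True by (auto simp: core_kernel_def ci indicator_def)
      thus ?thesis using True by simp
    qed (simp add: core_kernel_def)
  qed
  also have "\<dots> = (\<integral>t. k * core_kernel lam \<mu> \<beta> \<delta> s z t \<partial>(lborel \<Otimes>\<^sub>M lborel))"
    by (rule lborel_pair.integral_snd[of "\<lambda>w x. k * core_kernel lam \<mu> \<beta> \<delta> s z (w, x)", unfolded case_prod_pair_eq, OF intk])
  also have "\<dots> = k * I" by (simp add: I_def)
  finally have lhs: "(CLINT x:{1<..}|lborel. (CLINT w:{1<..}|lborel. laplace_integrand lam \<mu> \<gamma> \<alpha> \<beta> z w x)) = k * I" .
  have id: "core_factor lam \<mu> \<beta> \<delta> s * I = core_rhs lam \<mu> \<beta> \<delta> s z"
    unfolding I_def by (rule core_identity[OF _ _ zc int]) (use endpoint in \<open>auto simp: \<delta>_def\<close>)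
  define h where "h = hyp_reg (\<gamma> - lam - \<mu> + 1) (\<alpha> + \<gamma> + lam + 1) (\<alpha> + \<beta> + 2 * \<gamma> + 2) (2 / (1 - z))"
  \<comment> \<open>The dictionary from (\<delta>, s) back to (\<alpha>, \<gamma>). The third
    parameter \<alpha> + \<beta> + 2 \<gamma> + 2 involves neither \<lambda> nor \<mu>, because the
    shifts in Q cancel there.\<close>
  have e: "s - 2 * \<beta> - \<delta> - lam - \<mu> = \<gamma> - lam - \<mu> + 1" "s + lam + \<mu> = \<alpha> + \<beta> + \<gamma> + lam + \<mu> + 1"
    "s - \<beta> + lam = \<alpha> + \<gamma> + lam + 1" "s - \<beta> - \<delta> - lam = \<beta> + \<gamma> - lam + 1" "s - \<beta> = \<alpha> + \<gamma> + 1"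
    "2 * s - 2 * \<beta> - \<delta> = \<alpha> + \<beta> + 2 * \<gamma> + 2" "\<mu> / 2 - s + \<beta> = \<mu> / 2 - (\<alpha> + \<gamma> + 1)"
    by (simp_all add: s_def \<delta>_def algebra_simps)
  have rg: "rGamma y = 1 / Gamma y" for y :: complex by (simp add: rGamma_inverse_Gamma inverse_eq_divide)
  have id': "4 * of_real (sqrt pi) / Gamma (\<gamma> - lam - \<mu> + 1) / Gamma (\<alpha> + \<beta> + \<gamma> + lam + \<mu> + 1) / Gamma (\<alpha> + \<gamma> + lam + 1) / Gamma (\<beta> + \<gamma> - lam + 1) * I =
     2 powr s / Gamma (\<alpha> + \<gamma> + 1) / Gamma s * (z - 1) powr (\<mu> / 2 - (\<alpha> + \<gamma> + 1)) * (z + 1) powr (- \<beta> - \<mu> / 2) * h"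
    using id unfolding core_factor_def core_rhs_def e(1-4,6,7) unfolding e(5) rg h_def by simp
  define A B where "A = z - 1" and "B = z + 1"
  have Q: "jacobi_Q (\<gamma> - lam - \<mu>) (\<alpha> + 2 * lam + \<mu>) (\<beta> + \<mu>) z =
     2 powr (s - 1 + lam + \<mu>) * Gamma (\<alpha> + \<gamma> + lam + 1) * Gamma (\<beta> + \<gamma> - lam + 1) / (A powr (\<alpha> + \<gamma> + lam + 1) * B powr (\<beta> + \<mu>)) * h"
  proof -
    have q: "\<alpha> + 2 * lam + \<mu> + (\<beta> + \<mu>) + (\<gamma> - lam - \<mu>) = s - 1 + lam + \<mu>" "\<alpha> + 2 * lam + \<mu> + (\<gamma> - lam - \<mu>) + 1 = \<alpha> + \<gamma> + lam + 1"
      "\<beta> + \<mu> + (\<gamma> - lam - \<mu>) + 1 = \<beta> + \<gamma> - lam + 1" "\<alpha> + 2 * lam + \<mu> + (\<beta> + \<mu>) + 2 * (\<gamma> - lam - \<mu>) + 2 = \<alpha> + \<beta> + 2 * \<gamma> + 2"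
      by (simp_all add: s_def algebra_simps)
    show ?thesis unfolding jacobi_Q_def q A_def B_def h_def ..
  qed
  have pA: "A powr (lam + \<mu> / 2) / A powr (\<alpha> + \<gamma> + lam + 1) = A powr (\<mu> / 2 - (\<alpha> + \<gamma> + 1))"
    unfolding powr_diff[symmetric] by (rule arg_cong[where f="\<lambda>e. A powr e"]) simp
  have pB: "B powr (\<mu> / 2) / B powr (\<beta> + \<mu>) = B powr (- \<beta> - \<mu> / 2)"
    unfolding powr_diff[symmetric] by (rule arg_cong[where f="\<lambda>e. B powr e"]) (simp add: field_simps)
  define p where "p = A powr (\<mu> / 2 - (\<alpha> + \<gamma> + 1)) * B powr (- \<beta> - \<mu> / 2)"
  have "A powr (lam + \<mu> / 2) * B powr (\<mu> / 2) * jacobi_Q (\<gamma> - lam - \<mu>) (\<alpha> + 2 * lam + \<mu>) (\<beta> + \<mu>) z =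
     2 powr (s - 1 + lam + \<mu>) * Gamma (\<alpha> + \<gamma> + lam + 1) * Gamma (\<beta> + \<gamma> - lam + 1) *
     ((A powr (lam + \<mu> / 2) / A powr (\<alpha> + \<gamma> + lam + 1)) * (B powr (\<mu> / 2) / B powr (\<beta> + \<mu>))) * h"
    unfolding Q by simp
  also have "\<dots> = 2 powr (s - 1 + lam + \<mu>) * Gamma (\<alpha> + \<gamma> + lam + 1) * Gamma (\<beta> + \<gamma> - lam + 1) * p * h"
    unfolding pA pB p_def ..
  also have "2 powr (s - 1 + lam + \<mu>) = 2 powr s * (2 powr (lam + \<mu>) / 2)"
  proof -
    have "2 powr (s - 1 + lam + \<mu>) = 2 powr s * 2 powr (lam + \<mu> - 1)"
      unfolding powr_add[symmetric] by (simp add: algebra_simps)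
    also have "2 powr (lam + \<mu> - 1) = 2 powr (lam + \<mu>) / (2 :: complex)" by (simp add: powr_diff)
    finally show ?thesis .
  qed
  finally have L: "A powr (lam + \<mu> / 2) * B powr (\<mu> / 2) * jacobi_Q (\<gamma> - lam - \<mu>) (\<alpha> + 2 * lam + \<mu>) (\<beta> + \<mu>) z =
    Gamma (\<alpha> + \<gamma> + lam + 1) * Gamma (\<beta> + \<gamma> - lam + 1) * (2 powr (lam + \<mu>) / 2) * (2 powr s * p * h)"
    by (simp only: mult_ac)
  have id2: "2 powr s * p * h = Gamma (\<alpha> + \<gamma> + 1) * Gamma s *
     (4 * of_real (sqrt pi) / Gamma (\<gamma> - lam - \<mu> + 1) / Gamma (\<alpha> + \<beta> + \<gamma> + lam + \<mu> + 1) / Gamma (\<alpha> + \<gamma> + lam + 1) / Gamma (\<beta> + \<gamma> - lam + 1) * I)"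
    unfolding id' p_def A_def B_def using G by simp
  \<comment> \<open>The denominator 2^(2 \<beta> - 1) of the Gegenbauer constant in k cancels the
    power 2^(2 \<beta>) of the prefactor. The remaining 2 is the 4 of \<open>core_factor\<close>
    halved by the power of 2 in Q.\<close>
  have p2: "2 powr (2 * \<beta> + lam + \<mu>) / 2 powr (2 * \<beta> - 1) = 2 * 2 powr (lam + \<mu>)"
  proof -
    have "2 powr (2 * \<beta> + lam + \<mu>) = 2 powr (2 * \<beta> - 1) * (2 powr 1 * 2 powr (lam + \<mu> :: complex))"
      unfolding powr_add[symmetric] by (simp add: algebra_simps)
    thus ?thesis by simp
  qed
  have "A powr (lam + \<mu> / 2) * B powr (\<mu> / 2) * jacobi_Q (\<gamma> - lam - \<mu>) (\<alpha> + 2 * lam + \<mu>) (\<beta> + \<mu>) z =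
     (2 * 2 powr (lam + \<mu>)) * of_real (sqrt pi) * Gamma (\<alpha> + \<gamma> + 1) * Gamma s / (Gamma (\<gamma> - lam - \<mu> + 1) * Gamma (\<alpha> + \<beta> + \<gamma> + lam + \<mu> + 1)) * I"
    unfolding L id2 using G by simp
  also have "\<dots> = 2 powr (2 * \<beta> + lam + \<mu>) * Gamma \<beta> * Gamma (lam + 1) * Gamma (\<mu> + 1) * Gamma (\<alpha> + \<gamma> + 1) * Gamma s
      / (Gamma (\<alpha> - \<beta> + lam) * Gamma (2 * \<beta> + \<mu>) * Gamma (\<gamma> - lam - \<mu> + 1) * Gamma (\<alpha> + \<beta> + \<gamma> + lam + \<mu> + 1)) * (k * I)"
    unfolding p2[symmetric] k_def using G by (simp add: mult_ac)
  finally show ?thesis unfolding lhs A_def B_def s_def .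
qed

end
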